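(* In an $N_W=N$ SUSY vertex algebra $V$ the following identities hold for all homogeneous $a,b\in V$, all $j\in\mathbb Z$, $J\subset\{1,\dots,N\}$ and $i=1,\dots,N$: (1) $Y(a_{(j|J)}b,Z)=\sigma(J)\,Y(a,Z)_{(j|J)}Y(b,Z)$; (2) $Y(a_{(-1|N)}b,Z)=\,:Y(a,Z)Y(b,Z):$; (3) $Y(Ta,Z)=\partial_zY(a,Z)$; (4) $Y(S^ia,Z)=\partial_{\theta^i}Y(a,Z)$; (5) (OPE formula, the sums being finite) $$[Y(a,Z),Y(b,W)]=\sum_{(j|J):\,j\ge0}\sigma(J)\bigl(\partial_W^{(j|J)}\delta(Z,W)\bigr)Y(a_{(j|J)}b,W)=\sum_{(j|J):\,j\ge0}(i_{z,w}-i_{w,z})(Z-W)^{-1-j|N\setminus J}\,Y(a_{(j|J)}b,W).$$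
   Context: Ground field $\mathbb C$; $N\ge0$ a fixed integer. $Z=(z,\theta^1,\dots,\theta^N)$, $W=(w,\zeta^1,\dots,\zeta^N)$, $z,w$ even, $\theta^i,\zeta^i$ odd; odd variables anticommute with each other and supercommute with elements of superspaces; $[\ ,\ ]$ is the supercommutator. In exponents of $-1$, $a$ means the parity of $a$ and $J$ means $\#J$. For $J=\{j_1<\dots<j_k\}\subset\{1,\dots,N\}$, $\theta^J=\theta^{j_1}\cdots\theta^{j_k}$, $Z^{j|J}=z^j\theta^J$; "$N$" as a set means $\{1,\dots,N\}$; $\sigma(J)=\pm1$ is defined by $\theta^J\theta^{N\setminus J}=\sigma(J)\theta^1\cdots\theta^N$. $(Z-W)^{j|J}=(z-w)^j\prod_{i\in J}(\theta^i-\zeta^i)$ (increasing order); $\partial_W^{(j|J)}=\frac{(-1)^{J(J+1)/2}}{j!}\partial_w^j\partial_{\zeta^{j_1}}\cdots\partial_{\zeta^{j_k}}$; $i_{z,w}$, $i_{w,z}$ are expansions in the domains $|z|>|w|$, $|w|>|z|$; $\delta(Z,W)=(i_{z,w}-i_{w,z})(Z-W)^{-1|N}$. $\mathrm{res}_Z$ is the coefficient of $z^{-1}\theta^1\cdots\theta^N$ (written to the right of it). For $\mathrm{End}(V)$-valued fields (formal sums $a(Z)=\sum_{n\in\mathbb Z,I}Z^{n|I}a_{n|I}$ with $a(Z)v\in V((z))[\theta^1,\dots,\theta^N]$ for all $v\in V$) of parities $p(a),p(b)$, and all $(j|J)$, the $(j|J)$-product is $$a(W)_{(j|J)}b(W)=\mathrm{res}_Z\bigl(i_{z,w}(Z-W)^{j|J}a(Z)b(W)-(-1)^{p(a)p(b)}i_{w,z}(Z-W)^{j|J}b(W)a(Z)\bigr),$$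 and the normally ordered product is $:a(Z)b(Z):\,=a_+(Z)b(Z)+(-1)^{p(a)p(b)}b(Z)a_-(Z)$, where $a_+(Z)=\sum_{n\ge0,I}Z^{n|I}a_{n|I}$, $a_-(Z)=a(Z)-a_+(Z)$. An $N_W=N$ SUSY vertex algebra is a vector superspace $V$ with an even vector $|0\rangle$, an even operator $T$, odd operators $S^1,\dots,S^N$, and a parity preserving linear map $Y$ sending $a\in V$ to an $\mathrm{End}(V)$-valued field $Y(a,Z)=\sum_{j\in\mathbb Z,J}Z^{-1-j|N\setminus J}a_{(j|J)}$, $a_{(j|J)}\in\mathrm{End}(V)$, such that: $Y(a,Z)|0\rangle\in V[[z]][\theta^1,\dots,\theta^N]$ has value $a$ at $Z=0$, $T|0\rangle=S^i|0\rangle=0$; $[T,Y(a,Z)]=\partial_zY(a,Z)$, $[S^i,Y(a,Z)]=\partial_{\theta^i}Y(a,Z)$; for all $a,b$, $(z-w)^n[Y(a,Z),Y(b,W)]=0$ for some $n\ge0$. One writes $a_{(j|J)}b=a_{(j|J)}(b)$ for $a,b\in V$. *)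

theory Defs
  imports Complex_Main "HOL-Library.Groups_Big_Fun"
begin

text \<open>
  An \<open>'e sdist\<close> \<open>A\<close> stands for the formal sum of all \<open>Z^{n|I} A n I\<close>, and an \<open>'e sdist2\<close> \<open>B\<close> for
  the formal sum of all \<open>Z^{n|I} W^{m|K} B n I m K\<close> (coefficients always to the right of the
  monomials). Here \<open>I, K\<close> are subsets of \<open>{1..N}\<close>; by convention coefficients
  at all other index sets are zero, so that equality of functions is equality of formal sums.
  An operator-valued sum has coefficients of type \<open>'v \<Rightarrow> 'v\<close>.

  Parities are natural numbers, relevant only modulo 2. The scalar multiplication of the
  complex superspace is the argument \<open>s\<close>.
\<close>

type_synonym 'e sdist = "int \<Rightarrow> nat set \<Rightarrow> 'e"
type_synonym 'e sdist2 = "int \<Rightarrow> nat set \<Rightarrow> int \<Rightarrow> nat set \<Rightarrow> 'e"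


section \<open>Signs\<close>

text \<open>For disjoint \<open>I, K\<close>: \<open>\<theta>^I \<theta>^K = shuffle_sign I K * \<theta>^(I \<union> K)\<close>.\<close>

definition shuffle_sign :: "nat set \<Rightarrow> nat set \<Rightarrow> complex" where
  "shuffle_sign I K = (-1) ^ card {(i, k). i \<in> I \<and> k \<in> K \<and> k < i}"

definition sigma :: "nat \<Rightarrow> nat set \<Rightarrow> complex" where
  "sigma N J = shuffle_sign J ({1..N} - J)"


section \<open>Multiplication by scalar distributions in two variables\<close>

text \<open>
  The sign comes from
  \<open>(\<theta>^I' \<zeta>^K') (\<theta>^I'' \<zeta>^K'') = (-1)^(card K' * card I'') (\<theta>^I' \<theta>^I'') (\<zeta>^K' \<zeta>^K'')\<close>.
  The sum over the even exponents is a \<open>Sum_any\<close>, hence meaningful only if it has finitely many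
  nonzero terms. For operator-valued sums finiteness is only needed after application to
  each vector; it then holds in every product formed below from fields.
\<close>

definition mult2 ::
  "(complex \<Rightarrow> 'e \<Rightarrow> 'e) \<Rightarrow> complex sdist2 \<Rightarrow> 'e::ab_group_add sdist2 \<Rightarrow> 'e sdist2" where
  "mult2 s f A = (\<lambda>n I m K.
     \<Sum>I'\<in>Pow I. \<Sum>K'\<in>Pow K. Sum_any (\<lambda>(n', m').
       s ((-1) ^ (card K' * card (I - I')) * shuffle_sign I' (I - I') * shuffle_sign K' (K - K')
            * f n' I' m' K')
         (A (n - n') (I - I') (m - m') (K - K'))))"

definition op_mult2 ::
  "(complex \<Rightarrow> 'v \<Rightarrow> 'v) \<Rightarrow> complex sdist2 \<Rightarrow> ('v::ab_group_add \<Rightarrow> 'v) sdist2 \<Rightarrow> ('v \<Rightarrow> 'v) sdist2"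
  where
  "op_mult2 s f A = (\<lambda>n I m K v. mult2 s f (\<lambda>n I m K. A n I m K v) n I m K)"


section \<open>Expansions of \<open>(Z - W)^{j|J}\<close> and the super delta function\<close>

definition theta :: "nat \<Rightarrow> complex sdist2" where
  "theta i = (\<lambda>n I m K. if n = 0 \<and> I = {i} \<and> m = 0 \<and> K = {} then 1 else 0)"

definition zeta :: "nat \<Rightarrow> complex sdist2" where
  "zeta i = (\<lambda>n I m K. if n = 0 \<and> I = {} \<and> m = 0 \<and> K = {i} then 1 else 0)"

text \<open>
  The expansions of \<open>(z - w)^j\<close> for \<open>|z| > |w|\<close> and for \<open>|w| > |z|\<close>, by the binomial series.
\<close>

definition even_zw :: "int \<Rightarrow> complex sdist2" where
  "even_zw j = (\<lambda>n I m K.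
     if I = {} \<and> K = {} \<and> n + m = j \<and> m \<ge> 0 then (-1) powi m * (of_int j gchoose nat m) else 0)"

definition even_wz :: "int \<Rightarrow> complex sdist2" where
  "even_wz j = (\<lambda>n I m K.
     if I = {} \<and> K = {} \<and> n + m = j \<and> n \<ge> 0 then (-1) powi m * (of_int j gchoose nat n) else 0)"

definition times_odd :: "nat set \<Rightarrow> complex sdist2 \<Rightarrow> complex sdist2" where
  "times_odd J f =
     foldr (\<lambda>i. mult2 (*) (\<lambda>n I m K. theta i n I m K - zeta i n I m K)) (sorted_list_of_set J) f"

definition ipow_zw :: "int \<Rightarrow> nat set \<Rightarrow> complex sdist2" where
  "ipow_zw j J = times_odd J (even_zw j)"

definition ipow_wz :: "int \<Rightarrow> nat set \<Rightarrow> complex sdist2" where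
  "ipow_wz j J = times_odd J (even_wz j)"

definition ipow_diff :: "int \<Rightarrow> nat set \<Rightarrow> complex sdist2" where
  "ipow_diff j J = (\<lambda>n I m K. ipow_zw j J n I m K - ipow_wz j J n I m K)"

definition super_delta :: "nat \<Rightarrow> complex sdist2" where
  "super_delta N = ipow_diff (-1) {1..N}"


section \<open>Derivatives\<close>

definition dw :: "complex sdist2 \<Rightarrow> complex sdist2" where
  "dw f = (\<lambda>n I m K. of_int (m + 1) * f n I (m + 1) K)"

text \<open>Odd derivatives are left derivatives; \<open>\<partial>\<^sub>\<zeta>\<close> has to pass \<open>\<theta>^I\<close>.\<close>

definition dzeta :: "nat \<Rightarrow> complex sdist2 \<Rightarrow> complex sdist2" where
  "dzeta i f = (\<lambda>n I m K.
     if i \<in> K then 0 else (-1) ^ (card I + card {k \<in> K. k < i}) * f n I m (insert i K))"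

definition dW :: "nat \<Rightarrow> nat set \<Rightarrow> complex sdist2 \<Rightarrow> complex sdist2" where
  "dW j J f = (\<lambda>n I m K.
     (-1) ^ (card J * (card J + 1) div 2) / fact j
       * (dw ^^ j) (foldr dzeta (sorted_list_of_set J) f) n I m K)"

definition dz :: "(complex \<Rightarrow> 'v \<Rightarrow> 'v) \<Rightarrow> ('v \<Rightarrow> 'v) sdist \<Rightarrow> ('v \<Rightarrow> 'v) sdist" where
  "dz s A = (\<lambda>n I v. s (of_int (n + 1)) (A (n + 1) I v))"

definition dtheta ::
  "(complex \<Rightarrow> 'v::zero \<Rightarrow> 'v) \<Rightarrow> nat \<Rightarrow> ('v \<Rightarrow> 'v) sdist \<Rightarrow> ('v \<Rightarrow> 'v) sdist" where
  "dtheta s i A = (\<lambda>n I v.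
     if i \<in> I then 0 else s ((-1) ^ card {k \<in> I. k < i}) (A n (insert i I) v))"


section \<open>Superspaces and fields\<close>

definition homog :: "'v set \<Rightarrow> 'v set \<Rightarrow> nat \<Rightarrow> 'v set" where
  "homog V0 V1 p = (if even p then V0 else V1)"

locale superspace = vector_space s
  for s :: "complex \<Rightarrow> 'v::ab_group_add \<Rightarrow> 'v" +
  fixes V0 V1 :: "'v set"
  assumes subspace_even: "subspace V0"
    and subspace_odd: "subspace V1"
    and direct: "V0 \<inter> V1 = {0}"
    and decomposition: "\<exists>x\<in>V0. \<exists>y\<in>V1. v = x + y"

definition op_parity ::
  "(complex \<Rightarrow> 'v::ab_group_add \<Rightarrow> 'v) \<Rightarrow> 'v set \<Rightarrow> 'v set \<Rightarrow> nat \<Rightarrow> ('v \<Rightarrow> 'v) \<Rightarrow> bool" where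
  "op_parity s V0 V1 p A \<longleftrightarrow> Vector_Spaces.linear s s A
     \<and> (\<forall>q. \<forall>v\<in>homog V0 V1 q. A v \<in> homog V0 V1 (p + q))"

definition susy_field ::
  "(complex \<Rightarrow> 'v::ab_group_add \<Rightarrow> 'v) \<Rightarrow> nat \<Rightarrow> ('v \<Rightarrow> 'v) sdist \<Rightarrow> bool" where
  "susy_field s N A \<longleftrightarrow> (\<forall>n I. Vector_Spaces.linear s s (A n I))
     \<and> (\<forall>n I v. \<not> I \<subseteq> {1..N} \<longrightarrow> A n I v = 0)
     \<and> (\<forall>v. \<exists>n0. \<forall>n<n0. \<forall>I. A n I v = 0)"

text \<open>\<open>A(Z)\<close> has parity \<open>p\<close> iff its coefficient at \<open>Z^{n|I}\<close> has parity \<open>p + card I\<close>.\<close>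

definition field_parity ::
  "(complex \<Rightarrow> 'v::ab_group_add \<Rightarrow> 'v) \<Rightarrow> 'v set \<Rightarrow> 'v set \<Rightarrow> nat \<Rightarrow> ('v \<Rightarrow> 'v) sdist \<Rightarrow> bool" where
  "field_parity s V0 V1 p A \<longleftrightarrow> (\<forall>n I. op_parity s V0 V1 (p + card I) (A n I))"


section \<open>Products of homogeneous fields\<close>

text \<open>
  In what follows \<open>p\<close> and \<open>q\<close> are the parities of the fields \<open>a\<close> and \<open>b\<close>.

  In \<open>a(Z) b(W)\<close>, the coefficient \<open>a n I\<close>, of parity \<open>p + card I\<close>, is moved past \<open>W^{m|K}\<close>.
  In \<open>b(W) a(Z)\<close>, the monomial \<open>Z^{n|I}\<close> is moved to the left past \<open>W^{m|K} (b m K)\<close>, which has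
  parity \<open>q\<close>.
\<close>

definition prod_ZW ::
  "(complex \<Rightarrow> 'v \<Rightarrow> 'v) \<Rightarrow> nat \<Rightarrow> ('v \<Rightarrow> 'v) sdist \<Rightarrow> ('v \<Rightarrow> 'v) sdist \<Rightarrow> ('v \<Rightarrow> 'v) sdist2" where
  "prod_ZW s p a b = (\<lambda>n I m K v. s ((-1) ^ ((p + card I) * card K)) (a n I (b m K v)))"

definition prod_WZ ::
  "(complex \<Rightarrow> 'v \<Rightarrow> 'v) \<Rightarrow> nat \<Rightarrow> ('v \<Rightarrow> 'v) sdist \<Rightarrow> ('v \<Rightarrow> 'v) sdist \<Rightarrow> ('v \<Rightarrow> 'v) sdist2" where
  "prod_WZ s q b a = (\<lambda>n I m K v. s ((-1) ^ (q * card I)) (b m K (a n I v)))"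

definition supercomm ::
  "(complex \<Rightarrow> 'v::ab_group_add \<Rightarrow> 'v) \<Rightarrow> nat \<Rightarrow> nat \<Rightarrow> ('v \<Rightarrow> 'v) sdist \<Rightarrow> ('v \<Rightarrow> 'v) sdist
     \<Rightarrow> ('v \<Rightarrow> 'v) sdist2" where
  "supercomm s p q a b = (\<lambda>n I m K v.
     prod_ZW s p a b n I m K v - s ((-1) ^ (p * q)) (prod_WZ s q b a n I m K v))"

text \<open>
  The supercommutator of an operator \<open>D\<close> of parity \<open>d\<close> with a field of parity \<open>p\<close>;
  \<open>D\<close> is moved past \<open>Z^{n|I}\<close>.
\<close>

definition op_supercomm ::
  "(complex \<Rightarrow> 'v::ab_group_add \<Rightarrow> 'v) \<Rightarrow> nat \<Rightarrow> nat \<Rightarrow> ('v \<Rightarrow> 'v) \<Rightarrow> ('v \<Rightarrow> 'v) sdist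
     \<Rightarrow> ('v \<Rightarrow> 'v) sdist" where
  "op_supercomm s d p D a = (\<lambda>n I v.
     s ((-1) ^ (d * card I)) (D (a n I v)) - s ((-1) ^ (d * p)) (a n I (D v)))"

definition res_Z :: "nat \<Rightarrow> ('v \<Rightarrow> 'v) sdist2 \<Rightarrow> ('v \<Rightarrow> 'v) sdist" where
  "res_Z N A = (\<lambda>m K. A (-1) {1..N} m K)"

definition field_nth_prod ::
  "(complex \<Rightarrow> 'v::ab_group_add \<Rightarrow> 'v) \<Rightarrow> nat \<Rightarrow> nat \<Rightarrow> nat \<Rightarrow> ('v \<Rightarrow> 'v) sdist \<Rightarrow> int \<Rightarrow> nat set
     \<Rightarrow> ('v \<Rightarrow> 'v) sdist \<Rightarrow> ('v \<Rightarrow> 'v) sdist" where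
  "field_nth_prod s N p q a j J b = res_Z N (\<lambda>n I m K v.
     op_mult2 s (ipow_zw j J) (prod_ZW s p a b) n I m K v
     - s ((-1) ^ (p * q)) (op_mult2 s (ipow_wz j J) (prod_WZ s q b a) n I m K v))"

text \<open>
  The product \<open>a(Z) b(Z)\<close> in one variable, for \<open>a\<close> of parity \<open>p\<close>: the coefficient \<open>a k I\<close> is moved
  past \<open>\<theta>^(L - I)\<close>. As above, the sum over \<open>k\<close> must have finitely many nonzero terms on each vector.
\<close>

definition prod_ZZ ::
  "(complex \<Rightarrow> 'v::ab_group_add \<Rightarrow> 'v) \<Rightarrow> nat \<Rightarrow> ('v \<Rightarrow> 'v) sdist \<Rightarrow> ('v \<Rightarrow> 'v) sdist
     \<Rightarrow> ('v \<Rightarrow> 'v) sdist" where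
  "prod_ZZ s p a b = (\<lambda>n L v. \<Sum>I\<in>Pow L. Sum_any (\<lambda>k.
     s (shuffle_sign I (L - I) * (-1) ^ ((p + card I) * card (L - I)))
       (a k I (b (n - k) (L - I) v))))"

definition plus_part :: "('v \<Rightarrow> 'v::zero) sdist \<Rightarrow> ('v \<Rightarrow> 'v) sdist" where
  "plus_part a = (\<lambda>n I v. if n \<ge> 0 then a n I v else 0)"

definition minus_part :: "('v \<Rightarrow> 'v::ab_group_add) sdist \<Rightarrow> ('v \<Rightarrow> 'v) sdist" where
  "minus_part a = (\<lambda>n I v. a n I v - plus_part a n I v)"

definition normal_prod ::
  "(complex \<Rightarrow> 'v::ab_group_add \<Rightarrow> 'v) \<Rightarrow> nat \<Rightarrow> nat \<Rightarrow> ('v \<Rightarrow> 'v) sdist \<Rightarrow> ('v \<Rightarrow> 'v) sdist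
     \<Rightarrow> ('v \<Rightarrow> 'v) sdist" where
  "normal_prod s p q a b = (\<lambda>n L v.
     prod_ZZ s p (plus_part a) b n L v
     + s ((-1) ^ (p * q)) (prod_ZZ s q b (minus_part a) n L v))"

text \<open>\<open>c(W)\<close> as a formal sum in \<open>Z\<close> and \<open>W\<close>.\<close>

definition in_W :: "('v \<Rightarrow> 'v::zero) sdist \<Rightarrow> ('v \<Rightarrow> 'v) sdist2" where
  "in_W c = (\<lambda>n I m K v. if n = 0 \<and> I = {} then c m K v else 0)"


section \<open>SUSY vertex algebras\<close>

text \<open>The operator \<open>a_(j|J)\<close>, from \<open>Y(a,Z) = \<Sum> Z^{-1-j|N-J} a_(j|J)\<close>.\<close>

definition mode :: "nat \<Rightarrow> ('v \<Rightarrow> ('v \<Rightarrow> 'v) sdist) \<Rightarrow> 'v \<Rightarrow> int \<Rightarrow> nat set \<Rightarrow> 'v \<Rightarrow> 'v" where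
  "mode N Y a j J = Y a (-1 - j) ({1..N} - J)"

text \<open>
  Only the \<open>S i\<close> with \<open>i \<in> {1..N}\<close> are part of the structure. Supercommutators are stated
  for homogeneous vectors; they extend to all vectors by linearity.
\<close>

locale nw_susy_vertex_algebra = superspace s V0 V1
  for s :: "complex \<Rightarrow> 'v::ab_group_add \<Rightarrow> 'v" and V0 V1 :: "'v set" +
  fixes N :: nat
    and vac :: 'v
    and T :: "'v \<Rightarrow> 'v"
    and S :: "nat \<Rightarrow> 'v \<Rightarrow> 'v"
    and Y :: "'v \<Rightarrow> ('v \<Rightarrow> 'v) sdist"
  assumes vac_even: "vac \<in> homog V0 V1 0"
    and T_even: "op_parity s V0 V1 0 T"
    and S_odd: "i \<in> {1..N} \<Longrightarrow> op_parity s V0 V1 1 (S i)"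
    and Y_field: "susy_field s N (Y a)"
    and Y_linear: "Vector_Spaces.linear s s (\<lambda>a. Y a n I v)"
    and Y_parity: "a \<in> homog V0 V1 p \<Longrightarrow> field_parity s V0 V1 p (Y a)"
    and Y_vac_regular: "n < 0 \<Longrightarrow> Y a n I vac = 0"
    and Y_vac_value: "Y a 0 {} vac = a"
    and T_vac: "T vac = 0"
    and S_vac: "i \<in> {1..N} \<Longrightarrow> S i vac = 0"
    and T_comm: "a \<in> homog V0 V1 p \<Longrightarrow> op_supercomm s 0 p T (Y a) = dz s (Y a)"
    and S_comm: "a \<in> homog V0 V1 p \<Longrightarrow> i \<in> {1..N} \<Longrightarrow>
      op_supercomm s 1 p (S i) (Y a) = dtheta s i (Y a)"
    and locality: "a \<in> homog V0 V1 p \<Longrightarrow> b \<in> homog V0 V1 q \<Longrightarrow>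
      \<exists>n::nat. op_mult2 s (even_zw (int n)) (supercomm s p q (Y a) (Y b)) = (\<lambda>_ _ _ _ _. 0)"

end

theory Submission
  imports Defs
begin

text \<open>
  Setting all odd variables to zero leaves fields \<open>Y(a,z)\<close> with commutation signs. By Dong's lemma their
  products are local to every \<open>Y(d,w)\<close>, and a translation covariant field local to every \<open>Y(d,w)\<close> is
  determined by its value on the vacuum at \<open>z = 0\<close>. This identifies every coefficient of \<open>\<theta>^I\<close> in \<open>Y(a,Z)\<close>,
  the products of such a coefficient with \<open>Y(b,w)\<close>, and \<open>\<partial>\<^sub>z Y(a,z)\<close> as fields of states, which gives
  (3) and (4) after comparing states, and (1) and (5) at \<open>\<zeta> = 0\<close>. The powers of \<open>\<zeta>\<close> are then reached one
  \<open>\<zeta>^i\<close> at a time, since \<open>\<partial>/\<partial>\<zeta>^i\<close> replaces \<open>Y(x,W)\<close> by \<open>Y(S^i x,W)\<close> and obeys the Leibniz rule.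
\<close>

text \<open>The factor (z-w)^n in the locality axiom contains no odd variable, so locality holds
  separately at each \<theta>^I \<zeta>^K. A coefficient at \<theta>^I is thus an ordinary local
  field of parity p + #I, and only commutation signs remember the odd variables. Locality against
  the \<zeta>^0 parts Y(d,w) suffices for uniqueness, as they already produce every d at w = 0. The
  obstacle in Dong's lemma is the residue in z: afterwards a factor (z-u)^k is useless, so it has to
  be traded for powers of w-u beforehand. The axioms describe [T,Y(a,Z)] and [S^i,Y(a,Z)], not
  Y(Ta,Z) and Y(S^i a,Z). The bridge is that T and S^i kill the vacuum: there the commutators become
  T and S^i themselves, so the states of all components arise from a by applying the S^k. The
  smallest index is always added last, hence an odd derivative meets no smaller index of the set
  built so far. Since \<partial>/\<partial>\<zeta>^i turns b into S^i b, the inductions run over all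
  b at once. Moving S^i through a_(j|J) gives terms with J and with J - {i}; they match the
  derivatives of b and of the kernel.\<close>

section \<open>Difference operators\<close>

text \<open>Multiplication by \<open>z - w\<close>; below, by \<open>z - w\<close>, \<open>z - u\<close> and \<open>w - u\<close> in three variables.\<close>

definition diff :: "(int \<Rightarrow> int \<Rightarrow> 'v::ab_group_add) \<Rightarrow> int \<Rightarrow> int \<Rightarrow> 'v" where
  "diff F = (\<lambda>n m. F (n - 1) m - F n (m - 1))"

definition D12 :: "(int \<Rightarrow> int \<Rightarrow> int \<Rightarrow> 'v::ab_group_add) \<Rightarrow> int \<Rightarrow> int \<Rightarrow> int \<Rightarrow> 'v" where
  "D12 G = (\<lambda>n m l. G (n - 1) m l - G n (m - 1) l)"

definition D13 :: "(int \<Rightarrow> int \<Rightarrow> int \<Rightarrow> 'v::ab_group_add) \<Rightarrow> int \<Rightarrow> int \<Rightarrow> int \<Rightarrow> 'v" where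
  "D13 G = (\<lambda>n m l. G (n - 1) m l - G n m (l - 1))"

definition D23 :: "(int \<Rightarrow> int \<Rightarrow> int \<Rightarrow> 'v::ab_group_add) \<Rightarrow> int \<Rightarrow> int \<Rightarrow> int \<Rightarrow> 'v" where
  "D23 G = (\<lambda>n m l. G n (m - 1) l - G n m (l - 1))"

lemma funpow_commute:
  assumes "\<And>x. f (g x) = g (f x)"
  shows "(f ^^ n) ((g ^^ m) x) = (g ^^ m) ((f ^^ n) x)"
proof -
  have 1: "f ((g ^^ m) x) = (g ^^ m) (f x)" for x
    by (induction m) (auto simp: assms)
  show ?thesis by (induction n) (auto simp: 1)
qed

lemma funpow_diff_zero: "(diff ^^ n) (\<lambda>_ _. 0) = (\<lambda>_ _. 0)"
  by (induction n) (auto simp: diff_def)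

lemma funpow_diff_minus:
  "(diff ^^ n) (\<lambda>k m. F k m - G k m) = (\<lambda>k m. (diff ^^ n) F k m - (diff ^^ n) G k m)"
  by (induction n) (auto simp: diff_def algebra_simps)

lemma funpow_diff_mono:
  assumes "(diff ^^ n) F = (\<lambda>_ _. 0)" "n \<le> n'"
  shows "(diff ^^ n') F = (\<lambda>_ _. 0)"
proof -
  have "(diff ^^ n') F = (diff ^^ (n' - n)) ((diff ^^ n) F)"
    using assms(2) by (simp flip: funpow_add comp_apply[of "diff ^^ (n' - n)"])
  then show ?thesis by (simp add: assms(1) funpow_diff_zero)
qed

lemma funpow_D13_zero: "(D13 ^^ n) (\<lambda>_ _ _. 0) = (\<lambda>_ _ _. 0)"
  by (induction n) (auto simp: D13_def)

lemma funpow_D23_zero: "(D23 ^^ n) (\<lambda>_ _ _. 0) = (\<lambda>_ _ _. 0)"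
  by (induction n) (auto simp: D23_def)

lemma funpow_D13_minus:
  "(D13 ^^ n) (\<lambda>k m l. F k m l - G k m l) = (\<lambda>k m l. (D13 ^^ n) F k m l - (D13 ^^ n) G k m l)"
  by (induction n) (auto simp: D13_def algebra_simps)

lemma funpow_D23_minus:
  "(D23 ^^ n) (\<lambda>k m l. F k m l - G k m l) = (\<lambda>k m l. (D23 ^^ n) F k m l - (D23 ^^ n) G k m l)"
  by (induction n) (auto simp: D23_def algebra_simps)

lemma funpow_D13_plus:
  "(D13 ^^ n) (\<lambda>k m l. F k m l + G k m l) = (\<lambda>k m l. (D13 ^^ n) F k m l + (D13 ^^ n) G k m l)"
  by (induction n) (auto simp: D13_def algebra_simps)

lemma funpow_D23_plus:
  "(D23 ^^ n) (\<lambda>k m l. F k m l + G k m l) = (\<lambda>k m l. (D23 ^^ n) F k m l + (D23 ^^ n) G k m l)"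
  by (induction n) (auto simp: D23_def algebra_simps)

lemma D13_D23: "D13 (D23 G) = D23 (D13 G)"
  by (auto simp: D13_def D23_def algebra_simps)

lemma D12_D13: "D12 (D13 G) = D13 (D12 G)"
  by (auto simp: D13_def D12_def algebra_simps)

lemma D12_D23: "D12 (D23 G) = D23 (D12 G)"
  by (auto simp: D23_def D12_def algebra_simps)

text \<open>\<open>w - u = (z - u) - (z - w)\<close>, so each term of \<open>(w - u)^(\<alpha> + \<beta>)\<close> contains
  \<open>(z - w)^\<alpha>\<close> or \<open>(z - u)^\<beta>\<close>.\<close>

lemma funpow_D23_eq_0:
  assumes "(D12 ^^ \<alpha>) G = (\<lambda>_ _ _. 0)" "(D13 ^^ \<beta>) G = (\<lambda>_ _ _. 0)"
  shows "(D23 ^^ (\<alpha> + \<beta>)) G = (\<lambda>_ _ _. 0)"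
  using assms
proof (induction "\<alpha> + \<beta>" arbitrary: \<alpha> \<beta> G)
  case 0
  then show ?case by simp
next
  case (Suc k)
  show ?case
  proof (cases "\<alpha> = 0 \<or> \<beta> = 0")
    case True
    then have "G = (\<lambda>_ _ _. 0)" using Suc.prems by auto
    then show ?thesis by (simp add: funpow_D23_zero)
  next
    case False
    then obtain \<alpha>' \<beta>' where ab: "\<alpha> = Suc \<alpha>'" "\<beta> = Suc \<beta>'" by (meson not0_implies_Suc)
    have k: "k = \<alpha> + \<beta>'" "k = \<alpha>' + \<beta>" using Suc.hyps(2) ab by auto
    have "(D12 ^^ \<alpha>) (D13 G) = D13 ((D12 ^^ \<alpha>) G)"
      using funpow_commute[of D12 D13 \<alpha> 1 G] by (simp add: D12_D13)
    then have 1: "(D23 ^^ k) (D13 G) = (\<lambda>_ _ _. 0)"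
      using Suc.hyps(1)[OF k(1), of "D13 G"] Suc.prems k(1)
      by (simp add: ab(2) D13_def funpow_swap1)
    have "(D13 ^^ \<beta>) (D12 G) = D12 ((D13 ^^ \<beta>) G)"
      using funpow_commute[of D13 D12 \<beta> 1 G] by (simp add: D12_D13)
    then have 2: "(D23 ^^ k) (D12 G) = (\<lambda>_ _ _. 0)"
      using Suc.hyps(1)[OF k(2), of "D12 G"] Suc.prems k(2)
      by (simp add: ab(1) D12_def funpow_swap1)
    have "D23 G = (\<lambda>n m l. D13 G n m l - D12 G n m l)"
      by (auto simp: D12_def D13_def D23_def)
    then have "(D23 ^^ Suc k) G = (\<lambda>n m l. (D23 ^^ k) (D13 G) n m l - (D23 ^^ k) (D12 G) n m l)"
      by (simp add: funpow_Suc_right funpow_D23_minus del: funpow.simps)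
    then show ?thesis using Suc.hyps(2) by (simp add: 1 2)
  qed
qed

lemma funpow_D13_slice: "(D13 ^^ k) (\<lambda>n m l. H m n l) = (\<lambda>n m l. (diff ^^ k) (H m) n l)"
  by (induction k) (auto simp: D13_def diff_def)

lemma funpow_D23_slice: "(D23 ^^ k) (\<lambda>n m l. H n m l) = (\<lambda>n m l. (diff ^^ k) (H n) m l)"
  by (induction k) (auto simp: D23_def diff_def)

lemma funpow_D12_slice: "(D12 ^^ k) (\<lambda>n m l. H n m l) = (\<lambda>n m l. (diff ^^ k) (\<lambda>n m. H n m l) n m)"
  by (induction k) (auto simp: D12_def diff_def)

text \<open>Renaming z and w exchanges z-u with w-u; with this, the second half of the bracket in
  Dong's lemma follows from the first by swapping A and B.\<close>

lemma funpow_D13_flip: "(D13 ^^ k) (\<lambda>n m l. H m n l) = (\<lambda>n m l. (D23 ^^ k) H m n l)"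
  by (induction k) (auto simp: D13_def D23_def)

lemma funpow_D23_flip: "(D23 ^^ k) (\<lambda>n m l. H m n l) = (\<lambda>n m l. (D13 ^^ k) H m n l)"
  by (induction k) (auto simp: D13_def D23_def)

text \<open>Without negative powers of w one may set w = 0, which turns (z-w)^n into z^n.\<close>

lemma diff_at_corner:
  assumes "\<And>k m. m < 0 \<Longrightarrow> F k m = 0"
  shows "(diff ^^ n) F k 0 = F (k - int n) 0"
  using assms
proof (induction n arbitrary: F)
  case 0
  then show ?case by simp
next
  case (Suc n)
  have "(diff ^^ n) (diff F) k 0 = diff F (k - int n) 0"
    by (rule Suc.IH) (use Suc.prems in \<open>auto simp: diff_def\<close>)
  moreover have "diff F (k - int n) 0 = F (k - int (Suc n)) 0"
    by (simp add: diff_def Suc.prems algebra_simps)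
  ultimately show ?case by (simp only: funpow_Suc_right comp_apply)
qed

section \<open>Multiplication by the expansions of \<open>(z - w)^j\<close>\<close>

text \<open>The bound on the powers of w is uniform in n. As the expansion for |z| > |w| involves
  only w^k with k \<ge> 0, each coefficient of its product with F is then a finite sum.\<close>

definition lower_bounded :: "(int \<Rightarrow> int \<Rightarrow> 'v::zero) \<Rightarrow> bool" where
  "lower_bounded F \<longleftrightarrow> (\<exists>m0. \<forall>m<m0. \<forall>n. F n m = 0)"

lemma lower_bounded_cutoff:
  assumes "lower_bounded F"
  obtains L where "\<And>k n. k \<ge> L \<Longrightarrow> F n (m - int k) = 0"
proof -
  obtain m0 where "\<And>m n. m < m0 \<Longrightarrow> F n m = 0"
    using assms by (auto simp: lower_bounded_def)
  then show ?thesis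
    by (intro that[of "nat (m - m0 + 1)"]) auto
qed

lemma lower_bounded_minus:
  fixes F G :: "int \<Rightarrow> int \<Rightarrow> 'v::ab_group_add"
  assumes "lower_bounded F" "lower_bounded G"
  shows "lower_bounded (\<lambda>n m. F n m - G n m)"
proof -
  obtain m0 m1 where "\<And>m n. m < m0 \<Longrightarrow> F n m = 0" "\<And>m n. m < m1 \<Longrightarrow> G n m = 0"
    using assms unfolding lower_bounded_def by metis
  then show ?thesis unfolding lower_bounded_def by (intro exI[of _ "min m0 m1"]) auto
qed

lemma lower_bounded_comp:
  assumes "lower_bounded F" "\<And>n m. F n m = 0 \<Longrightarrow> G n m = 0"
  shows "lower_bounded G"
  using assms unfolding lower_bounded_def by blast

lemma lower_bounded_shift:
  assumes "lower_bounded F"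
  shows "lower_bounded (\<lambda>n m. F (g n) (m - 1))"
proof -
  obtain m0 where "\<And>m n. m < m0 \<Longrightarrow> F n m = 0" using assms by (auto simp: lower_bounded_def)
  then show ?thesis unfolding lower_bounded_def by (intro exI[of _ m0]) auto
qed

lemma lower_bounded_shift1: "lower_bounded F \<Longrightarrow> lower_bounded (\<lambda>n m. F (g n) m)"
  unfolding lower_bounded_def by blast

text \<open>The coefficient of z^(j-k) w^k in the expansion of (z-w)^j for |z| > |w|.\<close>

definition signed_binom :: "int \<Rightarrow> nat \<Rightarrow> complex" where
  "signed_binom j k = (-1) ^ k * (of_int j gchoose k)"

lemma signed_binom_0: "signed_binom j 0 = 1"
  by (simp add: signed_binom_def)

lemma signed_binom_eq_0: "0 \<le> j \<Longrightarrow> nat j < k \<Longrightarrow> signed_binom j k = 0"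
  using binomial_gbinomial[of "nat j" k, where 'a = complex]
  by (simp add: signed_binom_def binomial_eq_0)

lemma signed_binom_Suc: "signed_binom (j + 1) (Suc k) = signed_binom j (Suc k) - signed_binom j k"
  using gbinomial_Suc_Suc[of "of_int j :: complex" k]
  by (simp add: signed_binom_def algebra_simps)

text \<open>This is (\<partial>_z + \<partial>_w)(z-w)^j = 0, read off at z^(j-k-1) w^k.\<close>

lemma signed_binom_absorb: "of_nat (Suc k) * signed_binom j (Suc k) = - ((of_int j - of_nat k) * signed_binom j k)"
proof -
  have "of_nat (Suc k) * ((of_int j :: complex) gchoose Suc k) = (of_int j - of_nat k) * (of_int j gchoose k)"
    using gbinomial_absorb_comp[of "of_int j :: complex" k] gbinomial_absorption[of k "of_int j :: complex"]
    by simp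
  then show ?thesis
    unfolding signed_binom_def by (simp del: of_nat_Suc add: mult.left_commute)
qed

context superspace
begin

abbreviation lin :: "('v \<Rightarrow> 'v) \<Rightarrow> bool" where
  "lin A \<equiv> Vector_Spaces.linear s s A"

lemma lin_hom: "lin A \<Longrightarrow> module_hom s s A"
  by (simp add: Vector_Spaces.linear_def)

lemmas lin_add = module_hom.add[OF lin_hom]
lemmas lin_diff = module_hom.diff[OF lin_hom]
lemmas lin_scale = module_hom.scale[OF lin_hom]
lemmas lin_0 = module_hom.zero[OF lin_hom]
lemmas lin_sum = module_hom.sum[OF lin_hom]

lemma funpow_diff_scale: "(diff ^^ n) (\<lambda>k m. s c (F k m)) = (\<lambda>k m. s c ((diff ^^ n) F k m))"
  by (induction n) (auto simp: diff_def scale_right_diff_distrib)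

lemma funpow_diff_lin: "lin A \<Longrightarrow> (diff ^^ n) (\<lambda>k m. A (F k m)) = (\<lambda>k m. A ((diff ^^ n) F k m))"
  by (induction n) (auto simp: diff_def lin_diff)

definition mult_zw :: "int \<Rightarrow> (int \<Rightarrow> int \<Rightarrow> 'v) \<Rightarrow> int \<Rightarrow> int \<Rightarrow> 'v" where
  "mult_zw j F n m = Sum_any (\<lambda>k::nat. s (signed_binom j k) (F (n - j + int k) (m - int k)))"

text \<open>The expansion in \<open>|w| > |z|\<close>, via \<open>(z - w)^j = (-1)^j (w - z)^j\<close>.\<close>

definition mult_wz :: "int \<Rightarrow> (int \<Rightarrow> int \<Rightarrow> 'v) \<Rightarrow> int \<Rightarrow> int \<Rightarrow> 'v" where
  "mult_wz j F n m = s ((-1) powi j) (mult_zw j (\<lambda>m n. F n m) m n)"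

text \<open>The series can end for two reasons: the binomial coefficients vanish when j \<ge> 0, or
  F is bounded below in w. Supercommutators rely on the first, as they need not be bounded
  below.\<close>

lemma mult_zw_sum_weak:
  assumes "\<And>k. k \<ge> L \<Longrightarrow> signed_binom j k = 0 \<or> F (n - j + int k) (m - int k) = 0"
  shows "mult_zw j F n m = (\<Sum>k<L. s (signed_binom j k) (F (n - j + int k) (m - int k)))"
  unfolding mult_zw_def
proof (rule Sum_any.expand_superset)
  show "{k. s (signed_binom j k) (F (n - j + int k) (m - int k)) \<noteq> 0} \<subseteq> {..<L}"
  proof
    fix k assume "k \<in> {k. s (signed_binom j k) (F (n - j + int k) (m - int k)) \<noteq> 0}"
    then have "\<not> k \<ge> L" using assms[of k] by auto
    then show "k \<in> {..<L}" by simp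
  qed
qed simp

lemma mult_zw_sum:
  assumes "\<And>k. k \<ge> L \<Longrightarrow> F (n - j + int k) (m - int k) = 0"
  shows "mult_zw j F n m = (\<Sum>k<L. s (signed_binom j k) (F (n - j + int k) (m - int k)))"
  by (rule mult_zw_sum_weak, rule disjI2, rule assms)

lemma mult_zw_0: "mult_zw 0 F = F"
proof (intro ext)
  fix n m
  have "signed_binom 0 k = (if k = 0 then 1 else 0)" for k
    by (cases k) (auto simp: signed_binom_def)
  then have "mult_zw 0 F n m = Sum_any (\<lambda>k::nat. if k = 0 then F n m else 0)"
    unfolding mult_zw_def by (intro Sum_any.cong) auto
  then show "mult_zw 0 F n m = F n m" by simp
qed

lemma mult_zw_diff:
  assumes "lower_bounded F \<or> j \<ge> 0"
  shows "diff (mult_zw j F) = mult_zw (j + 1) F"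
proof (intro ext)
  fix n m
  have "\<exists>L. \<forall>k\<ge>L. (signed_binom j k = 0 \<or> (\<forall>n. F n (m - int k) = 0 \<and> F n (m - 1 - int k) = 0))
      \<and> (signed_binom (j + 1) (Suc k) = 0 \<or> (\<forall>n. F n (m - int (Suc k)) = 0))"
  proof (cases "j \<ge> 0")
    case True
    then show ?thesis by (intro exI[of _ "nat j + 1"]) (auto simp: signed_binom_eq_0)
  next
    case False
    then obtain m0 where "\<And>n m. m < m0 \<Longrightarrow> F n m = 0" using assms by (auto simp: lower_bounded_def)
    then show ?thesis by (intro exI[of _ "nat (m - m0 + 1)"]) auto
  qed
  then obtain L where L: "\<And>k. k \<ge> L \<Longrightarrow> signed_binom j k = 0 \<or> (\<forall>n. F n (m - int k) = 0 \<and> F n (m - 1 - int k) = 0)"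
    "\<And>k. k \<ge> L \<Longrightarrow> signed_binom (j + 1) (Suc k) = 0 \<or> (\<forall>n. F n (m - int (Suc k)) = 0)"
    by blast
  let ?f = "\<lambda>k. F (n - 1 - j + int k) (m - int k)"
  \<comment> \<open>The factor w shifts the summation index by one, so the sum up to
    \<open>L\<close> matches the tails of the two sums up to \<open>Suc L\<close>; Pascal's rule
    then compares the coefficients.\<close>
  have 1: "mult_zw j F (n - 1) m = (\<Sum>k<Suc L. s (signed_binom j k) (?f k))"
    by (rule mult_zw_sum_weak) (use L(1) Suc_leD in blast)
  have 2: "mult_zw j F n (m - 1) = (\<Sum>k<L. s (signed_binom j k) (F (n - j + int k) (m - 1 - int k)))"
    by (rule mult_zw_sum_weak) (use L(1) in blast)
  have 3: "mult_zw (j + 1) F n m = (\<Sum>k<Suc L. s (signed_binom (j + 1) k) (F (n - (j + 1) + int k) (m - int k)))"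
    by (rule mult_zw_sum_weak) (use L(2) Suc_le_D in blast)
  have e: "F (n - j + int k) (m - 1 - int k) = ?f (Suc k)" for k
    by (rule arg_cong2[where f = F]) auto
  have e2: "n - (j + 1) + int k = n - 1 - j + int k" for k by simp
  show "diff (mult_zw j F) n m = mult_zw (j + 1) F n m"
    unfolding diff_def 1 2 3 e e2 sum.lessThan_Suc_shift
    by (simp add: signed_binom_Suc signed_binom_0 scale_left_diff_distrib sum_subtractf)
qed

lemma funpow_diff_mult_zw:
  assumes "lower_bounded F \<or> j \<ge> 0"
  shows "(diff ^^ r) (mult_zw j F) = mult_zw (j + int r) F"
proof (induction r)
  case (Suc r)
  have "lower_bounded F \<or> j + int r \<ge> 0" using assms by linarith
  then have "diff (mult_zw (j + int r) F) = mult_zw (j + int (Suc r)) F"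
    by (simp add: mult_zw_diff add_ac)
  then show ?case using Suc by simp
qed simp

text \<open>Exchanging the variables changes the sign of \<open>diff\<close>, and this sign turns
  (-1)^j into (-1)^(j+1).\<close>

lemma mult_wz_diff:
  assumes "lower_bounded (\<lambda>m n. F n m)"
  shows "diff (mult_wz j F) = mult_wz (j + 1) F"
proof (intro ext)
  fix n m
  have "diff (mult_wz j F) n m = s ((-1) powi j) (- diff (mult_zw j (\<lambda>m n. F n m)) m n)"
    by (simp add: diff_def mult_wz_def scale_right_diff_distrib)
  also have "\<dots> = mult_wz (j + 1) F n m"
    by (simp add: mult_zw_diff[OF disjI1[OF assms]] mult_wz_def power_int_add)
  finally show "diff (mult_wz j F) n m = mult_wz (j + 1) F n m" .
qed

lemma mult_wz_0: "mult_wz 0 F = F"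
  by (simp add: fun_eq_iff mult_wz_def mult_zw_0)

lemma funpow_diff_mult_wz: "lower_bounded (\<lambda>m n. F n m) \<Longrightarrow> (diff ^^ r) (mult_wz j F) = mult_wz (j + int r) F"
  by (induction r) (auto simp: mult_wz_diff ac_simps)

lemma mult_zw_minus:
  assumes "lower_bounded F" "lower_bounded G"
  shows "mult_zw j (\<lambda>n m. F n m - G n m) n m = mult_zw j F n m - mult_zw j G n m"
proof -
  obtain L L' where L: "\<And>k n. k \<ge> L \<Longrightarrow> F n (m - int k) = 0" "\<And>k n. k \<ge> L' \<Longrightarrow> G n (m - int k) = 0"
    using lower_bounded_cutoff[OF assms(1)] lower_bounded_cutoff[OF assms(2)] by metis
  show ?thesis
    by (subst (1 2 3) mult_zw_sum[of "max L L'"])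
      (auto simp: L scale_right_diff_distrib sum_subtractf)
qed

lemma mult_zw_plus:
  assumes "lower_bounded F" "lower_bounded G"
  shows "mult_zw j (\<lambda>n m. F n m + G n m) n m = mult_zw j F n m + mult_zw j G n m"
proof -
  obtain L L' where L: "\<And>k n. k \<ge> L \<Longrightarrow> F n (m - int k) = 0" "\<And>k n. k \<ge> L' \<Longrightarrow> G n (m - int k) = 0"
    using lower_bounded_cutoff[OF assms(1)] lower_bounded_cutoff[OF assms(2)] by metis
  show ?thesis
    by (subst (1 2 3) mult_zw_sum[of "max L L'"])
      (auto simp: L scale_right_distrib sum.distrib)
qed

lemma mult_zw_lin:
  assumes "lower_bounded F" "lin C"
  shows "C (mult_zw j F n m) = mult_zw j (\<lambda>n m. C (F n m)) n m"
proof -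
  obtain L where L: "\<And>k n. k \<ge> L \<Longrightarrow> F n (m - int k) = 0"
    using lower_bounded_cutoff[OF assms(1)] by metis
  show ?thesis
    by (subst (1 2) mult_zw_sum[of L])
      (auto simp: L lin_sum lin_scale lin_0 assms(2))
qed

lemma lin_s: "lin (s c)"
  by unfold_locales (auto simp: scale_right_distrib scale_left_commute)

lemma mult_zw_scale: "lower_bounded F \<Longrightarrow> mult_zw j (\<lambda>n m. s c (F n m)) n m = s c (mult_zw j F n m)"
  using mult_zw_lin[OF _ lin_s] by metis

lemma mult_wz_minus:
  assumes "lower_bounded (\<lambda>m n. F n m)" "lower_bounded (\<lambda>m n. G n m)"
  shows "mult_wz j (\<lambda>n m. F n m - G n m) n m = mult_wz j F n m - mult_wz j G n m"
  by (simp add: mult_wz_def mult_zw_minus[OF assms] scale_right_diff_distrib)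

lemma mult_wz_plus:
  assumes "lower_bounded (\<lambda>m n. F n m)" "lower_bounded (\<lambda>m n. G n m)"
  shows "mult_wz j (\<lambda>n m. F n m + G n m) n m = mult_wz j F n m + mult_wz j G n m"
  by (simp add: mult_wz_def mult_zw_plus[OF assms] scale_right_distrib)

lemma mult_wz_lin:
  assumes "lower_bounded (\<lambda>m n. F n m)" "lin C"
  shows "C (mult_wz j F n m) = mult_wz j (\<lambda>n m. C (F n m)) n m"
  by (simp add: mult_wz_def mult_zw_lin[OF assms] lin_scale[OF assms(2)])

lemma mult_wz_scale: "lower_bounded (\<lambda>m n. F n m) \<Longrightarrow> mult_wz j (\<lambda>n m. s c (F n m)) n m = s c (mult_wz j F n m)"
  using mult_wz_lin[OF _ lin_s] by metis

lemma funpow_D13_mult_zw: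
  assumes "\<And>l. lower_bounded (\<lambda>n m. G n m l)"
  shows "(D13 ^^ k) (\<lambda>n m l. mult_zw j (\<lambda>n m. G n m l) n m) = (\<lambda>n m l. mult_zw j (\<lambda>n m. (D13 ^^ k) G n m l) n m)"
    and "lower_bounded (\<lambda>n m. (D13 ^^ k) G n m l)"
proof -
  have *: "lower_bounded (\<lambda>n m. (D13 ^^ k) G n m l)" for k l
    by (induction k arbitrary: l)
      (auto simp: D13_def assms intro!: lower_bounded_minus intro: lower_bounded_shift1[of "\<lambda>n m. (D13 ^^ _) G n m _"])
  have "D13 (\<lambda>n m l. mult_zw j (\<lambda>n m. G n m l) n m) = (\<lambda>n m l. mult_zw j (\<lambda>n m. D13 G n m l) n m)"
    if "\<And>l. lower_bounded (\<lambda>n m. G n m l)" for G :: "int \<Rightarrow> int \<Rightarrow> int \<Rightarrow> 'v"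
    unfolding D13_def
    by (subst mult_zw_minus) (auto simp: mult_zw_def algebra_simps intro: that lower_bounded_shift1[OF that])
  then show "(D13 ^^ k) (\<lambda>n m l. mult_zw j (\<lambda>n m. G n m l) n m) = (\<lambda>n m l. mult_zw j (\<lambda>n m. (D13 ^^ k) G n m l) n m)"
    using * by (induction k) auto
  show "lower_bounded (\<lambda>n m. (D13 ^^ k) G n m l)" by (rule *)
qed

lemma funpow_D23_mult_zw:
  assumes "\<And>l. lower_bounded (\<lambda>n m. G n m l)"
  shows "(D23 ^^ k) (\<lambda>n m l. mult_zw j (\<lambda>n m. G n m l) n m) = (\<lambda>n m l. mult_zw j (\<lambda>n m. (D23 ^^ k) G n m l) n m)"
    and "lower_bounded (\<lambda>n m. (D23 ^^ k) G n m l)"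
proof -
  have *: "lower_bounded (\<lambda>n m. (D23 ^^ k) G n m l)" for k l
    by (induction k arbitrary: l)
      (auto simp: D23_def assms intro!: lower_bounded_minus intro: lower_bounded_shift[of "\<lambda>n m. (D23 ^^ _) G n m _" "\<lambda>n. n"])
  have "D23 (\<lambda>n m l. mult_zw j (\<lambda>n m. G n m l) n m) = (\<lambda>n m l. mult_zw j (\<lambda>n m. D23 G n m l) n m)"
    if "\<And>l. lower_bounded (\<lambda>n m. G n m l)" for G :: "int \<Rightarrow> int \<Rightarrow> int \<Rightarrow> 'v"
    unfolding D23_def
    by (subst mult_zw_minus) (auto simp: mult_zw_def diff_right_commute intro: that lower_bounded_shift[OF that, of "\<lambda>n. n"])
  then show "(D23 ^^ k) (\<lambda>n m l. mult_zw j (\<lambda>n m. G n m l) n m) = (\<lambda>n m l. mult_zw j (\<lambda>n m. (D23 ^^ k) G n m l) n m)"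
    using * by (induction k) auto
  show "lower_bounded (\<lambda>n m. (D23 ^^ k) G n m l)" by (rule *)
qed

section \<open>Ordinary fields, locality and Dong's lemma\<close>

definition plain_field :: "(int \<Rightarrow> 'v \<Rightarrow> 'v) \<Rightarrow> bool" where
  "plain_field A \<longleftrightarrow> (\<forall>n. lin (A n)) \<and> (\<forall>v. \<exists>n0. \<forall>n<n0. A n v = 0)"

lemma plain_field_lin: "plain_field A \<Longrightarrow> lin (A n)"
  by (simp add: plain_field_def)

lemma plain_field_lower_bounded: "plain_field B \<Longrightarrow> (\<And>n. f n 0 = 0) \<Longrightarrow> lower_bounded (\<lambda>n m. f n (B m v))"
  unfolding plain_field_def lower_bounded_def by metis

definition local_at :: "nat \<Rightarrow> complex \<Rightarrow> (int \<Rightarrow> 'v \<Rightarrow> 'v) \<Rightarrow> (int \<Rightarrow> 'v \<Rightarrow> 'v) \<Rightarrow> bool" where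
  "local_at r \<epsilon> A B \<longleftrightarrow> (\<forall>v. (diff ^^ r) (\<lambda>n m. A n (B m v) - s \<epsilon> (B m (A n v))) = (\<lambda>_ _. 0))"

text \<open>The \<open>(j)\<close>-product of fields without odd variables, \<open>\<epsilon>\<close> being their commutation sign.\<close>

definition nprod :: "complex \<Rightarrow> int \<Rightarrow> (int \<Rightarrow> 'v \<Rightarrow> 'v) \<Rightarrow> (int \<Rightarrow> 'v \<Rightarrow> 'v) \<Rightarrow> int \<Rightarrow> 'v \<Rightarrow> 'v" where
  "nprod \<epsilon> j A B m v = mult_zw j (\<lambda>n m. A n (B m v)) (-1) m - s \<epsilon> (mult_wz j (\<lambda>n m. B m (A n v)) (-1) m)"

text \<open>C(u) is moved across A(z) B(w) in two steps: ABC - \<epsilon>2 \<epsilon>3 CAB = A(BC -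
  \<epsilon>3 CB) + \<epsilon>3 (AC - \<epsilon>2 CA)B. The first summand (\<open>G1\<close>) is
  killed by (w-u)^r3, the second (\<open>G2\<close>) by (z-u)^r2, and both factors commute with the
  expansion of (z-w)^j.\<close>

lemma dong_aux:
  assumes A: "plain_field A" and B: "plain_field B" and C: "plain_field C"
    and AC: "local_at r2 \<epsilon>2 A C" and BC: "local_at r3 \<epsilon>3 B C"
  shows "(D13 ^^ r2) ((D23 ^^ r3) (\<lambda>n m l. mult_zw j (\<lambda>n m. A n (B m (C l v))) n m
           - s (\<epsilon>2 * \<epsilon>3) (C l (mult_zw j (\<lambda>n m. A n (B m v)) n m)))) = (\<lambda>_ _ _. 0)"
proof -
  note lins = plain_field_lin[OF A] plain_field_lin[OF B] plain_field_lin[OF C]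
  define G1 where "G1 = (\<lambda>n m l. A n (B m (C l v) - s \<epsilon>3 (C l (B m v))))"
  define G2 where "G2 = (\<lambda>n m l. s \<epsilon>3 (A n (C l (B m v)) - s \<epsilon>2 (C l (A n (B m v)))))"
  define G where "G = (\<lambda>n m l. A n (B m (C l v)) - s (\<epsilon>2 * \<epsilon>3) (C l (A n (B m v))))"
  have b1: "lower_bounded (\<lambda>n m. A n (B m x))" for x
    by (rule plain_field_lower_bounded[OF B]) (simp add: lins lin_0)
  have b2: "lower_bounded (\<lambda>n m. C l (A n (B m v)))" for l
    by (rule lower_bounded_comp[OF b1[of v]]) (simp add: lins lin_0)
  have b3: "lower_bounded (\<lambda>n m. s c (C l (A n (B m v))))" for l c
    by (rule lower_bounded_comp[OF b2[of l]]) simp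
  have bG: "lower_bounded (\<lambda>n m. G n m l)" for l
    unfolding G_def by (rule lower_bounded_minus[OF b1 b3])
  have GG: "G = (\<lambda>n m l. G1 n m l + G2 n m l)"
    by (auto simp: G_def G1_def G2_def lins lin_diff lin_scale scale_right_diff_distrib mult.commute)
  have "(D23 ^^ r3) G1 = (\<lambda>_ _ _. 0)"
    unfolding G1_def funpow_D23_slice funpow_diff_lin[OF lins(1)]
    using BC by (simp add: lins local_at_def lin_0)
  moreover have "(D13 ^^ r2) G2 = (\<lambda>_ _ _. 0)"
    unfolding G2_def funpow_D13_slice[of r2 "\<lambda>m n l. s \<epsilon>3 (A n (C l (B m v)) - s \<epsilon>2 (C l (A n (B m v))))"]
    using AC by (simp add: funpow_diff_scale local_at_def)
  then have "(D13 ^^ r2) ((D23 ^^ r3) G2) = (\<lambda>_ _ _. 0)"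
    by (simp add: funpow_commute[of D13 D23] D13_D23 funpow_D23_zero)
  ultimately have G0: "(D13 ^^ r2) ((D23 ^^ r3) G) = (\<lambda>_ _ _. 0)"
    unfolding GG by (simp add: funpow_D23_plus funpow_D13_plus funpow_D13_zero)
  have eq: "(\<lambda>n m l. mult_zw j (\<lambda>n m. A n (B m (C l v))) n m
           - s (\<epsilon>2 * \<epsilon>3) (C l (mult_zw j (\<lambda>n m. A n (B m v)) n m))) = (\<lambda>n m l. mult_zw j (\<lambda>n m. G n m l) n m)"
    unfolding G_def
    by (subst mult_zw_minus[OF b1 b3]) (simp add: mult_zw_lin[OF b1] lins mult_zw_scale[OF b2])
  show ?thesis
    unfolding eq funpow_D23_mult_zw(1)[of G, OF bG]
    by (subst funpow_D13_mult_zw(1)) (auto simp: funpow_D23_mult_zw(2)[of G, OF bG] G0 mult_zw_def)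
qed

lemma dong:
  assumes A: "plain_field A" and B: "plain_field B" and C: "plain_field C"
    and AB: "local_at r1 \<epsilon>1 A B" and AC: "local_at r2 \<epsilon>2 A C" and BC: "local_at r3 \<epsilon>3 B C"
  shows "\<exists>r. local_at r (\<epsilon>2 * \<epsilon>3) (nprod \<epsilon>1 j A B) C"
proof -
  note lins = plain_field_lin[OF A] plain_field_lin[OF B] plain_field_lin[OF C]
  have bz: "lower_bounded (\<lambda>n m. A n (B m x))" for x
    by (rule plain_field_lower_bounded[OF B]) (simp add: lins lin_0)
  have bw: "lower_bounded (\<lambda>m n. B m (A n x))" for x
    by (rule plain_field_lower_bounded[OF A]) (simp add: lins lin_0)
  \<comment> \<open>\<open>U i\<close> is the bracket whose residue in z is the (i)-product, and
    \<open>P\<close> is its supercommutator with C(u). Multiplication by z-w raises i by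
    one.\<close>
  define U where "U = (\<lambda>i n m x. mult_zw i (\<lambda>n m. A n (B m x)) n m - s \<epsilon>1 (mult_wz i (\<lambda>n m. B m (A n x)) n m))"
  define P where "P = (\<lambda>i v n m l. U i n m (C l v) - s (\<epsilon>2 * \<epsilon>3) (C l (U i n m v)))"
  have Ud: "(diff ^^ r) (\<lambda>n m. U i n m x) = (\<lambda>n m. U (i + int r) n m x)" for r i x
    unfolding U_def
    by (simp add: funpow_diff_minus funpow_diff_scale funpow_diff_mult_zw[OF disjI1[OF bz]] funpow_diff_mult_wz bw)
  have U0: "U i n m x = 0" if "i \<ge> int r1" for i n m x
  proof -
    have "(\<lambda>n m. U i n m x) = (diff ^^ nat i) (\<lambda>n m. U 0 n m x)"
      using that by (simp add: Ud)
    also have "\<dots> = (\<lambda>_ _. 0)"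
      by (rule funpow_diff_mono[of r1])
        (use AB that in \<open>auto simp: U_def mult_zw_0 mult_wz_0 local_at_def\<close>)
    finally show ?thesis by (simp add: fun_eq_iff)
  qed
  \<comment> \<open>Chosen so that j + r \<ge> r1, where locality of A and B already makes
    \<open>U\<close> vanish.\<close>
  define r where "r = nat (int r1 - j)"
  have "(D12 ^^ r) (P j v) = P (j + int r) v" for v
    unfolding P_def funpow_D12_slice funpow_diff_minus funpow_diff_scale
      funpow_diff_lin[OF lins(3)] Ud ..
  moreover have "P (j + int r) v = (\<lambda>_ _ _. 0)" for v
    unfolding P_def using U0[of "j + int r"] by (auto simp: r_def lins lin_0)
  ultimately have D12: "(D12 ^^ r) (P j v) = (\<lambda>_ _ _. 0)" for v by simp
  have D13: "(D13 ^^ r2) ((D23 ^^ r3) (P j v)) = (\<lambda>_ _ _. 0)" for v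
  proof -
    define P1 where "P1 = (\<lambda>n m l. mult_zw j (\<lambda>n m. A n (B m (C l v))) n m
           - s (\<epsilon>2 * \<epsilon>3) (C l (mult_zw j (\<lambda>n m. A n (B m v)) n m)))"
    define P2 where "P2 = (\<lambda>m n l. mult_zw j (\<lambda>m n. B m (A n (C l v))) m n
           - s (\<epsilon>3 * \<epsilon>2) (C l (mult_zw j (\<lambda>m n. B m (A n v)) m n)))"
    define c where "c = \<epsilon>1 * (-1) powi j"
    have P: "P j v = (\<lambda>n m l. P1 n m l - s c (P2 m n l))"
      unfolding P_def U_def P1_def P2_def c_def mult_wz_def
      by (simp add: fun_eq_iff lins lin_diff lin_scale scale_right_diff_distrib mult_ac algebra_simps)
    have s13: "(D13 ^^ k) (\<lambda>n m l. s c (Q n m l)) = (\<lambda>n m l. s c ((D13 ^^ k) Q n m l))" for k Q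
      by (induction k) (auto simp: D13_def scale_right_diff_distrib)
    have s23: "(D23 ^^ k) (\<lambda>n m l. s c (Q n m l)) = (\<lambda>n m l. s c ((D23 ^^ k) Q n m l))" for k Q
      by (induction k) (auto simp: D23_def scale_right_diff_distrib)
    have 1: "(D13 ^^ r2) ((D23 ^^ r3) P1) = (\<lambda>_ _ _. 0)"
      unfolding P1_def by (rule dong_aux[OF A B C AC BC])
    have "(D13 ^^ r3) ((D23 ^^ r2) P2) = (\<lambda>_ _ _. 0)"
      unfolding P2_def by (rule dong_aux[OF B A C BC AC])
    then have 2: "(D13 ^^ r2) ((D23 ^^ r3) (\<lambda>n m l. P2 m n l)) = (\<lambda>_ _ _. 0)"
      unfolding funpow_D23_flip[of r3 P2] funpow_D13_flip[of r2 "(D13 ^^ r3) P2"]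
      by (simp add: funpow_commute[of D13 D23, OF D13_D23] fun_eq_iff)
    show ?thesis
      unfolding P
      by (simp add: funpow_D23_minus funpow_D13_minus s13 s23 1 2)
  qed
  have "(D12 ^^ r) ((D23 ^^ r3) (P j v)) = (\<lambda>_ _ _. 0)" for v
    by (simp add: funpow_commute[of D12 D23] D12_D23 D12 funpow_D23_zero)
  \<comment> \<open>Here (z-u)^r2 is traded for powers of w-u, with the help of (z-w)^r.\<close>
  then have "(D23 ^^ (r + r2)) ((D23 ^^ r3) (P j v)) = (\<lambda>_ _ _. 0)" for v
    by (rule funpow_D23_eq_0) (rule D13)
  then have "(D23 ^^ (r + r2 + r3)) (P j v) = (\<lambda>_ _ _. 0)" for v
    by (simp add: funpow_add)
  then have "(diff ^^ (r + r2 + r3)) (P j v n) = (\<lambda>_ _. 0)" for v n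
    using fun_cong[OF funpow_D23_slice[of "r + r2 + r3" "P j v"], of n] by (simp add: fun_eq_iff)
  \<comment> \<open>Powers of w-u leave the exponent of z alone, so the residue n = -1 may be taken
    now.\<close>
  from this[of _ "-1"] show ?thesis
    unfolding local_at_def P_def U_def nprod_def by blast
qed

end

section \<open>Signs\<close>

lemma shuffle_sign_empty [simp]: "shuffle_sign {} K = 1" "shuffle_sign I {} = 1"
  by (simp_all add: shuffle_sign_def)

lemma shuffle_sign_insert_left:
  assumes "finite I" "finite K" "i \<notin> I"
  shows "shuffle_sign (insert i I) K = (-1) ^ card {k \<in> K. k < i} * shuffle_sign I K"
proof -
  let ?P = "\<lambda>I. {(i, k). i \<in> I \<and> k \<in> K \<and> k < i}"
  have fin: "finite (?P I)"
    by (rule finite_subset[of _ "I \<times> K"]) (use assms in auto)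
  have "?P (insert i I) = ?P I \<union> Pair i ` {k \<in> K. k < i}" by auto
  moreover have "card (?P I \<union> Pair i ` {k \<in> K. k < i}) = card (?P I) + card (Pair i ` {k \<in> K. k < i})"
    by (rule card_Un_disjoint) (use assms fin in auto)
  ultimately have "card (?P (insert i I)) = card (?P I) + card {k \<in> K. k < i}"
    by (simp only: card_image inj_on_def prod.inject simp_thms Ball_def)
  then show ?thesis by (simp add: shuffle_sign_def power_add)
qed

lemma shuffle_sign_insert_right:
  assumes "finite I" "finite K" "k \<notin> K"
  shows "shuffle_sign I (insert k K) = (-1) ^ card {i \<in> I. k < i} * shuffle_sign I K"
proof -
  let ?P = "\<lambda>K. {(i, k). i \<in> I \<and> k \<in> K \<and> k < i}"
  have fin: "finite (?P K)"
    by (rule finite_subset[of _ "I \<times> K"]) (use assms in auto)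
  have "?P (insert k K) = ?P K \<union> (\<lambda>i. (i, k)) ` {i \<in> I. k < i}" by auto
  moreover have "card (?P K \<union> (\<lambda>i. (i, k)) ` {i \<in> I. k < i}) = card (?P K) + card ((\<lambda>i. (i, k)) ` {i \<in> I. k < i})"
    by (rule card_Un_disjoint) (use assms fin in auto)
  ultimately have "card (?P (insert k K)) = card (?P K) + card {i \<in> I. k < i}"
    by (simp only: card_image inj_on_def prod.inject simp_thms Ball_def)
  then show ?thesis by (simp add: shuffle_sign_def power_add)
qed

lemma shuffle_sign_square [simp]: "shuffle_sign I K * shuffle_sign I K = 1"
  by (simp add: shuffle_sign_def flip: power_add)

lemma card_less_greater:
  assumes "finite A" "(i::nat) \<notin> A"
  shows "card A = card {k \<in> A. k < i} + card {k \<in> A. i < k}"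
proof -
  have "A = {k \<in> A. k < i} \<union> {k \<in> A. i < k}" using assms(2) by (auto simp: not_less_iff_gr_or_eq)
  then have "card A = card ({k \<in> A. k < i} \<union> {k \<in> A. i < k})" by simp
  also have "\<dots> = card {k \<in> A. k < i} + card {k \<in> A. i < k}"
    by (rule card_Un_disjoint) (use assms in auto)
  finally show ?thesis .
qed

lemma shuffle_sign_swap:
  assumes "finite A" "finite B" "A \<inter> B = {}"
  shows "shuffle_sign A B * shuffle_sign B A = (-1) ^ (card A * card B)"
  using assms(1,3)
proof (induction A rule: finite_induct)
  case empty
  then show ?case by simp
next
  case (insert x A)
  have "card B = card {k \<in> B. k < x} + card {k \<in> B. x < k}"
    by (rule card_less_greater) (use insert assms in auto)
  then show ?case
    using insert assms(2)
    by (simp add: shuffle_sign_insert_left shuffle_sign_insert_right power_add algebra_simps)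
qed

section \<open>Odd expansion coefficients of \<open>(\<theta> - \<zeta>)^J\<close>\<close>

text \<open>Each k in K contributes -\<zeta>^k, and the shuffle sign sorts all \<theta> to the left
  of all \<zeta>.\<close>

definition oddpow :: "nat set \<Rightarrow> nat set \<Rightarrow> nat set \<Rightarrow> complex" where
  "oddpow J I K = (if I \<union> K = J \<and> I \<inter> K = {} then (-1) ^ card K * shuffle_sign I K else 0)"

lemma Sum_any_origin:
  fixes g :: "int \<Rightarrow> int \<Rightarrow> 'v::comm_monoid_add"
  assumes "\<And>n m. \<not> (n = 0 \<and> m = 0) \<Longrightarrow> g n m = 0"
  shows "Sum_any (\<lambda>(n, m). g n m) = g 0 0"
proof -
  have "Sum_any (\<lambda>(n, m). g n m) = (\<Sum>(n, m)\<in>{(0, 0)}. g n m)"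
    by (rule Sum_any.expand_superset) (use assms in auto)
  then show ?thesis by simp
qed

lemma mult2_theta_minus_zeta:
  assumes "finite I" "finite K"
  shows "mult2 (*) (\<lambda>n I m K. theta i n I m K - zeta i n I m K) f n I m K =
     (if i \<in> I then shuffle_sign {i} (I - {i}) * f n (I - {i}) m K else 0)
   - (if i \<in> K then (-1) ^ card I * shuffle_sign {i} (K - {i}) * f n I m (K - {i}) else 0)"
proof -
  define t where "t = (\<lambda>I' K'. (-1) ^ (card K' * card (I - I')) * shuffle_sign I' (I - I')
      * shuffle_sign K' (K - K') * f n (I - I') m (K - K'))"
  have "mult2 (*) (\<lambda>n I m K. theta i n I m K - zeta i n I m K) f n I m K =
    (\<Sum>I'\<in>Pow I. \<Sum>K'\<in>Pow K. (if I' = {i} \<and> K' = {} then t I' K' else 0)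
       - (if I' = {} \<and> K' = {i} then t I' K' else 0))"
    unfolding mult2_def
    by (intro sum.cong refl, subst Sum_any_origin) (auto simp: theta_def zeta_def t_def)
  also have "\<dots> = (\<Sum>I'\<in>Pow I. if I' = {i} then (\<Sum>K'\<in>Pow K. if K' = {} then t I' K' else 0) else 0)
       - (\<Sum>I'\<in>Pow I. if I' = {} then (\<Sum>K'\<in>Pow K. if K' = {i} then t I' K' else 0) else 0)"
    unfolding sum_subtractf
    by (intro arg_cong2[where f = minus] sum.cong refl) auto
  also have "\<dots> = (if i \<in> I then t {i} {} else 0) - (if i \<in> K then t {} {i} else 0)"
    using assms by (simp add: sum.delta)
  finally show ?thesis by (simp add: t_def)
qed

text \<open>The induction adds the smallest index, because \<open>foldr\<close> over the sorted list
  multiplies by that factor last, on the left.\<close>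

lemma times_odd_eq:
  assumes "finite J"
  shows "times_odd J (\<lambda>n I m K. if I = {} \<and> K = {} then e n m else 0)
       = (\<lambda>n I m K. oddpow J I K * e n m)"
  using assms
proof (induction J rule: finite_linorder_min_induct)
  case empty
  then show ?case by (auto simp: times_odd_def oddpow_def fun_eq_iff)
next
  case (insert i J)
  have iJ: "i \<notin> J" using insert by auto
  have "sorted_list_of_set (insert i J) = i # sorted_list_of_set J"
    using insert iJ by (simp add: insort_is_Cons less_imp_le)
  then have eq: "times_odd (insert i J) f = mult2 (*) (\<lambda>n I m K. theta i n I m K - zeta i n I m K) (times_odd J f)" for f
    by (simp add: times_odd_def)
  show ?case
  proof (intro ext)
    fix n m I K
    show "times_odd (insert i J) (\<lambda>n I m K. if I = {} \<and> K = {} then e n m else 0) n I m K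
       = oddpow (insert i J) I K * e n m"
    proof (cases "finite I \<and> finite K")
      case False
      \<comment> \<open>For infinite I or K the sums over \<open>Pow\<close> in \<open>mult2\<close>
        take the default value 0.\<close>
      then have "\<not> I \<union> K = insert i J" using insert(1) by (metis finite_Un finite_insert)
      then show ?thesis unfolding eq using False by (auto simp: mult2_def oddpow_def)
    next
      case True
      then have fin: "finite I" "finite K" by auto
      show ?thesis
      proof (cases "I \<union> K = insert i J \<and> I \<inter> K = {}")
        case False
        then have "i \<in> I \<Longrightarrow> oddpow J (I - {i}) K = 0" "i \<in> K \<Longrightarrow> oddpow J I (K - {i}) = 0"
          using iJ by (auto simp: oddpow_def)
        then show ?thesis
          unfolding eq insert.IH mult2_theta_minus_zeta[OF fin] using False by (auto simp: oddpow_def)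
      next
        case True
        have lt: "{k \<in> A. k < i} = {}" if "A \<subseteq> insert i J" for A
          using that insert(2) by force
        have gt: "{k \<in> A. i < k} = A" if "A \<subseteq> J" for A
          using that insert(2) by force
        show ?thesis
        proof (cases "i \<in> I")
          case iI: True
          define I' where "I' = I - {i}"
          have I: "I = insert i I'" "i \<notin> I'" "finite I'" "I' \<union> K = J" "I' \<inter> K = {}" "i \<notin> K" "K \<subseteq> insert i J"
            "I' \<subseteq> insert i J"
            using iI True iJ fin by (auto simp: I'_def)
          show ?thesis
            unfolding eq insert.IH mult2_theta_minus_zeta[OF fin]
            using I fin insert(1)
            by (simp add: oddpow_def shuffle_sign_insert_left lt)
        next
          case iI: False
          define K' where "K' = K - {i}"
          have K: "K = insert i K'" "i \<notin> K'" "finite K'" "I \<union> K' = J" "I \<inter> K' = {}" "K' \<subseteq> insert i J" "I \<subseteq> J"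
            using iI True iJ fin by (auto simp: K'_def)
          show ?thesis
            unfolding eq insert.IH mult2_theta_minus_zeta[OF fin]
            using K fin insert(1) iI
            by (simp add: oddpow_def shuffle_sign_insert_left shuffle_sign_insert_right lt gt)
        qed
      qed
    qed
  qed
qed

definition bin_zw :: "int \<Rightarrow> int \<Rightarrow> int \<Rightarrow> complex" where
  "bin_zw j n m = (if n + m = j \<and> m \<ge> 0 then (-1) powi m * (of_int j gchoose nat m) else 0)"

definition bin_wz :: "int \<Rightarrow> int \<Rightarrow> int \<Rightarrow> complex" where
  "bin_wz j n m = (if n + m = j \<and> n \<ge> 0 then (-1) powi m * (of_int j gchoose nat n) else 0)"

lemma ipow_zw_eq: "finite J \<Longrightarrow> ipow_zw j J = (\<lambda>n I m K. oddpow J I K * bin_zw j n m)"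
  unfolding ipow_zw_def times_odd_eq[symmetric]
  by (rule arg_cong[where f = "times_odd J"]) (auto simp: even_zw_def bin_zw_def fun_eq_iff)

lemma ipow_wz_eq: "finite J \<Longrightarrow> ipow_wz j J = (\<lambda>n I m K. oddpow J I K * bin_wz j n m)"
  unfolding ipow_wz_def times_odd_eq[symmetric]
  by (rule arg_cong[where f = "times_odd J"]) (auto simp: even_wz_def bin_wz_def fun_eq_iff)

lemma even_zw_eq: "even_zw j = (\<lambda>n I m K. oddpow {} I K * bin_zw j n m)"
  using ipow_zw_eq[of "{}" j] by (simp add: ipow_zw_def times_odd_def)

text \<open>The left derivative by \<zeta>^i passes the factors of index k < i in J, each giving a
  sign, and turns \<theta>^i - \<zeta>^i into -1. The left-hand side is that derivative at
  \<theta>^I \<zeta>^K.\<close>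

lemma oddpow_shift:
  assumes "finite I" "finite K" "i \<notin> K"
  shows "(-1) ^ (card I + card {k \<in> K. k < i}) * oddpow J I (insert i K)
       = (if i \<in> J then - ((-1) ^ card {k \<in> J. k < i} * oddpow (J - {i}) I K) else 0)"
proof (cases "I \<union> insert i K = J \<and> I \<inter> insert i K = {}")
  case True
  have "{k \<in> J. k < i} = {k \<in> I. k < i} \<union> {k \<in> K. k < i}" using True assms(3) by force
  moreover have "card ({k \<in> I. k < i} \<union> {k \<in> K. k < i}) = card {k \<in> I. k < i} + card {k \<in> K. k < i}"
    by (rule card_Un_disjoint) (use assms True in auto)
  moreover have "card I = card {k \<in> I. k < i} + card {k \<in> I. i < k}"
    by (rule card_less_greater) (use True assms in auto)
  moreover have "I \<union> K = J - {i} \<and> I \<inter> K = {}" using True assms(3) by auto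
  ultimately show ?thesis
    using True assms
    by (auto simp: oddpow_def shuffle_sign_insert_right power_add)
next
  case False
  have "\<not> (I \<union> K = J - {i} \<and> I \<inter> K = {})" if "i \<in> J"
    using False that assms(3) by blast
  then show ?thesis using False by (auto simp: oddpow_def)
qed

lemma oddpow_shift_min:
  assumes "finite I" "finite K" "\<And>k. k \<in> K \<Longrightarrow> i < k"
  shows "(-1) ^ card I * oddpow J I (insert i K)
       = (if i \<in> J then - ((-1) ^ card {k \<in> J. k < i} * oddpow (J - {i}) I K) else 0)"
proof -
  have K: "i \<notin> K" "{k \<in> K. k < i} = {}" using assms(3) by force+
  show ?thesis
    using oddpow_shift[OF assms(1,2) K(1), of J] unfolding K(2) by (simp only: card.empty add_0_right)
qed

lemma oddpow_parity:
  assumes "finite I" "finite K" "oddpow J I K \<noteq> 0"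
  shows "even (card I + card K) = even (card J)"
proof -
  have "I \<union> K = J" "I \<inter> K = {}" using assms(3) by (auto simp: oddpow_def split: if_splits)
  then show ?thesis using card_Un_disjoint[OF assms(1,2)] by simp
qed

context superspace
begin

section \<open>Separating even and odd variables; the Leibniz rule for odd derivatives\<close>

definition odd_mult :: "(nat set \<Rightarrow> nat set \<Rightarrow> complex) \<Rightarrow> (nat set \<Rightarrow> nat set \<Rightarrow> 'v) \<Rightarrow> nat set \<Rightarrow> nat set \<Rightarrow> 'v" where
  "odd_mult h F I K = (\<Sum>I'\<in>Pow I. \<Sum>K'\<in>Pow K.
     s ((-1) ^ (card K' * card (I - I')) * shuffle_sign I' (I - I') * shuffle_sign K' (K - K') * h I' K')
       (F (I - I') (K - K')))"

text \<open>For c \<noteq> 0 both sides have the same support; if it is infinite, both take the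
  default value 0.\<close>

lemma Sum_any_scale: "Sum_any (\<lambda>x. s c (g x)) = s c (Sum_any g)"
proof (cases "c = 0")
  case False
  then have "{x. s c (g x) \<noteq> 0} = {x. g x \<noteq> 0}" by simp
  then show ?thesis by (simp add: Sum_any.expand_set scale_sum_right)
qed simp

definition even_mult :: "(int \<Rightarrow> int \<Rightarrow> complex) \<Rightarrow> (int \<Rightarrow> int \<Rightarrow> 'v) \<Rightarrow> int \<Rightarrow> int \<Rightarrow> 'v" where
  "even_mult e F n m = Sum_any (\<lambda>(n', m'). s (e n' m') (F (n - n') (m - m')))"

lemma mult2_tensor:
  "mult2 s (\<lambda>n I m K. h I K * e n m) A n I m K
     = odd_mult h (\<lambda>I K. even_mult e (\<lambda>n m. A n I m K) n m) I K"
  unfolding mult2_def odd_mult_def even_mult_def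
  by (simp flip: Sum_any_scale add: case_prod_unfold mult.assoc)

lemma op_mult2_tensor:
  "op_mult2 s (\<lambda>n I m K. h I K * e n m) A n I m K v
     = odd_mult h (\<lambda>I K. even_mult e (\<lambda>n m. A n I m K v) n m) I K"
  unfolding op_mult2_def mult2_tensor ..

lemma Sum_any_reindex:
  fixes g :: "'x \<Rightarrow> 'v"
  assumes "inj f" "\<And>x. x \<notin> range f \<Longrightarrow> g x = 0"
  shows "Sum_any g = Sum_any (\<lambda>k. g (f k))"
proof -
  have "{x. g x \<noteq> 0} = f ` {k. g (f k) \<noteq> 0}"
    using assms(2) by fast
  then show ?thesis
    unfolding Sum_any.expand_set
    by (simp add: sum.reindex[OF inj_on_subset[OF assms(1)]])
qed

lemma even_mult_zw: "even_mult (bin_zw j) F n m = mult_zw j F n m"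
proof -
  have "even_mult (bin_zw j) F n m = Sum_any (\<lambda>k::nat. (\<lambda>(n', m'). s (bin_zw j n' m') (F (n - n') (m - m'))) (j - int k, int k))"
    unfolding even_mult_def
  proof (rule Sum_any_reindex)
    show "inj (\<lambda>k. (j - int k, int k))" by (auto simp: inj_def)
    fix x :: "int \<times> int"
    assume x: "x \<notin> range (\<lambda>k. (j - int k, int k))"
    obtain n' m' where [simp]: "x = (n', m')" by force
    have "n' + m' \<noteq> j \<or> m' < 0"
      using x zero_le_imp_eq_int[of m'] by (cases "0 \<le> m'") (auto simp: image_iff)
    then show "(\<lambda>(n', m'). s (bin_zw j n' m') (F (n - n') (m - m'))) x = 0"
      by (auto simp: bin_zw_def)
  qed
  also have "\<dots> = mult_zw j F n m"
    unfolding mult_zw_def by (simp add: bin_zw_def signed_binom_def algebra_simps)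
  finally show ?thesis .
qed

lemma even_mult_wz: "even_mult (bin_wz j) F n m = mult_wz j F n m"
proof -
  have sgn: "(-1 :: complex) powi (j - int k) = (-1) powi j * (-1) ^ k" for k
    by (simp add: power_int_diff power_int_minus field_simps flip: power_mult_distrib)
  have "even_mult (bin_wz j) F n m = Sum_any (\<lambda>k::nat. (\<lambda>(n', m'). s (bin_wz j n' m') (F (n - n') (m - m'))) (int k, j - int k))"
    unfolding even_mult_def
  proof (rule Sum_any_reindex)
    show "inj (\<lambda>k. (int k, j - int k))" by (auto simp: inj_def)
    fix x :: "int \<times> int"
    assume x: "x \<notin> range (\<lambda>k. (int k, j - int k))"
    obtain n' m' where [simp]: "x = (n', m')" by force
    have "n' + m' \<noteq> j \<or> n' < 0"
      using x zero_le_imp_eq_int[of n'] by (cases "0 \<le> n'") (auto simp: image_iff)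
    then show "(\<lambda>(n', m'). s (bin_wz j n' m') (F (n - n') (m - m'))) x = 0"
      by (auto simp: bin_wz_def)
  qed
  also have "\<dots> = mult_wz j F n m"
    unfolding mult_wz_def mult_zw_def by (simp add: bin_wz_def signed_binom_def sgn algebra_simps flip: Sum_any_scale)
  finally show ?thesis .
qed

lemma odd_mult_cong:
  assumes "\<And>I' K'. I' \<subseteq> I \<Longrightarrow> K' \<subseteq> K \<Longrightarrow> h I' K' = h' I' K'"
    and "\<And>I' K'. I' \<subseteq> I \<Longrightarrow> K' \<subseteq> K \<Longrightarrow> h' I' K' \<noteq> 0 \<Longrightarrow> F (I - I') (K - K') = F' (I - I') (K - K')"
  shows "odd_mult h F I K = odd_mult h' F' I K"
  unfolding odd_mult_def using assms
  by (intro sum.cong refl) (metis (no_types, lifting) PowD mult_zero_right scale_zero_left)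

lemma odd_mult_scale_left: "odd_mult (\<lambda>I K. c * h I K) F I K = s c (odd_mult h F I K)"
  unfolding odd_mult_def by (simp add: scale_sum_right mult_ac)

lemma odd_mult_scale_right: "odd_mult h (\<lambda>I K. s c (F I K)) I K = s c (odd_mult h F I K)"
  unfolding odd_mult_def by (simp add: scale_sum_right mult_ac)

lemma odd_mult_minus: "odd_mult h (\<lambda>I K. F I K - G I K) I K = odd_mult h F I K - odd_mult h G I K"
  unfolding odd_mult_def by (simp add: sum_subtractf scale_right_diff_distrib)

lemma odd_mult_plus: "odd_mult h (\<lambda>I K. F I K + G I K) I K = odd_mult h F I K + odd_mult h G I K"
  unfolding odd_mult_def by (simp add: sum.distrib scale_right_distrib)

lemma odd_mult_zero:
  assumes "\<And>I' K'. I' \<subseteq> I \<Longrightarrow> K' \<subseteq> K \<Longrightarrow> h I' K' \<noteq> 0 \<Longrightarrow> F (I - I') (K - K') = 0"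
  shows "odd_mult h F I K = 0"
  unfolding odd_mult_def using assms
  by (intro sum.neutral ballI) (metis PowD mult_zero_right scale_zero_left scale_zero_right)

lemma odd_mult_oddpow_empty:
  assumes "finite I" "finite K"
  shows "odd_mult (oddpow {}) F I K = F I K"
proof -
  have "odd_mult (oddpow {}) F I K = (\<Sum>I'\<in>Pow I. if I' = {} then (\<Sum>K'\<in>Pow K. if K' = {} then F I K else 0) else 0)"
    unfolding odd_mult_def by (intro sum.cong refl) (auto simp: oddpow_def intro!: sum.cong)
  then show ?thesis using assms by (simp add: sum.delta)
qed

lemma odd_mult_K_empty:
  "odd_mult h F I {} = (\<Sum>I'\<in>Pow I. s (shuffle_sign I' (I - I') * h I' {}) (F (I - I') {}))"
  unfolding odd_mult_def by simp

text \<open>The Leibniz rule for \<open>\<partial>/\<partial>\<zeta>^i\<close>, read off at monomials \<open>\<theta>^I \<zeta>^K\<close> with \<open>i < K\<close>, where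
  \<open>\<zeta>^i\<close> is moved past \<open>\<theta>^I\<close> only.\<close>

lemma odd_mult_leibniz:
  assumes fin: "finite I" "finite K" and i: "\<And>k. k \<in> K \<Longrightarrow> i < k"
    and par: "\<And>I' K'. I' \<subseteq> I \<Longrightarrow> K' \<subseteq> K \<Longrightarrow> h I' K' \<noteq> 0 \<Longrightarrow> even (card I' + card K') = even P"
  shows "s ((-1) ^ card I) (odd_mult h F I (insert i K))
       = odd_mult (\<lambda>I K. (-1) ^ card I * h I (insert i K)) F I K
         + s ((-1) ^ P) (odd_mult h (\<lambda>I K. s ((-1) ^ card I) (F I (insert i K))) I K)"
proof -
  have iK: "i \<notin> K" using i by blast
  define t where "t = (\<lambda>K I' K'. s ((-1) ^ (card K' * card (I - I')) * shuffle_sign I' (I - I')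
     * shuffle_sign K' (K - K') * h I' K') (F (I - I') (K - K')))"
  \<comment> \<open>A monomial of the product containing \<zeta>^i takes it either from h or from F;
    these are the two terms of the Leibniz rule.\<close>
  have split: "(\<Sum>K'\<in>Pow (insert i K). f K') = (\<Sum>K'\<in>Pow K. f (insert i K')) + (\<Sum>K'\<in>Pow K. f K')"
    for f :: "nat set \<Rightarrow> 'v"
  proof -
    have inj: "inj_on (insert i) (Pow K)"
      using iK by (auto simp: inj_on_def)
    have "sum f (Pow K \<union> insert i ` Pow K) = sum f (Pow K) + sum f (insert i ` Pow K)"
      by (rule sum.union_disjoint) (use fin iK in auto)
    then show ?thesis
      using sum.reindex[OF inj, of f] by (simp add: Pow_insert add.commute)
  qed
  have 1: "s ((-1) ^ card I) (t (insert i K) I' (insert i K'))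
     = s ((-1) ^ (card K' * card (I - I')) * shuffle_sign I' (I - I')
     * shuffle_sign K' (K - K') * ((-1) ^ card I' * h I' (insert i K'))) (F (I - I') (K - K'))"
    if "I' \<subseteq> I" "K' \<subseteq> K" for I' K'
  proof -
    have f: "finite I'" "finite K'" using that fin finite_subset by auto
    have e: "insert i K - insert i K' = K - K'" using iK by auto
    have 0: "{k \<in> K - K'. k < i} = {}" using i by force
    have "i \<notin> K'" using that iK by auto
    then have sh: "shuffle_sign (insert i K') (K - K') = shuffle_sign K' (K - K')"
      using fin f by (subst shuffle_sign_insert_left) (auto simp only: 0 finite_Diff card.empty power_0 mult_1_left)
    have "card I = card I' + card (I - I')"
      using that fin by (simp add: card_Diff_subset f card_mono)
    then have sg: "(-1::complex) ^ card I * (-1) ^ (card (insert i K') * card (I - I'))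
       = (-1) ^ (card K' * card (I - I')) * (-1) ^ card I'"
      using f \<open>i \<notin> K'\<close> by (simp add: power_add algebra_simps)
    have "s ((-1) ^ card I) (t (insert i K) I' (insert i K')) =
       s (((-1) ^ card I * (-1) ^ (card (insert i K') * card (I - I'))) * shuffle_sign I' (I - I')
         * shuffle_sign K' (K - K') * h I' (insert i K')) (F (I - I') (K - K'))"
      unfolding t_def e sh by (simp add: mult_ac)
    then show ?thesis unfolding sg by (simp add: mult_ac)
  qed
  have 2: "s ((-1) ^ card I) (t (insert i K) I' K')
     = s ((-1) ^ P) (s ((-1) ^ (card K' * card (I - I')) * shuffle_sign I' (I - I')
     * shuffle_sign K' (K - K') * h I' K') (s ((-1) ^ card (I - I')) (F (I - I') (insert i (K - K')))))"
    if "I' \<subseteq> I" "K' \<subseteq> K" for I' K'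
  proof (cases "h I' K' = 0")
    case True
    then show ?thesis by (simp add: t_def)
  next
    case False
    have f: "finite I'" "finite K'" using that fin finite_subset by auto
    have e: "insert i K - K' = insert i (K - K')" using iK that by auto
    have "{k \<in> K'. i < k} = K'" using i that by force
    then have sh: "shuffle_sign K' (insert i (K - K')) = (-1) ^ card K' * shuffle_sign K' (K - K')"
      using fin f iK by (subst shuffle_sign_insert_right) auto
    have "card I = card I' + card (I - I')"
      using that fin by (simp add: card_Diff_subset f card_mono)
    then have sg: "(-1::complex) ^ card I * (-1) ^ card K' = (-1) ^ P * (-1) ^ card (I - I')"
      using par[OF that False] by (auto simp: power_add minus_one_power_iff)
    have "s ((-1) ^ card I) (t (insert i K) I' K') =
       s (((-1) ^ card I * (-1) ^ card K') * ((-1) ^ (card K' * card (I - I')) * shuffle_sign I' (I - I')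
         * shuffle_sign K' (K - K') * h I' K')) (F (I - I') (insert i (K - K')))"
      unfolding t_def e sh by (simp add: mult_ac)
    then show ?thesis unfolding sg by (simp add: mult_ac)
  qed
  have "s ((-1) ^ card I) (odd_mult h F I (insert i K))
     = (\<Sum>I'\<in>Pow I. (\<Sum>K'\<in>Pow K. s ((-1) ^ card I) (t (insert i K) I' (insert i K')))
          + (\<Sum>K'\<in>Pow K. s ((-1) ^ card I) (t (insert i K) I' K')))"
    unfolding odd_mult_def t_def by (simp add: split scale_sum_right scale_right_distrib)
  also have "\<dots> = odd_mult (\<lambda>I K. (-1) ^ card I * h I (insert i K)) F I K
         + s ((-1) ^ P) (odd_mult h (\<lambda>I K. s ((-1) ^ card I) (F I (insert i K))) I K)"
    unfolding odd_mult_def sum.distrib scale_sum_right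
    by (intro arg_cong2[where f = plus] sum.cong refl) (auto simp: 1 2)
  finally show ?thesis .
qed

text \<open>The Leibniz rule for the kernel (\<theta>-\<zeta>)^J: its own derivative removes i from
  J, and passing it to reach F costs its parity #J.\<close>

lemma odd_mult_oddpow_insert:
  assumes "finite I" "finite K" "\<And>k. k \<in> K \<Longrightarrow> i < k"
  shows "s ((-1) ^ card I) (odd_mult (oddpow J) F I (insert i K))
       = (if i \<in> J then s (- ((-1) ^ card {k \<in> J. k < i})) (odd_mult (oddpow (J - {i})) F I K) else 0)
         + s ((-1) ^ card J) (odd_mult (oddpow J) (\<lambda>I K. s ((-1) ^ card I) (F I (insert i K))) I K)"
proof -
  have "odd_mult (\<lambda>I K. (-1) ^ card I * oddpow J I (insert i K)) F I K
      = odd_mult (\<lambda>I K. (if i \<in> J then - ((-1) ^ card {k \<in> J. k < i}) else 0) * oddpow (J - {i}) I K) F I K"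
    by (rule odd_mult_cong, subst oddpow_shift_min) (use assms finite_subset in \<open>auto simp: finite_subset\<close>)
  moreover have "even (card I' + card K') = even (card J)"
    if "I' \<subseteq> I" "K' \<subseteq> K" "oddpow J I' K' \<noteq> 0" for I' K'
    by (rule oddpow_parity) (use that assms finite_subset in auto)
  ultimately show ?thesis
    by (subst odd_mult_leibniz[where P = "card J"]) (use assms in \<open>auto simp: odd_mult_scale_left\<close>)
qed

end

context superspace
begin

section \<open>Products of ordinary fields\<close>

lemma sign_square: "s ((-1) ^ n) (s ((-1) ^ n) x) = x"
  by (simp flip: power_add)

lemma sign_cancel: "s ((-1) ^ n) x = s ((-1) ^ n) y \<longleftrightarrow> x = y"
  by simp

text \<open>The coefficients of (\<partial>_z + \<partial>_w)F.\<close>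

definition total_deriv :: "(int \<Rightarrow> int \<Rightarrow> 'v) \<Rightarrow> int \<Rightarrow> int \<Rightarrow> 'v" where
  "total_deriv F n m = s (of_int (n + 1)) (F (n + 1) m) + s (of_int (m + 1)) (F n (m + 1))"

text \<open>\<partial>_z + \<partial>_w is a derivation that kills (z-w)^j, hence commutes with
  multiplication by its expansion.\<close>

lemma mult_zw_total_deriv:
  assumes "lower_bounded F"
  shows "mult_zw j (total_deriv F) n m = total_deriv (mult_zw j F) n m"
proof -
  obtain L where L: "\<And>k n. k \<ge> L \<Longrightarrow> F n (m - int k) = 0"
    using lower_bounded_cutoff[OF assms] by blast
  define f where "f = (\<lambda>k. F (n + 1 - j + int k) (m - int k))"
  have L': "F n' (m + 1 - int k) = 0" if "k \<ge> Suc L" for k n'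
  proof -
    have "m + 1 - int k = m - int (k - 1)" using that by (simp add: of_nat_diff)
    then show ?thesis by (simp only:) (rule L, use that in simp)
  qed
  have g: "F (n - j + int (Suc k)) (m + 1 - int (Suc k)) = f k" for k
    unfolding f_def by (rule arg_cong2[where f = F]) auto
  have 1: "mult_zw j F (n + 1) m = (\<Sum>k<L. s (signed_binom j k) (f k))"
    unfolding f_def by (rule mult_zw_sum) (use L in simp)
  have 2: "mult_zw j F n (m + 1) = s (signed_binom j 0) (F (n - j) (m + 1)) + (\<Sum>k<L. s (signed_binom j (Suc k)) (f k))"
  proof -
    have "mult_zw j F n (m + 1) = (\<Sum>k<Suc L. s (signed_binom j k) (F (n - j + int k) (m + 1 - int k)))"
      by (rule mult_zw_sum) (rule L')
    then show ?thesis unfolding sum.lessThan_Suc_shift g by simp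
  qed
  have e1: "n - j + int k + 1 = n + 1 - j + int k" "m - int k + 1 = m + 1 - int k" for k by auto
  have "mult_zw j (total_deriv F) n m = (\<Sum>k<Suc L. s (signed_binom j k) (total_deriv F (n - j + int k) (m - int k)))"
  proof (rule mult_zw_sum)
    fix k assume "Suc L \<le> k"
    then show "total_deriv F (n - j + int k) (m - int k) = 0"
      unfolding total_deriv_def e1 by (simp only: L' L[OF Suc_leD]) simp
  qed
  also have "\<dots> = (\<Sum>k<Suc L. s (signed_binom j k * of_int (n + 1 - j + int k)) (f k))
      + (\<Sum>k<Suc L. s (signed_binom j k * of_int (m + 1 - int k)) (F (n - j + int k) (m + 1 - int k)))"
    by (simp only: total_deriv_def e1 f_def scale_right_distrib scale_scale sum.distrib)
  also have "(\<Sum>k<Suc L. s (signed_binom j k * of_int (n + 1 - j + int k)) (f k))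
      = (\<Sum>k<L. s (signed_binom j k * of_int (n + 1 - j + int k)) (f k))"
    using L[of L] by (simp add: f_def)
  also have "(\<Sum>k<Suc L. s (signed_binom j k * of_int (m + 1 - int k)) (F (n - j + int k) (m + 1 - int k)))
      = s (signed_binom j 0 * of_int (m + 1)) (F (n - j) (m + 1))
        + (\<Sum>k<L. s (signed_binom j (Suc k) * of_int (m + 1 - int (Suc k))) (f k))"
    unfolding sum.lessThan_Suc_shift g by simp
  finally have A: "mult_zw j (total_deriv F) n m = s (signed_binom j 0 * of_int (m + 1)) (F (n - j) (m + 1))
        + (\<Sum>k<L. s (signed_binom j k * of_int (n + 1 - j + int k) + signed_binom j (Suc k) * of_int (m + 1 - int (Suc k))) (f k))"
    by (simp only: scale_left_distrib sum.distrib add_ac)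
  have c: "signed_binom j k * of_int (n + 1 - j + int k) + signed_binom j (Suc k) * of_int (m + 1 - int (Suc k))
      = of_int (n + 1) * signed_binom j k + of_int (m + 1) * signed_binom j (Suc k)" for k
    using signed_binom_absorb[of k j] by (simp add: algebra_simps)
  show ?thesis
    unfolding A c total_deriv_def 1 2
    by (simp add: scale_sum_right scale_right_distrib scale_left_distrib sum.distrib mult.commute)
qed

lemma mult_wz_total_deriv:
  assumes "lower_bounded (\<lambda>m n. F n m)"
  shows "mult_wz j (total_deriv F) n m = total_deriv (mult_wz j F) n m"
proof -
  have "(\<lambda>m n. total_deriv F n m) = total_deriv (\<lambda>m n. F n m)"
    by (simp add: total_deriv_def fun_eq_iff add.commute)
  then show ?thesis
    by (simp add: mult_wz_def mult_zw_total_deriv[OF assms]) (simp add: total_deriv_def mult_wz_def scale_right_distrib mult_ac add.commute)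
qed

definition covariant :: "('v \<Rightarrow> 'v) \<Rightarrow> (int \<Rightarrow> 'v \<Rightarrow> 'v) \<Rightarrow> bool" where
  "covariant D A \<longleftrightarrow> (\<forall>n v. D (A n v) - A n (D v) = s (of_int (n + 1)) (A (n + 1) v))"

lemma lower_bounded_plain_field:
  assumes "plain_field A" "plain_field B"
  shows "lower_bounded (\<lambda>n m. A n (B m v))"
  by (rule plain_field_lower_bounded[OF assms(2)]) (simp add: plain_field_lin[OF assms(1)] lin_0)

lemma lower_bounded_lin: "lower_bounded F \<Longrightarrow> lin C \<Longrightarrow> lower_bounded (\<lambda>n m. C (F n m))"
  by (erule lower_bounded_comp) (simp add: lin_0)

lemma nprod_lin:
  assumes A: "plain_field A" and B: "plain_field B"
  shows "lin (nprod \<epsilon> j A B m)"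
proof -
  note b = lower_bounded_plain_field[OF A B] lower_bounded_plain_field[OF B A]
  note lins = plain_field_lin[OF A] plain_field_lin[OF B]
  show ?thesis
    by unfold_locales
      (simp_all add: nprod_def lins lin_add lin_scale mult_zw_plus mult_wz_plus mult_zw_scale mult_wz_scale b
        scale_right_distrib scale_right_diff_distrib mult.commute)
qed

text \<open>Commuting D with either ordering of A(z) and B(w) gives \<partial>_z + \<partial>_w,
  which commutes with the expansions. At z^-1 the part \<partial>_z has the factor n + 1 = 0, so
  only \<partial>_w survives.\<close>

lemma covariant_nprod:
  assumes A: "plain_field A" and B: "plain_field B" and D: "lin D" and cov: "covariant D A" "covariant D B"
  shows "covariant D (nprod \<epsilon> j A B)"
  unfolding covariant_def
proof (intro allI)
  fix m v
  note b = lower_bounded_plain_field[OF A B] lower_bounded_plain_field[OF B A]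
  note lins = plain_field_lin[OF A] plain_field_lin[OF B]
  have DA: "D (A n v) = A n (D v) + s (of_int (n + 1)) (A (n + 1) v)" for n v
    using cov(1) by (simp add: covariant_def algebra_simps)
  have DB: "D (B n v) = B n (D v) + s (of_int (n + 1)) (B (n + 1) v)" for n v
    using cov(2) by (simp add: covariant_def algebra_simps)
  have 1: "(\<lambda>n m. D (A n (B m v)) - A n (B m (D v))) = total_deriv (\<lambda>n m. A n (B m v))"
    by (simp add: fun_eq_iff DA DB total_deriv_def lins lin_add lin_scale)
  have 2: "(\<lambda>n m. D (B m (A n v)) - B m (A n (D v))) = total_deriv (\<lambda>n m. B m (A n v))"
    by (simp add: fun_eq_iff DA DB total_deriv_def lins lin_add lin_scale)
  have "mult_zw j (\<lambda>n m. D (A n (B m v))) (-1) m - mult_zw j (\<lambda>n m. A n (B m (D v))) (-1) m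
      = total_deriv (mult_zw j (\<lambda>n m. A n (B m v))) (-1) m"
    by (subst mult_zw_minus[symmetric]) (simp_all add: b lower_bounded_lin[OF b(1) D] 1 mult_zw_total_deriv)
  moreover have "mult_wz j (\<lambda>n m. D (B m (A n v))) (-1) m - mult_wz j (\<lambda>n m. B m (A n (D v))) (-1) m
      = total_deriv (mult_wz j (\<lambda>n m. B m (A n v))) (-1) m"
    by (subst mult_wz_minus[symmetric]) (simp_all add: b lower_bounded_lin[OF b(2) D] 2 mult_wz_total_deriv)
  ultimately show "D (nprod \<epsilon> j A B m v) - nprod \<epsilon> j A B m (D v)
      = s (of_int (m + 1)) (nprod \<epsilon> j A B (m + 1) v)"
    by (simp add: nprod_def lin_diff[OF D] lin_scale[OF D] mult_zw_lin[OF _ D] mult_wz_lin[OF _ D] b total_deriv_def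
        scale_right_diff_distrib algebra_simps eq_diff_eq diff_eq_eq)
qed

text \<open>The expansion for |w| > |z| has only nonnegative powers of z, as has A(z)v, so that term
  has no residue. In the other one, m = 0 leaves only the leading term z^j.\<close>

lemma nprod_regular:
  assumes A: "plain_field A" and B: "plain_field B"
    and v: "\<And>n. n < 0 \<Longrightarrow> A n v = 0" "\<And>n. n < 0 \<Longrightarrow> B n v = 0"
  shows "m < 0 \<Longrightarrow> nprod \<epsilon> j A B m v = 0" "nprod \<epsilon> j A B 0 v = A (-1 - j) (B 0 v)"
proof -
  note lins = plain_field_lin[OF A] plain_field_lin[OF B]
  have w: "mult_wz j (\<lambda>n m. B m (A n v)) (-1) m = 0" for m
    unfolding mult_wz_def by (subst mult_zw_sum[of 0]) (use v lins in \<open>auto simp: lin_0\<close>)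
  show "nprod \<epsilon> j A B m v = 0" if "m < 0"
    unfolding nprod_def w by (subst mult_zw_sum[of 0]) (use v lins that in \<open>auto simp: lin_0\<close>)
  show "nprod \<epsilon> j A B 0 v = A (-1 - j) (B 0 v)"
    unfolding nprod_def w by (subst mult_zw_sum[of 1]) (use v lins in \<open>auto simp: lin_0 signed_binom_0\<close>)
qed

lemma local_at_mono: "local_at r \<epsilon> A B \<Longrightarrow> r \<le> r' \<Longrightarrow> local_at r' \<epsilon> A B"
  unfolding local_at_def using funpow_diff_mono by blast

text \<open>From (z-w) \<partial>_z F = \<partial>_z((z-w)F) - F: differentiation costs one more
  power of z-w.\<close>

lemma local_at_deriv:
  assumes "local_at r \<epsilon> A B" "\<And>m. lin (B m)"
  shows "local_at (Suc r) \<epsilon> (\<lambda>n v. s (of_int (n + 1)) (A (n + 1) v)) B"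
proof -
  define D where "D = (\<lambda>(F :: int \<Rightarrow> int \<Rightarrow> 'v) n m. s (of_int (n + 1)) (F (n + 1) m))"
  have *: "(diff ^^ Suc r) (D F) = (\<lambda>_ _. 0)" if "(diff ^^ r) F = (\<lambda>_ _. 0)" for F
    using that
  proof (induction r arbitrary: F)
    case 0
    then show ?case by (simp add: D_def diff_def)
  next
    case (Suc r)
    have "diff (D F) = (\<lambda>n m. D (diff F) n m - F n m)"
      by (simp add: D_def diff_def fun_eq_iff scale_right_diff_distrib scale_left_distrib scale_left_diff_distrib)
    then have "(diff ^^ Suc (Suc r)) (D F) = (\<lambda>n m. (diff ^^ Suc r) (D (diff F)) n m - (diff ^^ Suc r) F n m)"
      by (simp add: funpow_Suc_right[of "Suc r"] funpow_diff_minus del: funpow.simps)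
    moreover have "(diff ^^ Suc r) (D (diff F)) = (\<lambda>_ _. 0)"
      by (rule Suc.IH) (use Suc.prems in \<open>simp add: funpow_swap1\<close>)
    ultimately show ?case using Suc.prems by simp
  qed
  show ?thesis
    unfolding local_at_def
  proof
    fix v
    have "(\<lambda>n m. s (of_int (n + 1)) (A (n + 1) (B m v)) - s \<epsilon> (B m (s (of_int (n + 1)) (A (n + 1) v))))
       = D (\<lambda>n m. A n (B m v) - s \<epsilon> (B m (A n v)))"
      by (simp add: D_def fun_eq_iff scale_right_diff_distrib lin_scale[OF assms(2)] scale_left_commute[of \<epsilon>] del: scale_scale)
    then show "(diff ^^ Suc r) (\<lambda>n m. s (of_int (n + 1)) (A (n + 1) (B m v)) - s \<epsilon> (B m (s (of_int (n + 1)) (A (n + 1) v))))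
       = (\<lambda>_ _. 0)"
      by (simp only: *[OF assms(1)[unfolded local_at_def, THEN spec]])
  qed
qed

end

section \<open>The state-field correspondence\<close>

context nw_susy_vertex_algebra
begin

lemma Y_lin: "lin (Y a n I)"
proof -
  have "susy_field s N (Y a)" by (rule Y_field)
  then show ?thesis unfolding susy_field_def by (elim conjE allE)
qed
lemma Y_support: "\<not> I \<subseteq> {1..N} \<Longrightarrow> Y a n I v = 0"
  using Y_field[of a] unfolding susy_field_def by blast

lemma Y_plain_field: "plain_field (\<lambda>n. Y a n I)"
  unfolding plain_field_def
proof (intro conjI allI)
  show "lin (Y a n I)" for n by (rule Y_lin)
  fix v
  obtain n0 where "\<And>n I. n < n0 \<Longrightarrow> Y a n I v = 0"
    using Y_field[of a] unfolding susy_field_def by metis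
  then show "\<exists>n0. \<forall>n<n0. Y a n I v = 0" by blast
qed

lemma Y_arg_lin: "lin (\<lambda>a. Y a n I v)"
  by (rule Y_linear)

lemma Y_homog:
  assumes "a \<in> homog V0 V1 p" "v \<in> homog V0 V1 q"
  shows "Y a n I v \<in> homog V0 V1 (p + card I + q)"
  using Y_parity[OF assms(1)] assms(2) unfolding field_parity_def op_parity_def by blast

lemma T_lin: "lin T"
  using T_even unfolding op_parity_def by blast

lemma S_lin: "i \<in> {1..N} \<Longrightarrow> lin (S i)"
  using S_odd[of i] unfolding op_parity_def by blast

lemma T_homog: "v \<in> homog V0 V1 q \<Longrightarrow> T v \<in> homog V0 V1 q"
  using T_even unfolding op_parity_def add_0 by blast

lemma S_homog: "i \<in> {1..N} \<Longrightarrow> v \<in> homog V0 V1 q \<Longrightarrow> S i v \<in> homog V0 V1 (Suc q)"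
  using S_odd[of i] unfolding op_parity_def plus_1_eq_Suc by blast

lemma Y_covariant:
  assumes "a \<in> homog V0 V1 p"
  shows "covariant T (\<lambda>n. Y a n I)"
  unfolding covariant_def
proof (intro allI)
  fix n v
  have "op_supercomm s 0 p T (Y a) n I v = dz s (Y a) n I v"
    by (simp only: T_comm[OF assms])
  then show "T (Y a n I v) - Y a n I (T v) = s (of_int (n + 1)) (Y a (n + 1) I v)"
    by (simp add: op_supercomm_def dz_def)
qed

lemma covariant_vac:
  assumes "covariant T A" "lin (A n)"
  shows "T (A n vac) = s (of_int (n + 1)) (A (n + 1) vac)"
  using assms(1)[unfolded covariant_def, rule_format, of n vac] by (simp add: T_vac lin_0[OF assms(2)])

lemma S_mode:
  assumes "a \<in> homog V0 V1 p" "i \<in> {1..N}"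
  shows "s ((-1) ^ card I) (S i (Y a n I v)) - s ((-1) ^ p) (Y a n I (S i v))
     = (if i \<in> I then 0 else s ((-1) ^ card {k \<in> I. k < i}) (Y a n (insert i I) v))"
proof -
  have "op_supercomm s 1 p (S i) (Y a) n I v = dtheta s i (Y a) n I v"
    by (simp only: S_comm[OF assms])
  then show ?thesis by (simp only: op_supercomm_def dtheta_def mult_1_left)
qed

text \<open>Multiplication by (z-w)^r does not mix odd monomials, so the axiom can be read at
  \<theta>^I \<zeta>^0; the coefficient of \<theta>^I has parity p + #I, whence the sign.\<close>

lemma Y_local:
  assumes "a \<in> homog V0 V1 p" "b \<in> homog V0 V1 q"
  shows "\<exists>r. local_at r ((-1) ^ ((p + card I) * q)) (\<lambda>n. Y a n I) (\<lambda>m. Y b m {})"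
proof (cases "finite I")
  case False
  then have "\<not> I \<subseteq> {1..N}" using finite_subset by blast
  then show ?thesis by (intro exI[of _ 0]) (simp add: local_at_def Y_support lin_0[OF Y_lin])
next
  case True
  obtain r :: nat where r: "op_mult2 s (even_zw (int r)) (supercomm s p q (Y a) (Y b)) = (\<lambda>_ _ _ _ _. 0)"
    using locality[OF assms] by blast
  show ?thesis
  proof (intro exI[of _ r], unfold local_at_def, intro allI ext)
    fix v n m
    define F where "F = (\<lambda>n m. Y a n I (Y b m {} v) - s ((-1) ^ ((p + card I) * q)) (Y b m {} (Y a n I v)))"
    have "0 = op_mult2 s (even_zw (int r)) (supercomm s p q (Y a) (Y b)) n I m {} v"
      unfolding r ..
    also have "\<dots> = mult_zw (int r) (\<lambda>n m. supercomm s p q (Y a) (Y b) n I m {} v) n m"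
      unfolding even_zw_eq op_mult2_tensor using True by (simp add: odd_mult_oddpow_empty even_mult_zw)
    also have "(\<lambda>n m. supercomm s p q (Y a) (Y b) n I m {} v) = F"
      by (simp add: F_def fun_eq_iff supercomm_def prod_ZW_def prod_WZ_def power_add algebra_simps)
    also have "mult_zw (int r) F = (diff ^^ r) F"
      using funpow_diff_mult_zw[of F 0 r] by (simp add: mult_zw_0)
    finally show "(diff ^^ r) (\<lambda>n m. Y a n I (Y b m {} v) - s ((-1) ^ ((p + card I) * q)) (Y b m {} (Y a n I v))) n m = 0"
      by (simp add: F_def)
  qed
qed

text \<open>The uniqueness argument: \<open>(z - w)^k (f(z) - Y(x,z)) Y(d,w)|0\<rangle>\<close> vanishes by locality, and setting
  \<open>w = 0\<close> leaves \<open>z^k (f(z) - Y(x,z)) d\<close>.\<close>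

lemma state_field:
  assumes lin: "\<And>n. lin (f n)"
    and reg: "\<And>n. n < 0 \<Longrightarrow> f n vac = 0"
    and cov: "covariant T f"
    and par: "f 0 vac \<in> homog V0 V1 P"
    and loc: "\<And>d r. d \<in> homog V0 V1 r \<Longrightarrow> \<exists>k. local_at k ((-1) ^ (P * r)) f (\<lambda>m. Y d m {})"
  shows "f n v = Y (f 0 vac) n {} v"
proof -
  define x where "x = f 0 vac"
  define g where "g = (\<lambda>n v. f n v - Y x n {} v)"
  have x: "x \<in> homog V0 V1 P" using par by (simp add: x_def)
  have g_add: "g n (u + v) = g n u + g n v" for n u v
    by (simp add: g_def lin_add[OF lin] lin_add[OF Y_lin])
  \<comment> \<open>Covariance and T|0> = 0 give T(g_k |0>) = (k+1) g_(k+1) |0>, so the value at k =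
    0 determines all later ones.\<close>
  have g_nat: "g (int k) vac = 0" for k
  proof (induction k)
    case 0
    then show ?case by (simp add: g_def x_def Y_vac_value)
  next
    case (Suc k)
    have "s (of_int (int k + 1)) (g (int k + 1) vac) = T (g (int k) vac)"
      using covariant_vac[OF cov lin, of "int k"] covariant_vac[OF Y_covariant[OF x] Y_lin, of "int k"]
      by (simp add: g_def scale_right_diff_distrib lin_diff[OF T_lin])
    also have "\<dots> = 0" by (simp add: Suc lin_0[OF T_lin])
    finally have "s (of_int (int k + 1)) (g (int k + 1) vac) = 0" .
    moreover have "(of_int (int k + 1) :: complex) = of_nat (Suc k)" by simp
    ultimately have "g (int k + 1) vac = 0"
      by (simp only: scale_eq_0_iff of_nat_neq_0 simp_thms)
    then show ?case by (simp add: add.commute)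
  qed
  have g_vac: "g n vac = 0" for n
  proof (cases "n < 0")
    case True
    then show ?thesis by (simp add: g_def reg Y_vac_regular)
  next
    case False
    then show ?thesis using g_nat[of "nat n"] by simp
  qed
  have g_homog: "g n d = 0" if d: "d \<in> homog V0 V1 r" for n d r
  proof -
    obtain k1 k2 where k: "local_at k1 ((-1) ^ (P * r)) f (\<lambda>m. Y d m {})"
      "local_at k2 ((-1) ^ (P * r)) (\<lambda>n. Y x n {}) (\<lambda>m. Y d m {})"
      using loc[OF d] Y_local[OF x d, of "{}"] by auto
    define k where "k = max k1 k2"
    define c :: complex where "c = (-1) ^ (P * r)"
    let ?y = "\<lambda>m. Y d m {}"
    have "(diff ^^ k) (\<lambda>n m. f n (?y m vac) - s c (?y m (f n vac))) = (\<lambda>_ _. 0)"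
      "(diff ^^ k) (\<lambda>n m. Y x n {} (?y m vac) - s c (?y m (Y x n {} vac))) = (\<lambda>_ _. 0)"
      using local_at_mono[OF k(1), of k] local_at_mono[OF k(2), of k] by (auto simp: local_at_def k_def c_def)
    then have "(diff ^^ k) (\<lambda>n m. (f n (?y m vac) - s c (?y m (f n vac)))
        - (Y x n {} (?y m vac) - s c (?y m (Y x n {} vac)))) = (\<lambda>_ _. 0)"
      by (simp add: funpow_diff_minus)
    \<comment> \<open>Both fields have parity P, hence the same sign c, and they agree on the
      vacuum; in the difference the terms with Y(d,w) on the left cancel.\<close>
    moreover have "?y m (f n vac) = ?y m (Y x n {} vac)" for n m
      using g_vac[of n] by (simp add: g_def)
    ultimately have "(diff ^^ k) (\<lambda>n m. g n (?y m vac)) = (\<lambda>_ _. 0)"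
      by (simp add: g_def)
    \<comment> \<open>The shift by k compensates the factor z^k that remains at w = 0.\<close>
    moreover have "(diff ^^ k) (\<lambda>n m. g n (?y m vac)) (n + int k) 0 = g n (?y 0 vac)"
      by (subst diff_at_corner) (auto simp: Y_vac_regular g_def lin_0[OF lin] lin_0[OF Y_lin])
    ultimately show ?thesis by (simp add: Y_vac_value)
  qed
  obtain v0 v1 where "v0 \<in> V0" "v1 \<in> V1" "v = v0 + v1"
    using decomposition by blast
  then have "g n v = 0"
    using g_homog[of v0 0 n] g_homog[of v1 1 n] by (simp add: g_add homog_def)
  then show ?thesis by (simp add: g_def x_def)
qed

text \<open>Reduces equations between superfields to equations between the states
  \<open>Y a 0 I vac\<close>.\<close>

lemma Y_component:
  assumes "a \<in> homog V0 V1 p"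
  shows "Y a n I v = Y (Y a 0 I vac) n {} v"
proof (rule state_field[where f = "\<lambda>n. Y a n I" and P = "p + card I"])
  show "Y a 0 I vac \<in> homog V0 V1 (p + card I)"
    using Y_homog[OF assms vac_even] by simp
qed (use Y_lin Y_vac_regular Y_covariant[OF assms] Y_local[OF assms] in auto)

text \<open>Dong's lemma supplies locality with sign exponent (p + #I + q)r, and the value on the
  vacuum at z = 0 is the state \<open>Y a (-1 - j) I b\<close>. This is (1) before any \<zeta>
  enters.\<close>

lemma Y_nprod:
  assumes a: "a \<in> homog V0 V1 p" and b: "b \<in> homog V0 V1 q"
  shows "nprod ((-1) ^ ((p + card I) * q)) j (\<lambda>n. Y a n I) (\<lambda>m. Y b m {}) n v = Y (Y a (-1 - j) I b) n {} v"
proof -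
  let ?f = "nprod ((-1) ^ ((p + card I) * q)) j (\<lambda>n. Y a n I) (\<lambda>m. Y b m {})"
  have reg: "?f n vac = 0" if "n < 0" for n
    by (rule nprod_regular(1)) (use that Y_plain_field Y_vac_regular in auto)
  have f0: "?f 0 vac = Y a (-1 - j) I b"
    by (subst nprod_regular(2)) (use Y_plain_field Y_vac_regular Y_vac_value in auto)
  have "?f n v = Y (?f 0 vac) n {} v"
  proof (rule state_field[where P = "p + card I + q"])
    show "lin (?f n)" for n by (rule nprod_lin[OF Y_plain_field Y_plain_field])
    show "covariant T ?f"
      by (rule covariant_nprod[OF Y_plain_field Y_plain_field T_lin Y_covariant[OF a] Y_covariant[OF b]])
    show "?f 0 vac \<in> homog V0 V1 (p + card I + q)"
      unfolding f0 by (rule Y_homog[OF a b])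
    fix d r assume d: "d \<in> homog V0 V1 r"
    obtain k1 k2 k3 where
      "local_at k1 ((-1) ^ ((p + card I) * q)) (\<lambda>n. Y a n I) (\<lambda>m. Y b m {})"
      "local_at k2 ((-1) ^ ((p + card I) * r)) (\<lambda>n. Y a n I) (\<lambda>m. Y d m {})"
      "local_at k3 ((-1) ^ (q * r)) (\<lambda>n. Y b n {}) (\<lambda>m. Y d m {})"
      using Y_local[OF a b, of I] Y_local[OF a d, of I] Y_local[OF b d, of "{}"] by auto
    from dong[OF Y_plain_field Y_plain_field Y_plain_field this, of j]
    show "\<exists>k. local_at k ((-1) ^ ((p + card I + q) * r)) ?f (\<lambda>m. Y d m {})"
      by (simp add: power_add algebra_simps)
  qed (use reg in auto)
  then show ?thesis by (simp only: f0)
qed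

lemma T_vac_mode: "a \<in> homog V0 V1 p \<Longrightarrow> T (Y a n I vac) = s (of_int (n + 1)) (Y a (n + 1) I vac)"
  by (rule covariant_vac[OF Y_covariant Y_lin])

lemma Y_T_even:
  assumes a: "a \<in> homog V0 V1 p"
  shows "s (of_int (n + 1)) (Y a (n + 1) {} v) = Y (T a) n {} v"
proof -
  let ?f = "\<lambda>n v. s (of_int (n + 1)) (Y a (n + 1) {} v)"
  have f0: "?f 0 vac = T a"
    using T_vac_mode[OF a, of 0 "{}"] by (simp add: Y_vac_value)
  have "?f n v = Y (?f 0 vac) n {} v"
  proof (rule state_field[where P = p])
    show "lin (?f n)" for n
      by unfold_locales (simp_all add: lin_add[OF Y_lin] lin_scale[OF Y_lin] scale_right_distrib mult.commute)
    \<comment> \<open>At n = -1 the mode \<open>Y a 0 {} vac\<close> is a itself, but its factor n +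
      1 vanishes.\<close>
    show "?f n vac = 0" if "n < 0" for n
      using that by (cases "n = -1") (auto simp: Y_vac_regular)
    show "covariant T ?f"
      using Y_covariant[OF a, of "{}"] unfolding covariant_def
      by (simp only: lin_scale[OF T_lin] lin_scale[OF Y_lin] scale_right_diff_distrib[symmetric]) simp
    show "?f 0 vac \<in> homog V0 V1 p"
      unfolding f0 by (rule T_homog[OF a])
    show "\<exists>k. local_at k ((-1) ^ (p * r)) ?f (\<lambda>m. Y d m {})" if d: "d \<in> homog V0 V1 r" for d r
    proof -
      obtain k where "local_at k ((-1) ^ (p * r)) (\<lambda>n. Y a n {}) (\<lambda>m. Y d m {})"
        using Y_local[OF a d, of "{}"] by auto
      from local_at_deriv[OF this Y_lin] show ?thesis by blast
    qed
  qed
  then show ?thesis by (simp only: f0)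
qed

text \<open>On the vacuum the supercommutator reduces to S^i, which therefore carries the
  coefficient at \<theta>^I to the one at \<open>insert i I\<close>. Repeated, this reaches every
  component from a.\<close>

lemma S_vac_mode:
  assumes "a \<in> homog V0 V1 p" "i \<in> {1..N}"
  shows "S i (Y a n I vac)
     = (if i \<in> I then 0 else s ((-1) ^ (card I + card {k \<in> I. k < i})) (Y a n (insert i I) vac))"
proof -
  let ?R = "if i \<in> I then 0 else s ((-1) ^ card {k \<in> I. k < i}) (Y a n (insert i I) vac)"
  have "S i (Y a n I vac) = s ((-1) ^ card I) (s ((-1) ^ card I) (S i (Y a n I vac)))"
    by (simp only: sign_square)
  also have "s ((-1) ^ card I) (S i (Y a n I vac)) = ?R"
    using S_mode[OF assms, of I n vac]
    by (simp only: S_vac[OF assms(2)] lin_0[OF Y_lin] scale_zero_right diff_0_right)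
  finally show ?thesis by (simp add: power_add)
qed

text \<open>Each new index k is reached by applying S^k to the formula for I. The two cases k < i
  and i < k record that the odd derivatives by \<theta>^i and \<theta>^k anticommute.\<close>

lemma Y_value_S:
  assumes a: "a \<in> homog V0 V1 p" and i: "i \<in> {1..N}" and I: "I \<subseteq> {1..N}"
  shows "Y (S i a) 0 I vac
     = (if i \<in> I then 0 else s ((-1) ^ card {k \<in> I. k < i}) (Y a 0 (insert i I) vac))"
proof -
  have "finite I" by (rule finite_subset[OF I]) simp
  then show ?thesis using I
  proof (induction I rule: finite_linorder_min_induct)
    case empty
    then show ?case
      using S_vac_mode[OF a i, of 0 "{}"] by (simp add: Y_vac_value)
  next
    case (insert k I)
    have k: "k \<in> {1..N}" "k \<notin> I" and I: "I \<subseteq> {1..N}" using insert by auto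
    have lt: "{l \<in> I. l < k} = {}" using insert by force
    have "s ((-1) ^ card I) (Y (S i a) 0 (insert k I) vac) = S k (Y (S i a) 0 I vac)"
      using S_vac_mode[OF S_homog[OF i a] k(1), of 0 I] k(2) by (simp add: lt)
    also have "\<dots> = S k (if i \<in> I then 0 else s ((-1) ^ card {k \<in> I. k < i}) (Y a 0 (insert i I) vac))"
      using insert.IH[OF I] by simp
    also have "\<dots> = s ((-1) ^ card I) (if i \<in> insert k I then 0
        else s ((-1) ^ card {l \<in> insert k I. l < i}) (Y a 0 (insert i (insert k I)) vac))"
    proof (cases "i \<in> insert k I")
      case True
      then show ?thesis
        using S_vac_mode[OF a k(1), of 0 "insert i I"] by (auto simp: lin_0[OF S_lin[OF k(1)]] lin_scale[OF S_lin[OF k(1)]])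
    next
      case False
      have fin: "finite I" using insert by auto
      have "k \<notin> insert i I" "card (insert i I) = Suc (card I)" using False k fin by auto
      then have *: "S k (Y a 0 (insert i I) vac) =
         s ((-1) ^ (Suc (card I) + card {l \<in> insert i I. l < k})) (Y a 0 (insert k (insert i I)) vac)"
        using S_vac_mode[OF a k(1), of 0 "insert i I"] by simp
      show ?thesis
      proof (cases "k < i")
        case True
        have e: "{l \<in> insert i I. l < k} = {}" using True lt by auto
        have *: "S k (Y a 0 (insert i I) vac) = s ((-1) ^ Suc (card I)) (Y a 0 (insert k (insert i I)) vac)"
          using *[unfolded e] by simp
        have "{l \<in> insert k I. l < i} = insert k {l \<in> I. l < i}" using True by auto
        then show ?thesis
          using False fin k unfolding if_not_P[OF False]
          by (simp add: * lin_scale[OF S_lin[OF k(1)]] insert_commute mult_ac)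
      next
        case ge: False
        then have "i < k" using False by auto
        then have "{l \<in> insert i I. l < k} = {i}" "{l \<in> insert k I. l < i} = {}" "{l \<in> I. l < i} = {}"
          using lt insert(2) by force+
        then show ?thesis
          using False fin k unfolding if_not_P[OF False]
          by (simp only:) (simp add: * lin_scale[OF S_lin[OF k(1)]] insert_commute)
      qed
    qed
    finally show ?case by (simp only: sign_cancel)
  qed
qed

lemma Y_S:
  assumes a: "a \<in> homog V0 V1 p" and i: "i \<in> {1..N}"
  shows "Y (S i a) = dtheta s i (Y a)"
proof (intro ext)
  fix n I v
  consider "\<not> I \<subseteq> {1..N}" | "I \<subseteq> {1..N}" "i \<in> I" | "I \<subseteq> {1..N}" "i \<notin> I" by blast
  then show "Y (S i a) n I v = dtheta s i (Y a) n I v"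
  proof cases
    case 1
    then have "Y a n (insert i I) v = 0" by (intro Y_support) blast
    then show ?thesis
      unfolding dtheta_def Y_support[OF 1] by simp
  next
    case 2
    have "Y (S i a) 0 I vac = 0" using Y_value_S[OF a i 2(1)] 2(2) by (simp only: if_True)
    then have "Y (S i a) n I v = Y 0 n {} v"
      using Y_component[OF S_homog[OF i a], of n I v] by (simp only:)
    then show ?thesis using 2(2) by (simp only: dtheta_def if_True lin_0[OF Y_arg_lin])
  next
    case 3
    let ?c = "(-1 :: complex) ^ card {k \<in> I. k < i}"
    have "Y (S i a) 0 I vac = s ?c (Y a 0 (insert i I) vac)"
      using Y_value_S[OF a i 3(1)] 3(2) by (simp only: if_False)
    then have "Y (S i a) n I v = Y (s ?c (Y a 0 (insert i I) vac)) n {} v"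
      using Y_component[OF S_homog[OF i a], of n I v] by (simp only:)
    also have "\<dots> = s ?c (Y a n (insert i I) v)"
      unfolding lin_scale[OF Y_arg_lin] Y_component[OF a, of n "insert i I" v] ..
    finally show ?thesis using 3(2) by (simp only: dtheta_def if_False)
  qed
qed

text \<open>T moves the coefficient at z^0 to the one at z^1, and S^k acts on both with the same
  sign, so the formula passes from I to \<open>insert k I\<close>.\<close>

lemma Y_value_T:
  assumes a: "a \<in> homog V0 V1 p" and I: "I \<subseteq> {1..N}"
  shows "Y (T a) 0 I vac = T (Y a 0 I vac)"
proof -
  have "finite I" by (rule finite_subset[OF I]) simp
  then show ?thesis using I
  proof (induction I rule: finite_linorder_min_induct)
    case empty
    then show ?case by (simp add: Y_vac_value)
  next
    case (insert k I)
    have k: "k \<in> {1..N}" "k \<notin> I" and I: "I \<subseteq> {1..N}" using insert by auto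
    have "s ((-1) ^ (card I + card {l \<in> I. l < k})) (Y (T a) 0 (insert k I) vac) = S k (Y (T a) 0 I vac)"
      using S_vac_mode[OF T_homog[OF a] k(1), of 0 I] k(2) by simp
    also have "\<dots> = S k (T (Y a 0 I vac))" using insert.IH[OF I] by simp
    also have "\<dots> = S k (Y a 1 I vac)" using T_vac_mode[OF a, of 0 I] by simp
    also have "\<dots> = s ((-1) ^ (card I + card {l \<in> I. l < k})) (Y a 1 (insert k I) vac)"
      using S_vac_mode[OF a k(1), of 1 I] k(2) by simp
    also have "Y a 1 (insert k I) vac = T (Y a 0 (insert k I) vac)"
      using T_vac_mode[OF a, of 0 "insert k I"] by simp
    finally show ?case by (simp only: sign_cancel)
  qed
qed

lemma Y_T:
  assumes a: "a \<in> homog V0 V1 p"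
  shows "Y (T a) = dz s (Y a)"
proof (intro ext)
  fix n I v
  show "Y (T a) n I v = dz s (Y a) n I v"
  proof (cases "I \<subseteq> {1..N}")
    case True
    have e: "Y a 0 I vac \<in> homog V0 V1 (p + card I)"
      using Y_homog[OF a vac_even] by simp
    have "Y (T a) n I v = Y (T (Y a 0 I vac)) n {} v"
      using Y_component[OF T_homog[OF a]] unfolding Y_value_T[OF a True, symmetric] .
    also have "\<dots> = s (of_int (n + 1)) (Y (Y a 0 I vac) (n + 1) {} v)"
      by (rule Y_T_even[OF e, symmetric])
    also have "\<dots> = dz s (Y a) n I v"
      unfolding dz_def Y_component[OF a, of "n + 1" I v, symmetric] ..
    finally show ?thesis .
  next
    case False
    then show ?thesis by (simp add: dz_def Y_support[OF False])
  qed
qed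

end

section \<open>Products with odd variables\<close>

text \<open>\<theta>^i leaves \<theta>^J past the larger elements of J and enters the complementary
  product past its smaller elements.\<close>

lemma sigma_remove:
  assumes "i \<in> J" "J \<subseteq> {1..N}"
  shows "sigma N J = (-1) ^ (card {k \<in> {1..N} - J. k < i} + card {k \<in> J. i < k}) * sigma N (J - {i})"
proof -
  define J' where "J' = J - {i}"
  have J: "J = insert i J'" "i \<notin> J'" using assms by (auto simp: J'_def)
  have fin: "finite J'" "finite ({1..N} - J)" using assms finite_subset by (auto simp: J'_def)
  have e: "{1..N} - J' = insert i ({1..N} - J)" using assms by (auto simp: J'_def)
  have c: "{k \<in> J. i < k} = {k \<in> J'. i < k}" by (auto simp: J'_def)
  have "sigma N J = (-1) ^ card {k \<in> {1..N} - J. k < i} * shuffle_sign J' ({1..N} - J)"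
    unfolding sigma_def by (subst J(1)) (rule shuffle_sign_insert_left[OF fin J(2)])
  moreover have "sigma N J' = (-1) ^ card {k \<in> J'. i < k} * shuffle_sign J' ({1..N} - J)"
    unfolding sigma_def e by (rule shuffle_sign_insert_right) (use fin assms in auto)
  ultimately show ?thesis
    unfolding c J'_def[symmetric] by (simp add: power_add)
qed

context nw_susy_vertex_algebra
begin

text \<open>The coefficient at \<open>z^-1 w^m \<theta>^I \<zeta>^K\<close> of the bracket defining the \<open>(j|{})\<close>-product.\<close>

definition nth_prod_coeff :: "nat \<Rightarrow> nat \<Rightarrow> 'v \<Rightarrow> 'v \<Rightarrow> int \<Rightarrow> int \<Rightarrow> 'v \<Rightarrow> nat set \<Rightarrow> nat set \<Rightarrow> 'v" where
  "nth_prod_coeff p q a b j m v I K = s ((-1) ^ ((p + card I) * card K))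
     (nprod ((-1) ^ ((p + card I) * (q + card K))) j (\<lambda>n. Y a n I) (\<lambda>m. Y b m K) m v)"

text \<open>The coefficients at \<theta>^I and \<zeta>^K are ordinary fields of parities p + #I and
  q + #K. The product of these parities is the exponent of their commutation sign, and
  \<open>G\<close> checks that it absorbs the signs of both orderings.\<close>

lemma field_nth_prod_eq:
  assumes "J \<subseteq> {1..N}"
  shows "field_nth_prod s N p q (Y a) j J (Y b) m K v = odd_mult (oddpow J) (nth_prod_coeff p q a b j m v) {1..N} K"
proof -
  have fin: "finite J" using assms by (rule finite_subset) simp
  have zw: "mult_zw j (\<lambda>n m. prod_ZW s p (Y a) (Y b) n I m K v) (-1) m
     = s ((-1) ^ ((p + card I) * card K)) (mult_zw j (\<lambda>n m. Y a n I (Y b m K v)) (-1) m)" for I K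
    unfolding prod_ZW_def by (rule mult_zw_scale) (rule lower_bounded_plain_field[OF Y_plain_field Y_plain_field])
  have wz: "mult_wz j (\<lambda>n m. prod_WZ s q (Y b) (Y a) n I m K v) (-1) m
     = s ((-1) ^ (q * card I)) (mult_wz j (\<lambda>n m. Y b m K (Y a n I v)) (-1) m)" for I K
    unfolding prod_WZ_def by (rule mult_wz_scale) (rule lower_bounded_plain_field[OF Y_plain_field Y_plain_field])
  have G: "nth_prod_coeff p q a b j m v I K = mult_zw j (\<lambda>n m. prod_ZW s p (Y a) (Y b) n I m K v) (-1) m
     - s ((-1) ^ (p * q)) (mult_wz j (\<lambda>n m. prod_WZ s q (Y b) (Y a) n I m K v) (-1) m)" for I K
  proof -
    have "(-1 :: complex) ^ ((p + card I) * card K) * (-1) ^ ((p + card I) * (q + card K))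
      = (-1) ^ (p * q) * (-1) ^ (q * card I)"
      unfolding power_add[symmetric] minus_one_power_iff by (simp add: algebra_simps)
    then show ?thesis
      by (simp add: nth_prod_coeff_def nprod_def zw wz scale_right_diff_distrib)
  qed
  show ?thesis
    unfolding field_nth_prod_def res_Z_def ipow_zw_eq[OF fin] ipow_wz_eq[OF fin] op_mult2_tensor
      even_mult_zw even_mult_wz odd_mult_scale_right[symmetric] odd_mult_minus[symmetric] G[symmetric] ..
qed

text \<open>For i below K the odd derivative carries no sign; this is how every induction on K
  replaces \<zeta>^i by S^i.\<close>

lemma Y_S_shift:
  assumes x: "x \<in> homog V0 V1 q" and i: "i \<in> {1..N}" and K: "\<And>k. k \<in> K \<Longrightarrow> i < k"
  shows "Y (S i x) m K v = Y x m (insert i K) v"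
proof -
  have e: "i \<notin> K" "{k \<in> K. k < i} = {}" using K by force+
  show ?thesis
    unfolding Y_S[OF x i] dtheta_def e(2) using e(1) by (simp only: if_False card.empty power_0 scale_one)
qed

text \<open>The derivative by \<zeta>^i passes \<theta>^I and the coefficient of a, together of
  parity p.\<close>

lemma nth_prod_coeff_shift:
  assumes b: "b \<in> homog V0 V1 q" and i: "i \<in> {1..N}" and K: "\<And>k. k \<in> K \<Longrightarrow> i < k" "finite K"
  shows "s ((-1) ^ card I) (nth_prod_coeff p q a b j m v I (insert i K)) = s ((-1) ^ p) (nth_prod_coeff p (Suc q) a (S i b) j m v I K)"
proof -
  have c: "card (insert i K) = Suc (card K)" using K by (subst card_insert_disjoint) auto
  have "(\<lambda>m. Y (S i b) m K) = (\<lambda>m. Y b m (insert i K))"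
    using Y_S_shift[OF b i K(1)] by (simp add: fun_eq_iff)
  moreover have "(-1 :: complex) ^ card I * (-1) ^ ((p + card I) * Suc (card K)) = (-1) ^ p * (-1) ^ ((p + card I) * card K)"
    unfolding power_add[symmetric] minus_one_power_iff by (simp add: algebra_simps)
  ultimately show ?thesis
    unfolding nth_prod_coeff_def c by (simp del: mult_Suc_right)
qed

lemma S_mode_alt:
  assumes a: "a \<in> homog V0 V1 p" and i: "i \<in> {1..N}"
  shows "s ((-1) ^ card I) (S i (Y a n I v))
     = s ((-1) ^ p) (Y a n I (S i v)) + (if i \<in> I then 0 else s ((-1) ^ card {k \<in> I. k < i}) (Y a n (insert i I) v))"
  using S_mode[OF a i, of I n v] by (simp only: diff_eq_eq add.commute)

text \<open>At K = {} only \<theta>^J of the kernel contributes, and \<open>Y_nprod\<close> applies.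
  In the step both sides are differentiated by \<zeta>^i, which yields the claim for J - {i} with b
  and for J with S^i b; hence the generalization over J and b.\<close>

lemma nth_prod_coeff_odd_mult:
  assumes a: "a \<in> homog V0 V1 p" and b: "b \<in> homog V0 V1 q" and J: "J \<subseteq> {1..N}" and K: "K \<subseteq> {1..N}"
  shows "odd_mult (oddpow J) (nth_prod_coeff p q a b j m v) {1..N} K = s (sigma N J) (Y (mode N Y a j J b) m K v)"
proof -
  have "finite K" by (rule finite_subset[OF K]) simp
  then show ?thesis using K b J
  proof (induction K arbitrary: b q J rule: finite_linorder_min_induct)
    case empty
    let ?t = "\<lambda>I'. s (shuffle_sign I' ({1..N} - I')) (nth_prod_coeff p q a b j m v ({1..N} - I') {})"
    have "odd_mult (oddpow J) (nth_prod_coeff p q a b j m v) {1..N} {} = (\<Sum>I'\<in>Pow {1..N}. if I' = J then ?t I' else 0)"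
      unfolding odd_mult_K_empty by (intro sum.cong refl) (simp add: oddpow_def)
    also have "\<dots> = ?t J" using empty(3) by (simp add: sum.delta)
    also have "\<dots> = s (sigma N J) (Y (mode N Y a j J b) m {} v)"
      using Y_nprod[OF a empty(2), of "{1..N} - J" j m v] by (simp add: nth_prod_coeff_def sigma_def mode_def)
    finally show ?case .
  next
    case (insert i K)
    note b = insert.prems(2) and J = insert.prems(3)
    have i: "i \<in> {1..N}" and K: "K \<subseteq> {1..N}" and lt: "\<And>k. k \<in> K \<Longrightarrow> i < k"
      using insert by auto
    define I where "I = {1..N} - J"
    define x where "x = Y a (-1 - j) I b"
    have mode: "mode N Y a j J c = Y a (-1 - j) I c" for c by (simp add: mode_def I_def)
    have mode': "mode N Y a j (J - {i}) c = Y a (-1 - j) (insert i I) c" if "i \<in> J" for c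
    proof -
      have "{1..N} - (J - {i}) = insert i I" using that i by (auto simp: I_def)
      then show ?thesis by (simp only: mode_def)
    qed
    have x: "x \<in> homog V0 V1 (p + card I + q)"
      unfolding x_def by (rule Y_homog[OF a b])
    have Sb: "S i b \<in> homog V0 V1 (Suc q)" by (rule S_homog[OF i b])
    have finJ: "finite J" by (rule finite_subset[OF J]) simp
    have N: "N = card I + card J"
      using J finJ card_mono[OF _ J] by (simp add: I_def card_Diff_subset)
    have shift: "odd_mult (oddpow J) (\<lambda>I K. s ((-1) ^ card I) (nth_prod_coeff p q a b j m v I (insert i K))) {1..N} K
       = odd_mult (oddpow J) (\<lambda>I K. s ((-1) ^ p) (nth_prod_coeff p (Suc q) a (S i b) j m v I K)) {1..N} K"
      by (rule odd_mult_cong[OF refl]) (intro nth_prod_coeff_shift[OF b i], use lt insert(1) in auto)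
    \<comment> \<open>The residue is read at \<theta>^1...\<theta>^N, so the derivative passes N odd
      variables.\<close>
    have A: "s ((-1) ^ N) (odd_mult (oddpow J) (nth_prod_coeff p q a b j m v) {1..N} (insert i K))
      = (if i \<in> J then s (- ((-1) ^ card {k \<in> J. k < i}) * sigma N (J - {i})) (Y (Y a (-1 - j) (insert i I) b) m K v) else 0)
        + s ((-1) ^ card J * (-1) ^ p * sigma N J) (Y (Y a (-1 - j) I (S i b)) m K v)"
    proof -
      have "s ((-1) ^ card {1..N}) (odd_mult (oddpow J) (nth_prod_coeff p q a b j m v) {1..N} (insert i K))
         = (if i \<in> J then s (- ((-1) ^ card {k \<in> J. k < i})) (odd_mult (oddpow (J - {i})) (nth_prod_coeff p q a b j m v) {1..N} K) else 0)
         + s ((-1) ^ card J) (odd_mult (oddpow J) (\<lambda>I K. s ((-1) ^ card I) (nth_prod_coeff p q a b j m v I (insert i K))) {1..N} K)"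
        by (rule odd_mult_oddpow_insert) (use lt insert(1) in auto)
      moreover have "odd_mult (oddpow (J - {i})) (nth_prod_coeff p q a b j m v) {1..N} K
         = s (sigma N (J - {i})) (Y (mode N Y a j (J - {i}) b) m K v)"
        by (rule insert.IH[OF K b]) (use J in blast)
      moreover have "odd_mult (oddpow J) (nth_prod_coeff p (Suc q) a (S i b) j m v) {1..N} K
         = s (sigma N J) (Y (mode N Y a j J (S i b)) m K v)"
        by (rule insert.IH[OF K Sb J])
      ultimately show ?thesis
        unfolding shift odd_mult_scale_right by (simp add: mode mode')
    qed
    \<comment> \<open>The right-hand side: S^i x for x = a_(j|J) b is expanded by moving S^i past
      a_(j|J).\<close>
    have "Y x m (insert i K) v = Y (S i x) m K v"
      by (rule Y_S_shift[OF x i lt, symmetric])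
    also have "S i x = s ((-1) ^ card I) (s ((-1) ^ card I) (S i x))"
      by (simp only: sign_square)
    also have "s ((-1) ^ card I) (S i x) = s ((-1) ^ p) (Y a (-1 - j) I (S i b))
        + (if i \<in> I then 0 else s ((-1) ^ card {k \<in> I. k < i}) (Y a (-1 - j) (insert i I) b))"
      unfolding x_def by (rule S_mode_alt[OF a i])
    finally have B: "Y x m (insert i K) v = s ((-1) ^ card I * (-1) ^ p) (Y (Y a (-1 - j) I (S i b)) m K v)
        + (if i \<in> J then s ((-1) ^ card I * (-1) ^ card {k \<in> I. k < i}) (Y (Y a (-1 - j) (insert i I) b) m K v) else 0)"
      using i by (auto simp: lin_add[OF Y_arg_lin] lin_scale[OF Y_arg_lin] lin_0[OF Y_arg_lin] scale_right_distrib I_def)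
    have c1: "(-1) ^ N * (sigma N J * ((-1) ^ card I * (-1) ^ p)) = (-1) ^ card J * (-1) ^ p * sigma N J"
      by (simp add: N power_add)
    \<comment> \<open>The factors of (\<theta>-\<zeta>)^J with index above i contribute (-1)^#{k
      \<in> J. i < k} to (-1)^N; \<open>sigma_remove\<close> contains the same sign, and they
      cancel.\<close>
    have c2: "(-1) ^ N * sigma N J * ((-1) ^ card I * (-1) ^ card {k \<in> I. k < i})
        = - ((-1) ^ card {k \<in> J. k < i}) * sigma N (J - {i})" if "i \<in> J"
    proof -
      have "card J = Suc (card (J - {i}))" using that finJ by (simp only: card.remove)
      also have "card (J - {i}) = card {k \<in> J - {i}. k < i} + card {k \<in> J - {i}. i < k}"
        by (rule card_less_greater) (use finJ in auto)
      also have "{k \<in> J - {i}. k < i} = {k \<in> J. k < i}" by auto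
      also have "{k \<in> J - {i}. i < k} = {k \<in> J. i < k}" by auto
      finally have "(-1 :: complex) ^ N = (-1) ^ card I * - ((-1) ^ card {k \<in> J. k < i} * (-1) ^ card {k \<in> J. i < k})"
        by (simp add: N power_add)
      then show ?thesis
        by (simp add: sigma_remove[OF that J, folded I_def] power_add mult_ac)
    qed
    have "s ((-1) ^ N) (odd_mult (oddpow J) (nth_prod_coeff p q a b j m v) {1..N} (insert i K))
        = s ((-1) ^ N) (s (sigma N J) (Y x m (insert i K) v))"
      unfolding A B scale_right_distrib scale_scale c1
      by (cases "i \<in> J") (simp_all only: c2 if_True if_False scale_scale scale_zero_right add_0_right add_0_left add.commute)
    then show ?case unfolding mode x_def[symmetric] by (simp only: sign_cancel)
  qed
qed

lemma field_nth_prod_outside: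
  assumes J: "J \<subseteq> {1..N}" and K: "\<not> K \<subseteq> {1..N}"
  shows "field_nth_prod s N p q (Y a) j J (Y b) m K v = 0"
  unfolding field_nth_prod_eq[OF J]
proof (rule odd_mult_zero)
  fix I' K' assume "I' \<subseteq> {1..N}" "K' \<subseteq> K" "oddpow J I' K' \<noteq> 0"
  then have "\<not> K - K' \<subseteq> {1..N}" using K J by (auto simp: oddpow_def split: if_splits)
  then have *: "Y b m (K - K') v = 0" for m v by (rule Y_support)
  show "nth_prod_coeff p q a b j m v ({1..N} - I') (K - K') = 0"
    unfolding nth_prod_coeff_def nprod_def * mult_wz_def
    by (subst (1 2) mult_zw_sum[of 0]) (auto simp: lin_0[OF Y_lin])
qed

lemma Y_mode:
  assumes a: "a \<in> homog V0 V1 p" and b: "b \<in> homog V0 V1 q" and J: "J \<subseteq> {1..N}"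
  shows "Y (mode N Y a j J b) m K v = s (sigma N J) (field_nth_prod s N p q (Y a) j J (Y b) m K v)"
proof (cases "K \<subseteq> {1..N}")
  case True
  have "sigma N J * sigma N J = 1" by (simp add: sigma_def)
  then show ?thesis
    unfolding field_nth_prod_eq[OF J] nth_prod_coeff_odd_mult[OF a b J True] by simp
next
  case False
  then show ?thesis by (simp add: Y_support field_nth_prod_outside[OF J])
qed

section \<open>The operator product expansion\<close>

text \<open>Newton's forward difference formula: along an antidiagonal, \<open>diff\<close> is the forward difference
  in the variable \<open>-1 - n\<close>.\<close>

lemma newton:
  fixes F :: "int \<Rightarrow> int \<Rightarrow> 'v"
  assumes "(diff ^^ M) F = (\<lambda>_ _. 0)"
  shows "F n m = (\<Sum>j<M. s (of_int (-1 - n) gchoose j) ((diff ^^ j) F (-1) (n + m + 1 + int j)))"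
  using assms
proof (induction M arbitrary: F n m)
  case 0
  then show ?case by simp
next
  case (Suc M)
  \<comment> \<open>The error of the formula. The induction hypothesis for \<open>diff F\<close>
    gives \<open>diff R\<close> = 0, so R is constant on antidiagonals; at n = -1 it vanishes
    because there the binomial coefficients are those of 0.\<close>
  define R where "R = (\<lambda>n m. F n m - (\<Sum>j<Suc M. s (of_int (-1 - n) gchoose j) ((diff ^^ j) F (-1) (n + m + 1 + int j))))"
  have "diff R = (\<lambda>_ _. 0)"
  proof (intro ext)
    fix n m
    have g: "((of_int (- n) :: complex) gchoose Suc j) - (of_int (-1 - n) gchoose Suc j) = (of_int (-1 - n) gchoose j)" for j
      using gbinomial_Suc_Suc[of "of_int (-1 - n) :: complex" j] by (simp add: algebra_simps)
    have "diff R n m = diff F n m - (\<Sum>j<Suc M. s ((of_int (- n) gchoose j) - (of_int (-1 - n) gchoose j))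
        ((diff ^^ j) F (-1) (n + m + int j)))"
      by (simp add: diff_def R_def sum_subtractf scale_left_diff_distrib algebra_simps)
    also have "(\<Sum>j<Suc M. s ((of_int (- n) gchoose j) - (of_int (-1 - n) gchoose j)) ((diff ^^ j) F (-1) (n + m + int j)))
      = (\<Sum>j<M. s (of_int (-1 - n) gchoose j) ((diff ^^ j) (diff F) (-1) (n + m + 1 + int j)))"
      unfolding sum.lessThan_Suc_shift g by (simp add: funpow_swap1 add_ac)
    also have "\<dots> = diff F n m"
      by (rule Suc.IH[symmetric]) (use Suc.prems in \<open>simp add: funpow_swap1\<close>)
    finally show "diff R n m = 0" by simp
  qed
  then have step: "R (n - 1) (m + 1) = R n m" for n m
    by (simp add: diff_def fun_eq_iff)
  have "R (- 1) m = 0" for m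
    unfolding R_def sum.lessThan_Suc_shift by simp
  moreover have R: "R (- 1 + k) (m - k) = R (- 1) m" for k m
  proof (induction k rule: int_induct[where k = 0])
    case (step1 k)
    then show ?case using step[of "-1 + (k + 1)" "m - (k + 1)"] by (simp add: algebra_simps)
  next
    case (step2 k)
    then show ?case using step[of "-1 + k" "m - k"] by (simp add: algebra_simps)
  qed simp
  ultimately have "R n m = 0" using R[of "n + 1" "n + m + 1"] by simp
  then show ?case by (simp add: R_def)
qed

text \<open>The coefficient at \<open>z^n w^m \<theta>^I \<zeta>^K\<close> of \<open>(i\<^sub>z\<^sub>,\<^sub>w - i\<^sub>w\<^sub>,\<^sub>z) (z - w)^(-1-j) Y(x,W)\<close>.\<close>

definition ope_coeff :: "nat \<Rightarrow> int \<Rightarrow> int \<Rightarrow> 'v \<Rightarrow> 'v \<Rightarrow> nat set \<Rightarrow> nat set \<Rightarrow> 'v" where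
  "ope_coeff j n m v x I K =
     (if I = {} then s (of_int (-1 - n) gchoose j) (Y x (n + m + 1 + int j) K v) else 0)"

text \<open>The coefficient at z^n w^m \<theta>^I \<zeta>^K of (i_zw - i_wz)(Z-W)^(-1-j|L) Y(x,W),
  applied to v.\<close>

abbreviation \<Phi> :: "nat \<Rightarrow> int \<Rightarrow> int \<Rightarrow> 'v \<Rightarrow> nat set \<Rightarrow> nat set \<Rightarrow> nat set \<Rightarrow> 'v \<Rightarrow> 'v" where
  "\<Phi> j n m v I K L x \<equiv> odd_mult (oddpow L) (ope_coeff j n m v x) I K"

lemma Phi_lin: "lin (\<Phi> j n m v I K L)"
proof -
  have 1: "ope_coeff j n m v (x + y) = (\<lambda>I K. ope_coeff j n m v x I K + ope_coeff j n m v y I K)" for x y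
    by (simp add: fun_eq_iff ope_coeff_def lin_add[OF Y_arg_lin] scale_right_distrib)
  have 2: "ope_coeff j n m v (s c x) = (\<lambda>I K. s c (ope_coeff j n m v x I K))" for x c
    by (simp add: fun_eq_iff ope_coeff_def lin_scale[OF Y_arg_lin] mult.commute)
  show ?thesis
    by unfold_locales (simp_all add: 1 2 odd_mult_plus odd_mult_scale_right)
qed

text \<open>For nonnegative exponents the two expansions agree, and the product is the residue of
  (z-w)^j times the commutator: the coefficients in Newton's formula.\<close>

lemma nprod_nonneg:
  assumes A: "plain_field A" and B: "plain_field B"
  shows "nprod \<epsilon> (int j) A B m v = (diff ^^ j) (\<lambda>n m. A n (B m v) - s \<epsilon> (B m (A n v))) (-1) m"
proof -
  have "(diff ^^ j) (\<lambda>n m. A n (B m v)) = mult_zw (int j) (\<lambda>n m. A n (B m v))"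
    using funpow_diff_mult_zw[OF disjI1[OF lower_bounded_plain_field[OF A B]], of j 0 v] by (simp add: mult_zw_0)
  moreover have "(diff ^^ j) (\<lambda>n m. B m (A n v)) = mult_wz (int j) (\<lambda>n m. B m (A n v))"
    using funpow_diff_mult_wz[OF lower_bounded_plain_field[OF B A], of j 0 v] by (simp add: mult_wz_0)
  ultimately show ?thesis
    by (simp add: nprod_def funpow_diff_minus funpow_diff_scale)
qed

lemma supercomm_shift:
  assumes b: "b \<in> homog V0 V1 q" and i: "i \<in> {1..N}" and K: "\<And>k. k \<in> K \<Longrightarrow> i < k" "finite K"
  shows "s ((-1) ^ card I) (supercomm s p q (Y a) (Y b) n I m (insert i K) v)
     = s ((-1) ^ p) (supercomm s p (Suc q) (Y a) (Y (S i b)) n I m K v)"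
proof -
  have c: "card (insert i K) = Suc (card K)" using K by (subst card_insert_disjoint) auto
  have "(-1 :: complex) ^ card I * (-1) ^ ((p + card I) * Suc (card K)) = (-1) ^ p * (-1) ^ ((p + card I) * card K)"
    unfolding power_add[symmetric] minus_one_power_iff by (simp add: algebra_simps)
  moreover have "(-1 :: complex) ^ card I * ((-1) ^ (p * q) * (-1) ^ (q * card I))
      = (-1) ^ p * ((-1) ^ (p * Suc q) * (-1) ^ (Suc q * card I))"
    unfolding power_add[symmetric] minus_one_power_iff by (simp add: algebra_simps)
  ultimately show ?thesis
    unfolding supercomm_def prod_ZW_def prod_WZ_def c
    by (simp only: scale_right_diff_distrib scale_scale Y_S_shift[OF b i K(1)])
qed

text \<open>The index \<open>L\<close> stands for \<open>{1..N} - J\<close>.\<close>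

lemma supercomm_expansion:
  assumes a: "a \<in> homog V0 V1 p" and b: "b \<in> homog V0 V1 q" and I: "I \<subseteq> {1..N}" and K: "K \<subseteq> {1..N}"
    and M: "\<And>j L. j \<ge> M \<Longrightarrow> Y a (-1 - int j) L b = 0"
  shows "supercomm s p q (Y a) (Y b) n I m K v
       = (\<Sum>j<M. \<Sum>L\<in>Pow {1..N}. \<Phi> j n m v I K L (Y a (-1 - int j) L b))"
proof -
  have finI: "finite I" by (rule finite_subset[OF I]) simp
  have "finite K" by (rule finite_subset[OF K]) simp
  then show ?thesis using K b M
  proof (induction K arbitrary: b q rule: finite_linorder_min_induct)
    case empty
    note b = empty(2) and M = empty(3)
    define \<epsilon> :: complex where "\<epsilon> = (-1) ^ ((p + card I) * q)"
    define C where "C = (\<lambda>n m. Y a n I (Y b m {} v) - s \<epsilon> (Y b m {} (Y a n I v)))"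
    obtain r where "local_at r \<epsilon> (\<lambda>n. Y a n I) (\<lambda>m. Y b m {})"
      using Y_local[OF a b, of I] unfolding \<epsilon>_def by blast
    then have "(diff ^^ r) C = (\<lambda>_ _. 0)" unfolding local_at_def C_def by blast
    \<comment> \<open>The locality order r may differ from M, the bound beyond which the modes
      vanish; the maximum serves both, and the terms from M on are dropped below.\<close>
    then have "(diff ^^ max r M) C = (\<lambda>_ _. 0)" by (rule funpow_diff_mono) simp
    then have "C n m = (\<Sum>j<max r M. s (of_int (-1 - n) gchoose j) ((diff ^^ j) C (-1) (n + m + 1 + int j)))"
      by (rule newton)
    also have "(\<lambda>j. (diff ^^ j) C (-1) (n + m + 1 + int j)) = (\<lambda>j. Y (Y a (-1 - int j) I b) (n + m + 1 + int j) {} v)"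
      unfolding C_def \<epsilon>_def nprod_nonneg[OF Y_plain_field Y_plain_field, symmetric] Y_nprod[OF a b] ..
    then have "(\<Sum>j<max r M. s (of_int (-1 - n) gchoose j) ((diff ^^ j) C (-1) (n + m + 1 + int j)))
        = (\<Sum>j<max r M. s (of_int (-1 - n) gchoose j) (Y (Y a (-1 - int j) I b) (n + m + 1 + int j) {} v))"
      by (simp only: fun_eq_iff)
    also have "\<dots> = (\<Sum>j<M. s (of_int (-1 - n) gchoose j) (Y (Y a (-1 - int j) I b) (n + m + 1 + int j) {} v))"
      by (rule sum.mono_neutral_right) (auto simp: M lin_0[OF Y_arg_lin])
    also have "\<dots> = (\<Sum>j<M. \<Sum>L\<in>Pow {1..N}. \<Phi> j n m v I {} L (Y a (-1 - int j) L b))"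
    proof (rule sum.cong[OF refl])
      fix j
      let ?w = "\<lambda>L. s (of_int (-1 - n) gchoose j) (Y (Y a (-1 - int j) L b) (n + m + 1 + int j) {} v)"
      have "\<Phi> j n m v I {} L (Y a (-1 - int j) L b) = (if L = I then ?w L else 0)" for L
      proof -
        have "\<Phi> j n m v I {} L (Y a (-1 - int j) L b)
           = (\<Sum>I'\<in>Pow I. if I' = I then (if L = I then ?w L else 0) else 0)"
          unfolding odd_mult_K_empty
          by (intro sum.cong refl) (auto simp: oddpow_def ope_coeff_def)
        then show ?thesis using finI by (simp add: sum.delta)
      qed
      then show "?w I = (\<Sum>L\<in>Pow {1..N}. \<Phi> j n m v I {} L (Y a (-1 - int j) L b))"
        using I by (simp add: sum.delta)
    qed
    finally have "C n m = (\<Sum>j<M. \<Sum>L\<in>Pow {1..N}. \<Phi> j n m v I {} L (Y a (-1 - int j) L b))" .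
    moreover have "supercomm s p q (Y a) (Y b) n I m {} v = C n m"
      by (simp add: supercomm_def prod_ZW_def prod_WZ_def C_def \<epsilon>_def power_add algebra_simps)
    ultimately show ?case by simp
  next
    case (insert i K)
    note b = insert.prems(2) and M = insert.prems(3)
    have i: "i \<in> {1..N}" and K: "K \<subseteq> {1..N}" and lt: "\<And>k. k \<in> K \<Longrightarrow> i < k"
      using insert by auto
    have Sb: "S i b \<in> homog V0 V1 (Suc q)" by (rule S_homog[OF i b])
    \<comment> \<open>The bound M is inherited by S^i b, because S^i moves past the modes of a up to
      modes of the same even index.\<close>
    have M': "Y a (-1 - int j) L (S i b) = 0" if "j \<ge> M" for j L
    proof -
      have "s ((-1) ^ p) (Y a (-1 - int j) L (S i b)) = 0"
        using S_mode_alt[OF a i, of L "-1 - int j" b] M[OF that] lin_0[OF S_lin[OF i]] by (simp cong: if_cong)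
      then show ?thesis by simp
    qed
    have *: "(\<Sum>L\<in>Pow {1..N}. s ((-1) ^ card I) (\<Phi> j n m v I (insert i K) L (Y a (-1 - int j) L b)))
        = (\<Sum>L\<in>Pow {1..N}. s ((-1) ^ p) (\<Phi> j n m v I K L (Y a (-1 - int j) L (S i b))))" for j
    proof -
      define x where "x = (\<lambda>L. Y a (-1 - int j) L b)"
      have x: "x L \<in> homog V0 V1 (p + card L + q)" for L
        unfolding x_def by (rule Y_homog[OF a b])
      have W: "s ((-1) ^ card I') (ope_coeff j n m v (x L) I' (insert i K')) = ope_coeff j n m v (S i (x L)) I' K'"
        if "K' \<subseteq> K" for L I' K'
        unfolding ope_coeff_def using that lt by (simp add: Y_S_shift[OF x i, of K'] subset_eq)
      \<comment> \<open>The derivative hits either the kernel, removing i from L, or Y(x,W),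
        replacing x by S^i x.\<close>
      have split: "s ((-1) ^ card I) (\<Phi> j n m v I (insert i K) L (x L))
         = (if i \<in> L then s (- ((-1) ^ card {k \<in> L. k < i})) (\<Phi> j n m v I K (L - {i}) (x L)) else 0)
         + s ((-1) ^ card L) (\<Phi> j n m v I K L (S i (x L)))" for L
      proof -
        have "odd_mult (oddpow L) (\<lambda>I K. s ((-1) ^ card I) (ope_coeff j n m v (x L) I (insert i K))) I K
           = \<Phi> j n m v I K L (S i (x L))"
          by (rule odd_mult_cong[OF refl], rule W) simp
        then show ?thesis
          by (subst odd_mult_oddpow_insert) (use finI lt insert(1) in auto)
      qed
      \<comment> \<open>Indexing by L - {i} instead of L brings the kernel terms to the same kernel
        as the others.\<close>
      have reidx: "(\<Sum>L\<in>Pow {1..N}. if i \<in> L then s (- ((-1) ^ card {k \<in> L. k < i})) (\<Phi> j n m v I K (L - {i}) (x L)) else 0)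
         = (\<Sum>L\<in>Pow {1..N}. if i \<in> L then 0 else s (- ((-1) ^ card {k \<in> L. k < i})) (\<Phi> j n m v I K L (x (insert i L))))"
      proof -
        have "(\<Sum>L\<in>Pow {1..N}. if i \<in> L then s (- ((-1) ^ card {k \<in> L. k < i})) (\<Phi> j n m v I K (L - {i}) (x L)) else 0)
          = (\<Sum>L\<in>{L \<in> Pow {1..N}. i \<in> L}. s (- ((-1) ^ card {k \<in> L. k < i})) (\<Phi> j n m v I K (L - {i}) (x L)))"
          by (rule sum.inter_filter[symmetric]) simp
        also have "\<dots> = (\<Sum>L\<in>{L \<in> Pow {1..N}. i \<notin> L}. s (- ((-1) ^ card {k \<in> L. k < i})) (\<Phi> j n m v I K L (x (insert i L))))"
        proof (rule sum.reindex_bij_witness[of _ "insert i" "\<lambda>L. L - {i}"])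
          fix L assume L: "L \<in> {L \<in> Pow {1..N}. i \<in> L}"
          have "{k \<in> L - {i}. k < i} = {k \<in> L. k < i}" "insert i (L - {i}) = L" using L by auto
          then show "s (- ((-1) ^ card {k \<in> L - {i}. k < i})) (\<Phi> j n m v I K (L - {i}) (x (insert i (L - {i}))))
             = s (- ((-1) ^ card {k \<in> L. k < i})) (\<Phi> j n m v I K (L - {i}) (x L))"
            by (simp only:)
        qed (use i in auto)
        also have "\<dots> = (\<Sum>L\<in>Pow {1..N}. if i \<notin> L then s (- ((-1) ^ card {k \<in> L. k < i})) (\<Phi> j n m v I K L (x (insert i L))) else 0)"
          by (rule sum.inter_filter) simp
        also have "\<dots> = (\<Sum>L\<in>Pow {1..N}. if i \<in> L then 0 else s (- ((-1) ^ card {k \<in> L. k < i})) (\<Phi> j n m v I K L (x (insert i L))))"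
          by (rule sum.cong) auto
        finally show ?thesis .
      qed
      have "(\<Sum>L\<in>Pow {1..N}. s ((-1) ^ card I) (\<Phi> j n m v I (insert i K) L (x L)))
        = (\<Sum>L\<in>Pow {1..N}. (if i \<in> L then 0 else s (- ((-1) ^ card {k \<in> L. k < i})) (\<Phi> j n m v I K L (x (insert i L))))
            + s ((-1) ^ card L) (\<Phi> j n m v I K L (S i (x L))))"
        unfolding split sum.distrib reidx ..
      \<comment> \<open>For each L the kernel term cancels the part of S^i(x L) with index
        \<open>insert i L\<close>, leaving the mode applied to S^i b.\<close>
      also have "\<dots> = (\<Sum>L\<in>Pow {1..N}. s ((-1) ^ p) (\<Phi> j n m v I K L (Y a (-1 - int j) L (S i b))))"
      proof (rule sum.cong[OF refl])
        fix L
        have "s ((-1) ^ card L) (\<Phi> j n m v I K L (S i (x L))) = \<Phi> j n m v I K L (s ((-1) ^ card L) (S i (x L)))"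
          by (rule lin_scale[OF Phi_lin, symmetric])
        also have "\<dots> = \<Phi> j n m v I K L (s ((-1) ^ p) (Y a (-1 - int j) L (S i b))
            + (if i \<in> L then 0 else s ((-1) ^ card {k \<in> L. k < i}) (x (insert i L))))"
          unfolding x_def S_mode_alt[OF a i] ..
        finally show "(if i \<in> L then 0 else s (- ((-1) ^ card {k \<in> L. k < i})) (\<Phi> j n m v I K L (x (insert i L))))
            + s ((-1) ^ card L) (\<Phi> j n m v I K L (S i (x L)))
            = s ((-1) ^ p) (\<Phi> j n m v I K L (Y a (-1 - int j) L (S i b)))"
          by (simp add: lin_add[OF Phi_lin] lin_scale[OF Phi_lin] lin_0[OF Phi_lin])
      qed
      finally show ?thesis unfolding x_def .
    qed
    have "s ((-1) ^ card I) (supercomm s p q (Y a) (Y b) n I m (insert i K) v)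
       = s ((-1) ^ p) (supercomm s p (Suc q) (Y a) (Y (S i b)) n I m K v)"
      by (rule supercomm_shift[OF b i lt insert(1)])
    also have "\<dots> = s ((-1) ^ p) (\<Sum>j<M. \<Sum>L\<in>Pow {1..N}. \<Phi> j n m v I K L (Y a (-1 - int j) L (S i b)))"
      by (subst insert.IH[OF K Sb M']) auto
    also have "\<dots> = s ((-1) ^ card I) (\<Sum>j<M. \<Sum>L\<in>Pow {1..N}. \<Phi> j n m v I (insert i K) L (Y a (-1 - int j) L b))"
      unfolding scale_sum_right * ..
    finally show ?case by (simp only: sign_cancel)
  qed
qed

end

section \<open>Closed form of the super delta function and its derivatives\<close>

lemma bin_zw_minus_bin_wz:
  "bin_zw (-1 - int j) n m - bin_wz (-1 - int j) n m
     = (if n + m = -1 - int j then of_int (-1 - n) gchoose j else 0)"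
proof (cases "n + m = -1 - int j")
  case False
  then show ?thesis by (simp add: bin_zw_def bin_wz_def)
next
  case nm: True
  show ?thesis
  \<comment> \<open>For n \<ge> 0 only the expansion in |w| > |z| contributes, for m \<ge> 0 only
    the other. If both are negative, then 0 \<le> -1-n < j and the binomial coefficient is zero as
    well.\<close>
  proof (cases "n \<ge> 0")
    case True
    define k where "k = nat n"
    have n: "n = int k" and m: "m = -1 - int j - int k" using True nm by (auto simp: k_def)
    have g: "((of_int (-1 - int j) :: complex) gchoose k) = (-1) ^ k * of_nat ((j + k) choose k)"
      by (subst gbinomial_negated_upper) (simp add: binomial_gbinomial algebra_simps)
    have h: "((of_int (-1 - n) :: complex) gchoose j) = (-1) ^ j * of_nat ((j + k) choose j)"
      unfolding n by (subst gbinomial_negated_upper) (simp add: binomial_gbinomial algebra_simps)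
    have "(-1 :: complex) powi m = - ((-1) ^ j * (-1) ^ k)"
      unfolding m by (simp add: power_int_diff power_int_minus power_int_add field_simps flip: power_mult_distrib)
    moreover have "(j + k) choose k = (j + k) choose j"
      using binomial_symmetric[of k "j + k"] by simp
    ultimately show ?thesis
      using nm n m g h by (simp add: bin_zw_def bin_wz_def flip: power_mult_distrib)
  next
    case n: False
    show ?thesis
    proof (cases "m \<ge> 0")
      case True
      define k where "k = nat m"
      have m: "m = int k" and e: "-1 - n = int (j + k)" using True nm by (auto simp: k_def)
      have g: "((of_int (-1 - int j) :: complex) gchoose k) = (-1) ^ k * of_nat ((j + k) choose k)"
        by (subst gbinomial_negated_upper) (simp add: binomial_gbinomial algebra_simps)
      have h: "((of_int (-1 - n) :: complex) gchoose j) = of_nat ((j + k) choose j)"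
        unfolding e by (simp add: binomial_gbinomial)
      have "(j + k) choose k = (j + k) choose j"
        using binomial_symmetric[of k "j + k"] by simp
      then show ?thesis
        using nm n m g h by (simp add: bin_zw_def bin_wz_def flip: power_mult_distrib)
    next
      case False
      define k where "k = nat (-1 - n)"
      have e: "-1 - n = int k" and k: "k < j" using False n nm by (auto simp: k_def)
      have "((of_int (-1 - n) :: complex) gchoose j) = of_nat (k choose j)"
        unfolding e by (simp add: binomial_gbinomial)
      also have "\<dots> = 0" using k by (simp add: binomial_eq_0)
      finally show ?thesis
        using nm n False by (simp add: bin_zw_def bin_wz_def)
    qed
  qed
qed

lemma ipow_diff_eq:
  assumes "finite J"
  shows "ipow_diff (-1 - int j) J
    = (\<lambda>n I m K. oddpow J I K * (if n + m = -1 - int j then of_int (-1 - n) gchoose j else 0))"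
  unfolding ipow_diff_def ipow_zw_eq[OF assms] ipow_wz_eq[OF assms] right_diff_distrib[symmetric]
    bin_zw_minus_bin_wz ..

text \<open>Writing (\<theta>-\<zeta>)^N as \<sigma>(J) (\<theta>-\<zeta>)^J
  (\<theta>-\<zeta>)^(N-J), the #J derivatives give (-1)^#J from the -\<zeta>^i and
  (-1)^(#J(#J-1)/2) from their order. The product is the sign built into \<open>dW\<close>.\<close>

lemma foldr_dzeta_oddpow:
  assumes "J \<subseteq> {1..N}"
  shows "foldr dzeta (sorted_list_of_set J) (\<lambda>n I m K. oddpow {1..N} I K * e n m)
    = (\<lambda>n I m K. sigma N J * (-1) ^ (card J * (card J + 1) div 2) * oddpow ({1..N} - J) I K * e n m)"
proof -
  have "finite J" by (rule finite_subset[OF assms]) simp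
  then show ?thesis using assms
  proof (induction J rule: finite_linorder_min_induct)
    case empty
    then show ?case by (simp add: sigma_def)
  next
    case (insert i J)
    have i: "i \<in> {1..N}" "i \<notin> J" and J: "J \<subseteq> {1..N}" using insert by auto
    define c where "c = (\<lambda>J. sigma N J * (-1) ^ (card J * (card J + 1) div 2))"
    have "sorted_list_of_set (insert i J) = i # sorted_list_of_set J"
      using insert i by (simp add: insort_is_Cons less_imp_le)
    then have "foldr dzeta (sorted_list_of_set (insert i J)) (\<lambda>n I m K. oddpow {1..N} I K * e n m)
       = dzeta i (\<lambda>n I m K. c J * oddpow ({1..N} - J) I K * e n m)"
      using insert.IH[OF J] by (simp add: c_def)
    also have "\<dots> = (\<lambda>n I m K. c (insert i J) * oddpow ({1..N} - insert i J) I K * e n m)"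
    proof (intro ext)
      fix n I m K
      have N: "{1..N} - insert i J = ({1..N} - J) - {i}" "i \<in> {1..N} - J" using i by auto
      show "dzeta i (\<lambda>n I m K. c J * oddpow ({1..N} - J) I K * e n m) n I m K
        = c (insert i J) * oddpow ({1..N} - insert i J) I K * e n m"
      proof (cases "finite I \<and> finite K \<and> i \<notin> K")
        case True
        have "{k \<in> insert i J. i < k} = J" using insert(2) i by auto
        moreover have "insert i J - {i} = J" using i by auto
        moreover have "{k \<in> {1..N} - insert i J. k < i} = {k \<in> {1..N} - J. k < i}" by auto
        ultimately have "sigma N (insert i J) = (-1) ^ (card {k \<in> {1..N} - J. k < i} + card J) * sigma N J"
          using sigma_remove[of i "insert i J" N] insert.prems by (simp only: insertI1)
        moreover have "card (insert i J) * (card (insert i J) + 1) div 2 = card J * (card J + 1) div 2 + (card J + 1)"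
        proof -
          have "card (insert i J) * (card (insert i J) + 1) = card J * (card J + 1) + 2 * (card J + 1)"
            using i insert(1) by simp
          then show ?thesis by simp
        qed
        ultimately have c: "c (insert i J) = - ((-1) ^ card {k \<in> {1..N} - J. k < i}) * c J"
          by (simp add: c_def power_add flip: power_mult_distrib)
        have "(-1) ^ (card I + card {k \<in> K. k < i}) * oddpow ({1..N} - J) I (insert i K)
           = - ((-1) ^ card {k \<in> {1..N} - J. k < i} * oddpow ({1..N} - insert i J) I K)"
          unfolding N(1) by (subst oddpow_shift) (use True N(2) in auto)
        then show ?thesis
          using True unfolding dzeta_def c by (simp add: mult_ac)
      next
        case False
        have "\<not> I \<union> insert i K = {1..N} - J" "\<not> I \<union> K = {1..N} - insert i J" if "i \<notin> K"
          using False that by (metis finite_Diff finite_Un finite_atLeastAtMost finite_insert)+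
        moreover have "\<not> I \<union> K = {1..N} - insert i J" if "i \<in> K" using that by auto
        ultimately show ?thesis by (auto simp: dzeta_def oddpow_def)
      qed
    qed
    finally show ?case by (simp only: c_def)
  qed
qed

lemma funpow_dw:
  "(dw ^^ j) (\<lambda>n I m K. h I K * (if n + m = -1 then 1 else 0))
    = (\<lambda>n I m K. h I K * (fact j * (if n + m = -1 - int j then of_int (-1 - n) gchoose j else 0)))"
proof (induction j)
  case 0
  then show ?case by (simp cong: if_cong)
next
  case (Suc j)
  have "of_int (m + 1) * (fact j * ((of_int (-1 - n) :: complex) gchoose j)) = fact (Suc j) * (of_int (-1 - n) gchoose Suc j)"
    if "n + m = -1 - int (Suc j)" for n m
  proof -
    have "(of_int (-1 - n) - of_nat j :: complex) * (of_int (-1 - n) gchoose j) = of_nat (Suc j) * (of_int (-1 - n) gchoose Suc j)"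
      using gbinomial_absorb_comp[of "of_int (-1 - n) :: complex" j] gbinomial_absorption[of j "of_int (-1 - n) :: complex"]
      by simp
    moreover have "of_int (-1 - n) - of_nat j = (of_int (m + 1) :: complex)"
    proof -
      have "-1 - n - int j = m + 1" using that by simp
      then show ?thesis by (metis of_int_diff of_int_of_nat_eq)
    qed
    ultimately show ?thesis by (simp only: fact_Suc mult.left_commute mult.assoc)
  qed
  then have "of_int (m + 1) * (h I K * (fact j * (if n + (m + 1) = -1 - int j then of_int (-1 - n) gchoose j else 0)))
      = h I K * (fact (Suc j) * (if n + m = -1 - int (Suc j) then of_int (-1 - n) gchoose Suc j else 0))" for n m I K
    by (cases "n + m = -1 - int (Suc j)") (simp_all del: fact_Suc of_int_add of_int_diff add: mult.left_commute[of _ "h I K"])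
  then show ?case
    by (simp only: funpow.simps comp_apply Suc) (simp only: dw_def)
qed

text \<open>Both signs occur squared, and j! cancels; this makes the two forms of the OPE formula
  agree term by term.\<close>

lemma dW_super_delta:
  assumes "J \<subseteq> {1..N}"
  shows "(\<lambda>n I m K. sigma N J * dW j J (super_delta N) n I m K) = ipow_diff (-1 - int j) ({1..N} - J)"
proof -
  define t where "t = card J * (card J + 1) div 2"
  have d: "super_delta N = (\<lambda>n I m K. oddpow {1..N} I K * (if n + m = -1 then 1 else 0))"
    using ipow_diff_eq[of "{1..N}" 0] by (simp add: super_delta_def cong: if_cong)
  have sq: "sigma N J * sigma N J = 1" by (simp add: sigma_def)
  have "(-1 :: complex) ^ t * (-1) ^ t = 1" by (simp flip: power_mult_distrib)
  then have c: "sigma N J * ((-1) ^ t / fact j * (sigma N J * (-1) ^ t * x * (fact j * y))) = x * y" for x y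
    using sq by (simp add: field_simps)
  show ?thesis
    unfolding dW_def d foldr_dzeta_oddpow[OF assms] funpow_dw ipow_diff_eq[OF finite_Diff[OF finite_atLeastAtMost]]
      t_def[symmetric] c ..
qed

section \<open>Normally ordered products and assembly of the OPE formula\<close>

context nw_susy_vertex_algebra
begin

text \<open>The residue against the expansion of (z-w)^-1 for |z| > |w| selects a_+ (sum
  \<open>P\<close>), that for |w| > |z| selects -a_- (sum \<open>Q\<close>), and the minus sign of
  the bracket makes the latter positive.\<close>

lemma Y_normal_prod:
  "field_nth_prod s N p q (Y a) (-1) {1..N} (Y b) = normal_prod s p q (Y a) (Y b)"
proof (intro ext)
  fix m K v
  define P where "P = (\<lambda>I L. Sum_any (\<lambda>k::nat. Y a (int k) I (Y b (m - int k) L v)))"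
  define Q where "Q = (\<lambda>I L. Sum_any (\<lambda>k::nat. Y b (m + 1 + int k) L (Y a (-1 - int k) I v)))"
  have co: "signed_binom (-1) k = 1" for k
    using binomial_gbinomial[of k k, where 'a = complex]
    by (simp add: signed_binom_def gbinomial_minus flip: power_mult_distrib)
  have mult_zw: "mult_zw (-1) F n' m' = Sum_any (\<lambda>k::nat. F (n' + 1 + int k) (m' - int k))" for F :: "int \<Rightarrow> int \<Rightarrow> 'v" and n' m'
    by (simp add: mult_zw_def co)
  have G: "nth_prod_coeff p q a b (-1) m v I L = s ((-1) ^ ((p + card I) * card L)) (P I L)
      + s ((-1) ^ (p * q) * (-1) ^ (q * card I)) (Q I L)" for I L
  proof -
    have "nprod \<epsilon> (-1) (\<lambda>n. Y a n I) (\<lambda>m. Y b m L) m v = P I L + s \<epsilon> (Q I L)" for \<epsilon>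
      by (simp add: nprod_def mult_wz_def mult_zw P_def Q_def)
    moreover have "(-1 :: complex) ^ ((p + card I) * card L) * (-1) ^ ((p + card I) * (q + card L))
      = (-1) ^ (p * q) * (-1) ^ (q * card I)"
      unfolding power_add[symmetric] minus_one_power_iff by (simp add: algebra_simps)
    ultimately show ?thesis
      by (simp add: nth_prod_coeff_def scale_right_distrib)
  qed
  have ZZ1: "prod_ZZ s p (plus_part (Y a)) (Y b) m K v
      = (\<Sum>I\<in>Pow K. s (shuffle_sign I (K - I) * (-1) ^ ((p + card I) * card (K - I))) (P I (K - I)))"
  proof -
    have "Sum_any (\<lambda>k. plus_part (Y a) k I (Y b (m - k) L v)) = P I L" for I L
      unfolding P_def
    proof (subst Sum_any_reindex[of int])
      fix k assume "k \<notin> range int"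
      then have "k < 0" using zero_le_imp_eq_int[of k] by (cases "k < 0") auto
      then show "plus_part (Y a) k I (Y b (m - k) L v) = 0" by (simp add: plus_part_def)
    qed (simp_all add: plus_part_def)
    then show ?thesis unfolding prod_ZZ_def Sum_any_scale by simp
  qed
  have ZZ2: "prod_ZZ s q (Y b) (minus_part (Y a)) m K v
      = (\<Sum>I\<in>Pow K. s (shuffle_sign I (K - I) * (-1) ^ ((q + card I) * card (K - I))) (Q (K - I) I))"
  proof -
    have "Sum_any (\<lambda>k. Y b k I (minus_part (Y a) (m - k) L v)) = Q L I" for I L
      unfolding Q_def
    proof (subst Sum_any_reindex[of "\<lambda>k. m + 1 + int k"])
      show "inj (\<lambda>k. m + 1 + int k)" by (simp add: inj_def)
      fix k assume "k \<notin> range (\<lambda>k. m + 1 + int k)"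
      then have "m - k \<ge> 0"
        using zero_le_imp_eq_int[of "k - m - 1"] by (cases "m - k \<ge> 0") (auto simp: image_iff algebra_simps)
      then show "Y b k I (minus_part (Y a) (m - k) L v) = 0"
        by (simp add: minus_part_def plus_part_def lin_0[OF Y_lin])
    qed (simp add: minus_part_def plus_part_def algebra_simps)
    then show ?thesis unfolding prod_ZZ_def Sum_any_scale by simp
  qed
  show "field_nth_prod s N p q (Y a) (-1) {1..N} (Y b) m K v = normal_prod s p q (Y a) (Y b) m K v"
  proof (cases "K \<subseteq> {1..N}")
    case False
    have "P I (K - I) = 0 \<and> Q (K - I) I = 0" for I
    proof (cases "I \<subseteq> {1..N}")
      case True
      then have "\<not> K - I \<subseteq> {1..N}" using False by blast
      then show ?thesis unfolding P_def Q_def by (simp add: Y_support[of "K - I"] lin_0[OF Y_lin])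
    next
      case nI: False
      then show ?thesis unfolding P_def Q_def by (simp add: Y_support[OF nI] lin_0[OF Y_lin])
    qed
    then show ?thesis
      unfolding normal_prod_def ZZ1 ZZ2 field_nth_prod_outside[OF order_refl False] by simp
  next
    case K: True
    have finK: "finite K" by (rule finite_subset[OF K]) simp
    \<comment> \<open>Under the residue (\<theta>-\<zeta>)^N acts as an odd delta function: the
      kernel monomial with \<zeta>^K' needs \<theta>^K' from a, so \<theta> is replaced by \<zeta>
      in a.\<close>
    let ?u = "\<lambda>K'. s (shuffle_sign K' (K - K')) (nth_prod_coeff p q a b (-1) m v K' (K - K'))"
    have "field_nth_prod s N p q (Y a) (-1) {1..N} (Y b) m K v
      = (\<Sum>I'\<in>Pow {1..N}. \<Sum>K'\<in>Pow K. if I' = {1..N} - K' then ?u K' else 0)"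
      unfolding field_nth_prod_eq[OF order_refl] odd_mult_def
    proof (intro sum.cong refl)
      fix I' K' assume I': "I' \<in> Pow {1..N}" and K': "K' \<in> Pow K"
      show "s ((-1) ^ (card K' * card ({1..N} - I')) * shuffle_sign I' ({1..N} - I') * shuffle_sign K' (K - K')
           * oddpow {1..N} I' K') (nth_prod_coeff p q a b (-1) m v ({1..N} - I') (K - K'))
         = (if I' = {1..N} - K' then ?u K' else 0)"
      proof (cases "I' = {1..N} - K'")
        case False
        then have "oddpow {1..N} I' K' = 0"
          unfolding oddpow_def by (intro if_not_P) blast
        then show ?thesis using False by simp
      next
        case True
        have *: "{1..N} - I' = K'" "I' \<union> K' = {1..N}" "I' \<inter> K' = {}" using True K' K by auto
        have sq: "(-1 :: complex) ^ (card K' * card K') * (-1) ^ card K' = 1"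
          unfolding power_add[symmetric] minus_one_power_iff by simp
        have assoc: "x * z * w * (y * z) = (x * y) * (z * z) * w" for x y z w :: complex
          by (simp only: mult_ac)
        have "(-1) ^ (card K' * card K') * shuffle_sign I' K' * shuffle_sign K' (K - K') * ((-1) ^ card K' * shuffle_sign I' K')
           = shuffle_sign K' (K - K')"
          unfolding assoc sq shuffle_sign_square by simp
        then show ?thesis using True unfolding oddpow_def * by simp
      qed
    qed
    also have "\<dots> = (\<Sum>K'\<in>Pow K. \<Sum>I'\<in>Pow {1..N}. if I' = {1..N} - K' then ?u K' else 0)"
      by (rule sum.swap)
    also have "\<dots> = (\<Sum>K'\<in>Pow K. ?u K')"
      by (intro sum.cong refl) (simp add: sum.delta)
    also have "\<dots> = (\<Sum>I\<in>Pow K. s (shuffle_sign I (K - I) * (-1) ^ ((p + card I) * card (K - I))) (P I (K - I)))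
      + (\<Sum>I\<in>Pow K. s (shuffle_sign I (K - I) * ((-1) ^ (p * q) * (-1) ^ (q * card I))) (Q I (K - I)))"
      by (simp add: G scale_right_distrib sum.distrib)
    \<comment> \<open>In b a_- the odd monomial of b comes first, so the sum is reindexed by
      complements in K; \<open>shuffle_sign_swap\<close> accounts for the exchange.\<close>
    also have "(\<Sum>I\<in>Pow K. s (shuffle_sign I (K - I) * ((-1) ^ (p * q) * (-1) ^ (q * card I))) (Q I (K - I)))
      = (\<Sum>I\<in>Pow K. s ((-1) ^ (p * q)) (s (shuffle_sign I (K - I) * (-1) ^ ((q + card I) * card (K - I))) (Q (K - I) I)))"
    proof (rule sum.reindex_bij_witness[of _ "\<lambda>I. K - I" "\<lambda>I. K - I"])
      fix I assume "I \<in> Pow K"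
      then have I: "K - (K - I) = I" "finite I" using finK finite_subset by auto
      have "shuffle_sign I (K - I) * shuffle_sign (K - I) I = (-1) ^ (card I * card (K - I))"
        by (rule shuffle_sign_swap) (use I finK in auto)
      then have "shuffle_sign (K - I) I = shuffle_sign I (K - I) * (-1) ^ (card I * card (K - I))"
        using shuffle_sign_square[of I "K - I"] by (metis mult.assoc mult_1_left)
      then have "(-1) ^ (p * q) * (shuffle_sign (K - I) I * (-1) ^ ((q + card (K - I)) * card I))
        = shuffle_sign I (K - I) * ((-1) ^ (p * q) * (-1) ^ (q * card I))"
        by (simp add: power_add algebra_simps flip: power_mult_distrib)
      then show "s ((-1) ^ (p * q)) (s (shuffle_sign (K - I) (K - (K - I)) * (-1) ^ ((q + card (K - I)) * card (K - (K - I)))) (Q (K - (K - I)) (K - I)))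
        = s (shuffle_sign I (K - I) * ((-1) ^ (p * q) * (-1) ^ (q * card I))) (Q I (K - I))"
        unfolding I by simp
    qed auto
    finally show ?thesis unfolding normal_prod_def ZZ1 ZZ2 scale_sum_right .
  qed
qed

lemma modes_bounded:
  obtains M where "\<And>j L. j \<ge> M \<Longrightarrow> Y a (-1 - int j) L b = 0"
proof -
  obtain n0 where "\<And>n I. n < n0 \<Longrightarrow> Y a n I b = 0"
    using Y_field[of a] unfolding susy_field_def by metis
  then show ?thesis by (intro that[of "nat (- n0)"]) auto
qed

lemma finite_modes: "finite {(j, J). j \<ge> 0 \<and> J \<subseteq> {1..N} \<and> mode N Y a j J b \<noteq> 0}"
proof -
  obtain M where M: "\<And>j L. j \<ge> M \<Longrightarrow> Y a (-1 - int j) L b = 0" using modes_bounded by blast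
  have "{(j, J). j \<ge> 0 \<and> J \<subseteq> {1..N} \<and> mode N Y a j J b \<noteq> 0} \<subseteq> {0..<int M} \<times> Pow {1..N}"
  proof clarsimp
    fix j J assume "0 \<le> j" "mode N Y a j J b \<noteq> 0"
    then show "j < int M" using M[of "nat j"] by (cases "nat j \<ge> M") (auto simp: mode_def)
  qed
  then show ?thesis by (rule finite_subset) simp
qed

lemma in_W_term:
  assumes "J \<subseteq> {1..N}"
  shows "op_mult2 s (ipow_diff (-1 - int j) J) (in_W (Y x)) n I m K v = \<Phi> j n m v I K J x"
proof -
  have fin: "finite J" by (rule finite_subset[OF assms]) simp
  let ?e = "\<lambda>n m. if n + m = -1 - int j then of_int (-1 - n) gchoose j else (0 :: complex)"
  have "even_mult ?e (\<lambda>n m. in_W (Y x) n I m K v) n m = ope_coeff j n m v x I K" for I K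
  proof -
    \<comment> \<open>Y(x,W) lives at z^0 only, which forces n' = n; the kernel then forces m', and
      a single term is left.\<close>
    have "even_mult ?e (\<lambda>n m. in_W (Y x) n I m K v) n m
        = (\<Sum>(n', m')\<in>{(n, -1 - int j - n)}. s (?e n' m') (in_W (Y x) (n - n') I (m - m') K v))"
      unfolding even_mult_def
      by (rule Sum_any.expand_superset) (auto simp: in_W_def split: if_splits)
    then show ?thesis by (simp add: in_W_def ope_coeff_def algebra_simps)
  qed
  then show ?thesis
    unfolding ipow_diff_eq[OF fin] op_mult2_tensor by simp
qed

lemma ope:
  assumes a: "a \<in> homog V0 V1 p" and b: "b \<in> homog V0 V1 q"
  shows "supercomm s p q (Y a) (Y b) n I m K v
    = (\<Sum>(j, J)\<in>{(j, J). j \<ge> 0 \<and> J \<subseteq> {1..N} \<and> mode N Y a j J b \<noteq> 0}.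
         op_mult2 s (ipow_diff (-1 - j) ({1..N} - J)) (in_W (Y (mode N Y a j J b))) n I m K v)"
proof -
  let ?A = "{(j, J). j \<ge> 0 \<and> J \<subseteq> {1..N} \<and> mode N Y a j J b \<noteq> 0}"
  let ?t = "\<lambda>(j, J). \<Phi> (nat j) n m v I K ({1..N} - J) (mode N Y a j J b)"
  have t: "(\<Sum>(j, J)\<in>?A. op_mult2 s (ipow_diff (-1 - j) ({1..N} - J)) (in_W (Y (mode N Y a j J b))) n I m K v)
      = (\<Sum>x\<in>?A. ?t x)"
  proof (rule sum.cong[OF refl], clarify)
    fix j :: int and J assume "0 \<le> j"
    then show "op_mult2 s (ipow_diff (-1 - j) ({1..N} - J)) (in_W (Y (mode N Y a j J b))) n I m K v
       = \<Phi> (nat j) n m v I K ({1..N} - J) (mode N Y a j J b)"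
      using in_W_term[of "{1..N} - J" "nat j"] by auto
  qed
  show ?thesis
  proof (cases "I \<subseteq> {1..N} \<and> K \<subseteq> {1..N}")
    case True
    obtain M where M: "\<And>j L. j \<ge> M \<Longrightarrow> Y a (-1 - int j) L b = 0" using modes_bounded by blast
    have "(\<Sum>x\<in>?A. ?t x) = (\<Sum>x\<in>{0..<int M} \<times> Pow {1..N}. ?t x)"
    proof (rule sum.mono_neutral_left)
      show "?A \<subseteq> {0..<int M} \<times> Pow {1..N}"
      proof clarsimp
        fix j J assume "0 \<le> j" "mode N Y a j J b \<noteq> 0"
        then show "j < int M" using M[of "nat j"] by (cases "nat j \<ge> M") (auto simp: mode_def)
      qed
      show "\<forall>x\<in>{0..<int M} \<times> Pow {1..N} - ?A. ?t x = 0"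
        by (auto simp: lin_0[OF Phi_lin])
    qed simp
    \<comment> \<open>The mode with index J is the coefficient at L = {1..N} - J.\<close>
    also have "\<dots> = (\<Sum>(j, L)\<in>{..<M} \<times> Pow {1..N}. \<Phi> j n m v I K L (Y a (-1 - int j) L b))"
      by (rule sum.reindex_bij_witness[of _ "\<lambda>(j, L). (int j, {1..N} - L)" "\<lambda>(j, J). (nat j, {1..N} - J)"])
        (auto simp: mode_def double_diff)
    also have "\<dots> = (\<Sum>j<M. \<Sum>L\<in>Pow {1..N}. \<Phi> j n m v I K L (Y a (-1 - int j) L b))"
      by (rule sum.cartesian_product[symmetric])
    also have "\<dots> = supercomm s p q (Y a) (Y b) n I m K v"
      by (rule supercomm_expansion[OF a b _ _ M, symmetric]) (use True in auto)
    finally show ?thesis unfolding t by (rule sym)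
  next
    case False
    \<comment> \<open>Equality of formal sums also concerns index sets outside {1..N}, where both
      sides are zero by convention.\<close>
    have "supercomm s p q (Y a) (Y b) n I m K v = 0"
    proof (cases "I \<subseteq> {1..N}")
      case True
      with False have "\<not> K \<subseteq> {1..N}" by blast
      then show ?thesis by (simp add: supercomm_def prod_ZW_def prod_WZ_def Y_support[of K] lin_0[OF Y_lin])
    next
      case nI: False
      then show ?thesis by (simp add: supercomm_def prod_ZW_def prod_WZ_def Y_support[OF nI] lin_0[OF Y_lin])
    qed
    moreover have "?t x = 0" for x
    proof (cases x)
      case (Pair j J)
      have "\<Phi> (nat j) n m v I K ({1..N} - J) y = 0" for y
      proof (rule odd_mult_zero)
        fix I' K' assume *: "I' \<subseteq> I" "K' \<subseteq> K" "oddpow ({1..N} - J) I' K' \<noteq> 0"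
        then have IK: "I' \<union> K' = {1..N} - J" by (auto simp: oddpow_def split: if_splits)
        show "ope_coeff (nat j) n m v y (I - I') (K - K') = 0"
        proof (cases "I - I' = {}")
          case True
          then have "\<not> K - K' \<subseteq> {1..N}" using False IK by blast
          then show ?thesis by (simp add: ope_coeff_def Y_support)
        next
          case False
          then show ?thesis unfolding ope_coeff_def by (simp only: if_False)
        qed
      qed
      then show ?thesis by (simp add: Pair)
    qed
    ultimately show ?thesis unfolding t by simp
  qed
qed

end

theorem theorem3p3p9:
  fixes s :: "complex \<Rightarrow> 'v::ab_group_add \<Rightarrow> 'v" and V0 V1 :: "'v set"
    and N :: nat and vac :: 'v and T :: "'v \<Rightarrow> 'v" and S :: "nat \<Rightarrow> 'v \<Rightarrow> 'v"
    and Y :: "'v \<Rightarrow> ('v \<Rightarrow> 'v) sdist"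
    and a b :: 'v and p q :: nat
  assumes "nw_susy_vertex_algebra s V0 V1 N vac T S Y"
    and "a \<in> homog V0 V1 p" and "b \<in> homog V0 V1 q"
  shows
    "(\<forall>j J. J \<subseteq> {1..N} \<longrightarrow>
        Y (mode N Y a j J b)
          = (\<lambda>n I v. s (sigma N J) (field_nth_prod s N p q (Y a) j J (Y b) n I v)))
   \<and> Y (mode N Y a (-1) {1..N} b) = normal_prod s p q (Y a) (Y b)
   \<and> Y (T a) = dz s (Y a)
   \<and> (\<forall>i\<in>{1..N}. Y (S i a) = dtheta s i (Y a))
   \<and> finite {(j, J). j \<ge> 0 \<and> J \<subseteq> {1..N} \<and> mode N Y a j J b \<noteq> 0}
   \<and> supercomm s p q (Y a) (Y b)
       = (\<lambda>n I m K v. \<Sum>(j, J) \<in> {(j, J). j \<ge> 0 \<and> J \<subseteq> {1..N} \<and> mode N Y a j J b \<noteq> 0}.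
            op_mult2 s (\<lambda>n I m K. sigma N J * dW (nat j) J (super_delta N) n I m K)
              (in_W (Y (mode N Y a j J b))) n I m K v)
   \<and> supercomm s p q (Y a) (Y b)
       = (\<lambda>n I m K v. \<Sum>(j, J) \<in> {(j, J). j \<ge> 0 \<and> J \<subseteq> {1..N} \<and> mode N Y a j J b \<noteq> 0}.
            op_mult2 s (ipow_diff (-1 - j) ({1..N} - J))
              (in_W (Y (mode N Y a j J b))) n I m K v)"
proof -
  interpret nw_susy_vertex_algebra s V0 V1 N vac T S Y by fact
  note a = assms(2) and b = assms(3)
  let ?A = "{(j, J). j \<ge> 0 \<and> J \<subseteq> {1..N} \<and> mode N Y a j J b \<noteq> 0}"
  have 1: "Y (mode N Y a j J b) = (\<lambda>n I v. s (sigma N J) (field_nth_prod s N p q (Y a) j J (Y b) n I v))"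
    if "J \<subseteq> {1..N}" for j J
    using Y_mode[OF a b that] by (simp add: fun_eq_iff)
  \<comment> \<open>This is (1) at (-1|N), where \<sigma>(N) = 1.\<close>
  have 2: "Y (mode N Y a (-1) {1..N} b) = normal_prod s p q (Y a) (Y b)"
    unfolding 1[OF order_refl] Y_normal_prod by (simp add: sigma_def)
  have 5: "supercomm s p q (Y a) (Y b) = (\<lambda>n I m K v. \<Sum>(j, J)\<in>?A.
      op_mult2 s (ipow_diff (-1 - j) ({1..N} - J)) (in_W (Y (mode N Y a j J b))) n I m K v)"
    by (intro ext) (rule ope[OF a b])
  have "(\<lambda>n I m K. sigma N J * dW (nat j) J (super_delta N) n I m K) = ipow_diff (-1 - j) ({1..N} - J)"
    if "j \<ge> 0" "J \<subseteq> {1..N}" for j J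
    using dW_super_delta[OF that(2), of "nat j"] that(1) by simp
  then have "supercomm s p q (Y a) (Y b) = (\<lambda>n I m K v. \<Sum>(j, J)\<in>?A.
      op_mult2 s (\<lambda>n I m K. sigma N J * dW (nat j) J (super_delta N) n I m K)
        (in_W (Y (mode N Y a j J b))) n I m K v)"
    unfolding 5 by (intro ext sum.cong refl) auto
  then show ?thesis
    using 1 2 5 Y_T[OF a] Y_S[OF a] finite_modes by blast
qed

end
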